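(* Let $\Omega\subset\mathbb{R}^d$ be a bounded domain with Lipschitz boundary, let $J$ be a functional on $L^q(\Omega)$ such that $\|u\|_{BV}\le C\,J(u)$ for some constant $C>0$ and all $u$, and let $T$ be a functional on $L^q(\Omega)$ that is CBV-coercive (with respect to $J$). If $1\le q<\frac{d}{d-1}$ and $T$ is lower semi-continuous on $L^q(\Omega)$, then the problem $\min_{u\in L^q(\Omega)}T(u)$ has a solution. If instead $q=\frac{d}{d-1}$, $d\ge 2$, and $T$ is weakly lower semi-continuous on $L^q(\Omega)$, then a solution also exists. In either case, the solution is unique if $T$ is strictly convex.
   Context: The functionals $T$ and $J$ may take the value $+\infty$. $T$ is called CBV-coercive (with respect to $J$) if $T(u)\to+\infty$ whenever $J(u)\to+\infty$, where $J$ is a functional satisfying $\|u\|_{BV}\le C\,J(u)$. The BV norm is $\|u\|_{BV}:=\|u\|_{L^1(\Omega)}+\|u\|_{\dot{BV}}$, where $\|u\|_{\dot{BV}}:=\sup_{\sigma\in V}\int_\Omega(-u\,\mathrm{div}\,\sigma)\,dx$ and $V:=\{\sigma\in C_c^1(\Omega;\mathbb{R}^d):|\sigma(x)|\le 1\text{ for all }x\in\Omega\}$ (with value $+\infty$ if $u$ is not of bounded variation). *)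

theory Defs
  imports "HOL-Analysis.Analysis"
begin

(* Elements of L^p(Omega) are represented by functions on the whole space of which only the
   values in Omega matter; equality in L^p(Omega) is equality almost everywhere in Omega. *)

definition Lp_space :: "real \<Rightarrow> 'a::euclidean_space set \<Rightarrow> ('a \<Rightarrow> real) set" where
  "Lp_space p \<Omega> = {u. u \<in> borel_measurable (lebesgue_on \<Omega>) \<and>
                      integrable (lebesgue_on \<Omega>) (\<lambda>x. \<bar>u x\<bar> powr p)}"

definition Lp_norm :: "real \<Rightarrow> 'a::euclidean_space set \<Rightarrow> ('a \<Rightarrow> real) \<Rightarrow> real" where
  "Lp_norm p \<Omega> u = (LINT x|lebesgue_on \<Omega>. \<bar>u x\<bar> powr p) powr (1 / p)"

definition ae_eq :: "'a::euclidean_space set \<Rightarrow> ('a \<Rightarrow> real) \<Rightarrow> ('a \<Rightarrow> real) \<Rightarrow> bool" where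
  "ae_eq \<Omega> u v \<longleftrightarrow> (AE x in lebesgue_on \<Omega>. u x = v x)"

(* A functional on L^p(Omega) with values in the reals extended by +infinity; the second
   conjunct says that it is well defined on equivalence classes. *)

definition Lp_functional ::
    "real \<Rightarrow> 'a::euclidean_space set \<Rightarrow> (('a \<Rightarrow> real) \<Rightarrow> ereal) \<Rightarrow> bool" where
  "Lp_functional p \<Omega> F \<longleftrightarrow>
     (\<forall>u\<in>Lp_space p \<Omega>. F u \<noteq> -\<infinity>) \<and>
     (\<forall>u\<in>Lp_space p \<Omega>. \<forall>v\<in>Lp_space p \<Omega>. ae_eq \<Omega> u v \<longrightarrow> F u = F v)"

(* Near each boundary point, Omega is the strict epigraph of a Lipschitz function: e is the
   vertical direction of a rotated coordinate system, and g is a function of the coordinates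
   orthogonal to e. *)

definition lipschitz_boundary :: "'a::euclidean_space set \<Rightarrow> bool" where
  "lipschitz_boundary \<Omega> \<longleftrightarrow>
     (\<forall>x\<in>frontier \<Omega>. \<exists>r>0. \<exists>e. \<exists>L. \<exists>g :: 'a \<Rightarrow> real.
        norm e = 1 \<and> L-lipschitz_on {z. z \<bullet> e = 0} g \<and>
        (\<forall>y\<in>ball x r. y \<in> \<Omega> \<longleftrightarrow> y \<bullet> e > g (y - (y \<bullet> e) *\<^sub>R e)))"

definition bounded_lipschitz_domain :: "'a::euclidean_space set \<Rightarrow> bool" where
  "bounded_lipschitz_domain \<Omega> \<longleftrightarrow>
     \<Omega> \<noteq> {} \<and> open \<Omega> \<and> connected \<Omega> \<and> bounded \<Omega> \<and> lipschitz_boundary \<Omega>"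

definition divergence :: "('a::euclidean_space \<Rightarrow> 'a) \<Rightarrow> 'a \<Rightarrow> real" where
  "divergence \<sigma> x = (\<Sum>b\<in>Basis. frechet_derivative \<sigma> (at x) b \<bullet> b)"

(* The set V; members of C_c^1(Omega) are extended by zero to the whole space. *)

definition test_fields :: "'a::euclidean_space set \<Rightarrow> ('a \<Rightarrow> 'a) set" where
  "test_fields \<Omega> = {\<sigma>.
     (\<forall>x\<in>\<Omega>. \<sigma> differentiable (at x)) \<and>
     (\<forall>h. continuous_on \<Omega> (\<lambda>x. frechet_derivative \<sigma> (at x) h)) \<and>
     compact (closure {x. \<sigma> x \<noteq> 0}) \<and> closure {x. \<sigma> x \<noteq> 0} \<subseteq> \<Omega> \<and>
     (\<forall>x\<in>\<Omega>. norm (\<sigma> x) \<le> 1)}"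

definition BV_seminorm :: "'a::euclidean_space set \<Rightarrow> ('a \<Rightarrow> real) \<Rightarrow> ereal" where
  "BV_seminorm \<Omega> u =
     (SUP \<sigma>\<in>test_fields \<Omega>. ereal (LINT x|lebesgue_on \<Omega>. - u x * divergence \<sigma> x))"

definition BV_norm :: "'a::euclidean_space set \<Rightarrow> ('a \<Rightarrow> real) \<Rightarrow> ereal" where
  "BV_norm \<Omega> u =
     (if u \<in> Lp_space 1 \<Omega> then ereal (Lp_norm 1 \<Omega> u) + BV_seminorm \<Omega> u else \<infinity>)"

(* The sequences u range over all of L^p(Omega), and J (u n) may be +infinity; in particular
   T is +infinity wherever J is. *)

definition CBV_coercive :: "real \<Rightarrow> 'a::euclidean_space set \<Rightarrow>
    (('a \<Rightarrow> real) \<Rightarrow> ereal) \<Rightarrow> (('a \<Rightarrow> real) \<Rightarrow> ereal) \<Rightarrow> bool" where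
  "CBV_coercive p \<Omega> J T \<longleftrightarrow>
     (\<forall>u. (\<forall>n::nat. u n \<in> Lp_space p \<Omega>) \<longrightarrow>
        (\<lambda>n. J (u n)) \<longlonglongrightarrow> \<infinity> \<longrightarrow> (\<lambda>n. T (u n)) \<longlonglongrightarrow> \<infinity>)"

definition Lp_dual :: "real \<Rightarrow> 'a::euclidean_space set \<Rightarrow> (('a \<Rightarrow> real) \<Rightarrow> real) set" where
  "Lp_dual p \<Omega> = {\<phi>.
     (\<forall>u\<in>Lp_space p \<Omega>. \<forall>v\<in>Lp_space p \<Omega>. \<phi> (\<lambda>x. u x + v x) = \<phi> u + \<phi> v) \<and>
     (\<forall>u\<in>Lp_space p \<Omega>. \<forall>c. \<phi> (\<lambda>x. c * u x) = c * \<phi> u) \<and>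
     (\<exists>K. \<forall>u\<in>Lp_space p \<Omega>. \<bar>\<phi> u\<bar> \<le> K * Lp_norm p \<Omega> u)}"

definition Lp_tendsto ::
    "real \<Rightarrow> 'a::euclidean_space set \<Rightarrow> (nat \<Rightarrow> 'a \<Rightarrow> real) \<Rightarrow> ('a \<Rightarrow> real) \<Rightarrow> bool" where
  "Lp_tendsto p \<Omega> u v \<longleftrightarrow> (\<lambda>n. Lp_norm p \<Omega> (\<lambda>x. u n x - v x)) \<longlonglongrightarrow> 0"

definition Lp_weak_tendsto ::
    "real \<Rightarrow> 'a::euclidean_space set \<Rightarrow> (nat \<Rightarrow> 'a \<Rightarrow> real) \<Rightarrow> ('a \<Rightarrow> real) \<Rightarrow> bool" where
  "Lp_weak_tendsto p \<Omega> u v \<longleftrightarrow> (\<forall>\<phi>\<in>Lp_dual p \<Omega>. (\<lambda>n. \<phi> (u n)) \<longlonglongrightarrow> \<phi> v)"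

definition Lp_lsc :: "real \<Rightarrow> 'a::euclidean_space set \<Rightarrow> (('a \<Rightarrow> real) \<Rightarrow> ereal) \<Rightarrow> bool" where
  "Lp_lsc p \<Omega> T \<longleftrightarrow>
     (\<forall>u. \<forall>v\<in>Lp_space p \<Omega>. (\<forall>n. u n \<in> Lp_space p \<Omega>) \<longrightarrow> Lp_tendsto p \<Omega> u v \<longrightarrow>
        T v \<le> liminf (\<lambda>n. T (u n)))"

(* Weak lower semicontinuity in the sequential sense of the calculus of variations; it is
   implied by lower semicontinuity with respect to the weak topology. *)

definition Lp_weakly_lsc ::
    "real \<Rightarrow> 'a::euclidean_space set \<Rightarrow> (('a \<Rightarrow> real) \<Rightarrow> ereal) \<Rightarrow> bool" where
  "Lp_weakly_lsc p \<Omega> T \<longleftrightarrow>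
     (\<forall>u. \<forall>v\<in>Lp_space p \<Omega>. (\<forall>n. u n \<in> Lp_space p \<Omega>) \<longrightarrow> Lp_weak_tendsto p \<Omega> u v \<longrightarrow>
        T v \<le> liminf (\<lambda>n. T (u n)))"

(* As usual for extended-real functionals, strictness is required on the effective domain. *)

definition Lp_strictly_convex ::
    "real \<Rightarrow> 'a::euclidean_space set \<Rightarrow> (('a \<Rightarrow> real) \<Rightarrow> ereal) \<Rightarrow> bool" where
  "Lp_strictly_convex p \<Omega> T \<longleftrightarrow>
     (\<forall>u\<in>Lp_space p \<Omega>. \<forall>v\<in>Lp_space p \<Omega>. \<forall>t\<in>{0<..<1}.
        \<not> ae_eq \<Omega> u v \<longrightarrow> T u < \<infinity> \<longrightarrow> T v < \<infinity> \<longrightarrow>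
        T (\<lambda>x. t * u x + (1 - t) * v x) < ereal t * T u + ereal (1 - t) * T v)"

definition Lp_proper ::
    "real \<Rightarrow> 'a::euclidean_space set \<Rightarrow> (('a \<Rightarrow> real) \<Rightarrow> ereal) \<Rightarrow> bool" where
  "Lp_proper p \<Omega> T \<longleftrightarrow> (\<exists>u\<in>Lp_space p \<Omega>. T u < \<infinity>)"

definition Lp_minimizer ::
    "real \<Rightarrow> 'a::euclidean_space set \<Rightarrow> (('a \<Rightarrow> real) \<Rightarrow> ereal) \<Rightarrow> ('a \<Rightarrow> real) \<Rightarrow> bool" where
  "Lp_minimizer p \<Omega> T u \<longleftrightarrow> u \<in> Lp_space p \<Omega> \<and> (\<forall>v\<in>Lp_space p \<Omega>. T u \<le> T v)"

(* d / (d - 1), read as +infinity for d = 1 (real division by zero would give 0). *)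

definition critical_exponent :: "nat \<Rightarrow> ereal" where
  "critical_exponent d = (if d = 1 then \<infinity> else ereal (real d / (real d - 1)))"

end

theory Submission
  imports Defs "HOL-Library.Diagonal_Subsequence"
begin

text \<open>
The proof is the direct method. Coercivity bounds J, and hence the BV norm, along a subsequence
of a minimizing sequence, so everything rests on the compactness of BV-bounded sets: a
BV-bounded sequence has a subsequence that converges almost everywhere and in L^1 and is bounded
in L^p with p = d / (d - 1) (any finite p if d = 1). For q < p interpolation improves this to
convergence in L^q, and lower semicontinuity applies. For q = p > 1, almost everywhere convergence
together with boundedness in L^q yields weak convergence. A strictly convex T has no two
minimizers because their midpoint would have a smaller value.

Compactness is proved without an extension operator and without mollifying u. The BV seminorm
enters only through the translation estimate (lemma BV_translation_estimate)

  int |u(x + v) - u(x)| dx <= |v| |Du|(\<Omega>),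

where x ranges over the points for which the whole segment from x to x + v lies in \<Omega>. It follows
from testing with the fields \<sigma>(y) = (int_0^1 \<phi>(y - s v) ds) v, whose divergence is
\<phi>(y) - \<phi>(y - v). Everything else works with finite differences.

Boundary regularity is used only to cover \<Omega> by finitely many open pieces, each of which may be
moved inside \<Omega> along an open set of directions (lemma bounded_lipschitz_domain_cone_covered).
On such a piece a level set of u can be estimated by differences: if the set where |u| > t is small
compared with the set of admissible steps of length h, then from every point where |u| >= 2 t at
least half of these steps lead to a point where |u| <= t. Choosing h^d proportional to the measure
of that set gives a weak-type Sobolev inequality for each dyadic slice of u. Since the differences
of the slices add up to the difference of |u|, summation over the slices gives the L^p bound
at the critical exponent (lemma sobolev_bound).

For L^1 compactness, a diagonal sequence makes the integrals over all dyadic cells inside \<Omega>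
converge. The translation estimate gives a Poincare inequality on small cells, and the L^p bound
controls the part of \<Omega> not covered by cells (lemma diff_bounded_L1_Cauchy_subsequence).

Weak convergence in L^q is obtained without identifying the dual space. If a functional stayed
away from 0 along a sequence that is bounded in L^q and tends to 0 almost everywhere, a sum of n
of its members would have L^q norm of order n^(1/q) but value of order n under the functional
(lemma Lp_dual_null_sequence).
\<close>

section \<open>Compactly supported test functions\<close>

text \<open>The derivative is encoded by its gradient D, so that differentiation under the integral sign
yields a gradient that is again an integral.\<close>

definition C1c :: "'a::euclidean_space set \<Rightarrow> ('a \<Rightarrow> real) set" where
  "C1c U = {\<phi>.
     (\<exists>D. (\<forall>x. (\<phi> has_derivative (\<lambda>h. h \<bullet> D x)) (at x)) \<and> continuous_on UNIV D) \<and>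
     (\<exists>S. compact S \<and> S \<subseteq> U \<and> (\<forall>x. x \<notin> S \<longrightarrow> \<phi> x = 0))}"

lemma C1cI:
  assumes "\<And>x. (\<phi> has_derivative (\<lambda>h. h \<bullet> D x)) (at x)" "continuous_on UNIV D"
    "compact S" "S \<subseteq> U" "\<And>x. x \<notin> S \<Longrightarrow> \<phi> x = 0"
  shows "\<phi> \<in> C1c U"
  unfolding C1c_def mem_Collect_eq
  by (intro conjI exI[of _ D] exI[of _ S] allI impI assms)

lemma C1cE:
  assumes "\<phi> \<in> C1c U"
  obtains D S where "\<And>x. (\<phi> has_derivative (\<lambda>h. h \<bullet> D x)) (at x)" "continuous_on UNIV D"
    "compact S" "S \<subseteq> U" "\<And>x. x \<notin> S \<Longrightarrow> \<phi> x = 0"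
  using assms unfolding C1c_def by (elim CollectE conjE exE) (rule that, auto)

text \<open>The simplest C^1 function that vanishes exactly on the nonpositive reals; cutoff functions are
built from it alone.\<close>

definition sq_pos :: "real \<Rightarrow> real" where
  "sq_pos t = (max 0 t)\<^sup>2"

lemma sq_pos_has_derivative: "(sq_pos has_real_derivative 2 * max 0 t) (at t)"
proof -
  consider "t < 0" | "t = 0" | "t > 0" by linarith
  then show ?thesis
  proof cases
    case 1
    have "((\<lambda>_. 0) has_real_derivative 2 * max 0 t) (at t)" using 1 by simp
    moreover have "eventually (\<lambda>s. (0::real) = sq_pos s) (nhds t)"
      using eventually_nhds_in_open[of "{..<0}" t] 1
      by (auto simp: sq_pos_def elim!: eventually_mono)
    ultimately show ?thesis
      by (subst DERIV_cong_ev[OF refl _ refl, of _ "\<lambda>_. 0"]) (auto elim: eventually_mono)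
  next
    case 3
    have "((\<lambda>s. s\<^sup>2) has_real_derivative 2 * max 0 t) (at t)" using 3
      by (auto intro!: derivative_eq_intros)
    moreover have "eventually (\<lambda>s. s\<^sup>2 = sq_pos s) (nhds t)"
      using eventually_nhds_in_open[of "{0<..}" t] 3
      by (auto simp: sq_pos_def elim!: eventually_mono)
    ultimately show ?thesis
      by (subst DERIV_cong_ev[OF refl _ refl, of _ "\<lambda>s. s\<^sup>2"]) (auto elim: eventually_mono)
  next
    case 2
    have "((\<lambda>h. (sq_pos (0 + h) - sq_pos 0) / h) \<longlongrightarrow> 0) (at 0)"
    proof (rule Lim_null_comparison)
      show "\<forall>\<^sub>F h in at 0. norm ((sq_pos (0 + h) - sq_pos 0) / h) \<le> \<bar>h\<bar>"
        by (rule always_eventually) (auto simp: sq_pos_def power2_eq_square max_def field_simps)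
      show "((\<lambda>h::real. \<bar>h\<bar>) \<longlongrightarrow> 0) (at 0)"
        by (intro tendsto_rabs_zero tendsto_ident_at)
    qed
    then show ?thesis using 2 by (simp add: DERIV_def)
  qed
qed

lemma has_derivative_compose_real:
  assumes "(\<phi> has_derivative (\<lambda>h. h \<bullet> D)) (at x)" "(g has_real_derivative g') (at (\<phi> x))"
  shows "((\<lambda>x. g (\<phi> x)) has_derivative (\<lambda>h. h \<bullet> (g' *\<^sub>R D))) (at x)"
proof -
  have "(g has_derivative (*) g') (at (\<phi> x))"
    using assms(2) by (simp add: has_field_derivative_def)
  from has_derivative_compose[OF assms(1) this] show ?thesis
    by (simp add: inner_scaleR_right)
qed

text \<open>Over a finite cover of K by balls inside U, the sum of sq_pos (r^2 - |y - x|^2) is a C^1 function,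
positive on K and zero off the closed balls. Compactness gives it a positive lower bound c on K, and
composing with t \<mapsto> 1 - sq_pos (1 - t / c) flattens it to 1 there.\<close>

lemma C1c_cutoff:
  fixes K U :: "'a::euclidean_space set"
  assumes "compact K" "open U" "K \<subseteq> U"
  shows "\<exists>\<zeta>\<in>C1c U. (\<forall>x. 0 \<le> \<zeta> x \<and> \<zeta> x \<le> 1) \<and> (\<forall>x\<in>K. \<zeta> x = 1)"
proof -
  have "\<forall>x\<in>K. \<exists>r>0. cball x r \<subseteq> U"
    using assms(2,3) open_contains_cball by blast
  then obtain r where r: "\<And>x. x \<in> K \<Longrightarrow> r x > 0 \<and> cball x (r x) \<subseteq> U" by metis
  have "K \<subseteq> (\<Union>x\<in>K. ball x (r x))" using r by force
  then obtain F where F: "F \<subseteq> K" "finite F" "K \<subseteq> (\<Union>x\<in>F. ball x (r x))"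
    using compactE_image[OF assms(1), of K "\<lambda>x. ball x (r x)"] by auto
  define \<psi> where "\<psi> y = (\<Sum>x\<in>F. sq_pos ((r x)\<^sup>2 - (y - x) \<bullet> (y - x)))" for y
  define E where "E y = (\<Sum>x\<in>F. (2 * max 0 ((r x)\<^sup>2 - (y - x) \<bullet> (y - x))) *\<^sub>R ((-2) *\<^sub>R (y - x)))" for y
  have d\<psi>: "(\<psi> has_derivative (\<lambda>h. h \<bullet> E y)) (at y)" for y
    unfolding \<psi>_def E_def inner_sum_right
  proof (rule has_derivative_sum)
    fix x assume "x \<in> F"
    have "((\<lambda>y. (r x)\<^sup>2 - (y - x) \<bullet> (y - x)) has_derivative (\<lambda>h. h \<bullet> ((-2) *\<^sub>R (y - x)))) (at y)"
      by (auto intro!: derivative_eq_intros simp: inner_commute fun_eq_iff)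
    from has_derivative_compose_real[OF this sq_pos_has_derivative]
    show "((\<lambda>y. sq_pos ((r x)\<^sup>2 - (y - x) \<bullet> (y - x))) has_derivative
        (\<lambda>h. h \<bullet> (2 * max 0 ((r x)\<^sup>2 - (y - x) \<bullet> (y - x))) *\<^sub>R ((-2) *\<^sub>R (y - x)))) (at y)" .
  qed
  have contE: "continuous_on UNIV E" unfolding E_def by (intro continuous_intros)
  have cont\<psi>: "continuous_on UNIV \<psi>"
    by (auto intro!: continuous_at_imp_continuous_on has_derivative_continuous[OF d\<psi>])
  have \<psi>0: "\<psi> y \<ge> 0" for y unfolding \<psi>_def by (intro sum_nonneg) (auto simp: sq_pos_def)
  have \<psi>pos: "\<psi> y > 0" if yK: "y \<in> K" for y
  proof -
    obtain x where x: "x \<in> F" "y \<in> ball x (r x)" using F(3) yK by blast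
    have "norm (y - x) < r x" using x by (simp add: dist_norm norm_minus_commute)
    then have "(norm (y - x))\<^sup>2 < (r x)\<^sup>2" by (intro power_strict_mono) auto
    then have "0 < sq_pos ((r x)\<^sup>2 - (y - x) \<bullet> (y - x))"
      by (simp add: sq_pos_def power2_norm_eq_inner)
    then show ?thesis unfolding \<psi>_def
      by (rule sum_pos2[OF F(2) x(1)]) (auto simp: sq_pos_def)
  qed
  have "\<exists>c>0. \<forall>y\<in>K. c \<le> \<psi> y"
  proof (cases "K = {}")
    case True then show ?thesis by (auto intro: exI[of _ 1])
  next
    case False
    have "continuous_on K \<psi>" using cont\<psi> continuous_on_subset by blast
    from continuous_attains_inf[OF assms(1) False this] show ?thesis using \<psi>pos by metis
  qed
  then obtain c where c: "c > 0" "\<And>y. y \<in> K \<Longrightarrow> c \<le> \<psi> y" by auto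
  define \<zeta> where "\<zeta> y = 1 - sq_pos (1 - \<psi> y / c)" for y
  define S where "S = (\<Union>x\<in>F. cball x (r x))"
  have "compact S" unfolding S_def using F by (intro compact_UN) auto
  have "S \<subseteq> U" unfolding S_def using r F by fastforce
  have "\<zeta> y = 0" if "y \<notin> S" for y
  proof -
    have "sq_pos ((r x)\<^sup>2 - (y - x) \<bullet> (y - x)) = 0" if "x \<in> F" for x
    proof -
      have "r x > 0" using r F that by auto
      have "r x < norm (y - x)" using \<open>y \<notin> S\<close> that by (auto simp: S_def dist_norm norm_minus_commute)
      then have "(r x)\<^sup>2 < (norm (y - x))\<^sup>2" using \<open>r x > 0\<close> by (intro power_strict_mono) auto
      then show ?thesis by (simp add: sq_pos_def power2_norm_eq_inner)
    qed
    then have "\<psi> y = 0" by (simp add: \<psi>_def)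
    then show ?thesis by (simp add: \<zeta>_def sq_pos_def)
  qed
  moreover have d\<zeta>: "(\<zeta> has_derivative (\<lambda>h. h \<bullet> ((2 * max 0 (1 - \<psi> y / c)) *\<^sub>R (1 / c) *\<^sub>R E y))) (at y)" for y
  proof -
    have "((\<lambda>t. 1 - sq_pos (1 - t / c)) has_real_derivative (2 * max 0 (1 - \<psi> y / c)) * (1 / c)) (at (\<psi> y))"
    proof -
      have "((\<lambda>t. 1 - t / c) has_real_derivative - (1 / c)) (at (\<psi> y))"
        using c by (auto intro!: derivative_eq_intros)
      from DERIV_chain2[OF sq_pos_has_derivative this] have
        "((\<lambda>t. sq_pos (1 - t / c)) has_real_derivative (2 * max 0 (1 - \<psi> y / c)) * - (1 / c)) (at (\<psi> y))" .
      from DERIV_diff[OF DERIV_const this] show ?thesis by simp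
    qed
    from has_derivative_compose_real[OF d\<psi> this] show ?thesis unfolding \<zeta>_def by simp
  qed
  moreover have "continuous_on UNIV (\<lambda>y. (2 * max 0 (1 - \<psi> y / c)) *\<^sub>R (1 / c) *\<^sub>R E y)"
    using c by (intro continuous_intros contE cont\<psi>) auto
  ultimately have "\<zeta> \<in> C1c U"
    using \<open>compact S\<close> \<open>S \<subseteq> U\<close> by (intro C1cI)
  moreover have "0 \<le> \<zeta> y \<and> \<zeta> y \<le> 1" for y
  proof -
    have "0 \<le> \<psi> y / c" using \<psi>0 c by simp
    then have "(max 0 (1 - \<psi> y / c)) ^ 2 \<le> 1 ^ 2" by (intro power_mono) auto
    then show ?thesis by (simp add: \<zeta>_def sq_pos_def)
  qed
  moreover have "\<zeta> y = 1" if "y \<in> K" for y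
  proof -
    have "1 \<le> \<psi> y / c" using c that by simp
    then show ?thesis by (simp add: \<zeta>_def sq_pos_def)
  qed
  ultimately show ?thesis by blast
qed

lemma C1c_diff:
  assumes "f \<in> C1c U" "g \<in> C1c U"
  shows "(\<lambda>x. f x - g x) \<in> C1c U"
proof -
  obtain D S where f: "\<And>x. (f has_derivative (\<lambda>h. h \<bullet> D x)) (at x)" "continuous_on UNIV D"
    "compact S" "S \<subseteq> U" "\<And>x. x \<notin> S \<Longrightarrow> f x = 0"
    by (rule C1cE[OF assms(1)]) (rule that)
  obtain D' S' where g: "\<And>x. (g has_derivative (\<lambda>h. h \<bullet> D' x)) (at x)" "continuous_on UNIV D'"
    "compact S'" "S' \<subseteq> U" "\<And>x. x \<notin> S' \<Longrightarrow> g x = 0"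
    by (rule C1cE[OF assms(2)]) (rule that)
  have "((\<lambda>x. f x - g x) has_derivative (\<lambda>h. h \<bullet> (D x - D' x))) (at x)" for x
    unfolding inner_diff_right by (intro has_derivative_diff f g)
  moreover have "continuous_on UNIV (\<lambda>x. D x - D' x)" by (intro continuous_intros f g)
  moreover have "compact (S \<union> S')" "S \<union> S' \<subseteq> U" "\<And>x. x \<notin> S \<union> S' \<Longrightarrow> f x - g x = 0"
    using f g by auto
  ultimately show ?thesis by (rule C1cI)
qed

lemma C1c_mono: "f \<in> C1c U \<Longrightarrow> U \<subseteq> V \<Longrightarrow> f \<in> C1c V"
  by (elim C1cE, rule C1cI) (assumption | erule order_trans | blast)+

lemma C1c_zero: "f \<in> C1c U \<Longrightarrow> x \<notin> U \<Longrightarrow> f x = 0"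
  by (elim C1cE) auto

lemma C1c_continuous: "f \<in> C1c U \<Longrightarrow> continuous_on UNIV f"
  unfolding C1c_def by (auto intro!: continuous_at_imp_continuous_on dest: has_derivative_continuous)

text \<open>The L^1 norm is recovered from smooth test functions: the finite measure with density |f| is inner
regular, so up to a small mass f is positive on a compact set P and negative on a disjoint compact
set N, and a difference of two cutoffs is 1 on P and -1 on N.\<close>

lemma L1_norm_le_if_C1c_pairing_le:
  fixes f :: "'a::euclidean_space \<Rightarrow> real"
  assumes f: "integrable lborel f" and G: "open G" and B: "B \<ge> 0"
    and le: "\<And>\<phi>. \<phi> \<in> C1c G \<Longrightarrow> (\<And>x. \<bar>\<phi> x\<bar> \<le> 1) \<Longrightarrow> (LINT x|lborel. f x * \<phi> x) \<le> B"
  shows "(\<integral>\<^sup>+x. indicator G x * ennreal \<bar>f x\<bar> \<partial>lborel) \<le> ennreal B"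
proof -
  have [measurable]: "f \<in> borel_measurable borel" using f by auto
  have [measurable]: "G \<in> sets borel" using G by auto
  define \<mu> where "\<mu> = density lborel (\<lambda>x. ennreal \<bar>f x\<bar>)"
  have sets\<mu>: "sets \<mu> = sets borel" by (simp add: \<mu>_def)
  have em: "emeasure \<mu> A = (\<integral>\<^sup>+x. ennreal \<bar>f x\<bar> * indicator A x \<partial>lborel)" if "A \<in> sets borel" for A
    unfolding \<mu>_def using that by (simp add: emeasure_density)
  have int_ind: "integrable lborel (\<lambda>x. \<bar>f x\<bar> * indicator A x)" if [measurable]: "A \<in> sets borel" for A
    by (rule Bochner_Integration.integrable_bound[OF f]) (auto simp: indicator_def)
  have em_int: "emeasure \<mu> A = ennreal (LINT x|lborel. \<bar>f x\<bar> * indicator A x)" if "A \<in> sets borel" for A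
  proof -
    have "emeasure \<mu> A = (\<integral>\<^sup>+x. ennreal (\<bar>f x\<bar> * indicator A x) \<partial>lborel)"
      unfolding em[OF that] by (intro nn_integral_cong) (auto simp: indicator_def)
    then show ?thesis using nn_integral_eq_integral[OF int_ind[OF that]] by (simp add: indicator_def)
  qed
  have fin: "emeasure \<mu> (space \<mu>) \<noteq> \<infinity>"
    using em_int[of UNIV] by (simp add: \<mu>_def)
  have approx: "\<exists>K. K \<subseteq> A \<and> compact K \<and>
      (LINT x|lborel. \<bar>f x\<bar> * indicator A x) \<le> (LINT x|lborel. \<bar>f x\<bar> * indicator K x) + e"
    if A: "A \<in> sets borel" and e: "e > 0" for A e
  proof -
    have "emeasure \<mu> A = (SUP K \<in> {K. K \<subseteq> A \<and> compact K}. emeasure \<mu> K)"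
      by (rule inner_regular[OF sets\<mu> fin A])
    moreover have "emeasure \<mu> A \<noteq> top" using em_int[OF A] by simp
    moreover have "{K. K \<subseteq> A \<and> compact K} \<noteq> {}" by (auto intro: exI[of _ "{}"])
    ultimately obtain K where K: "K \<subseteq> A" "compact K" "emeasure \<mu> A < emeasure \<mu> K + ennreal e"
      using SUP_approx_ennreal[of e "{K. K \<subseteq> A \<and> compact K}" "emeasure \<mu> A" "emeasure \<mu>"] e
      by auto
    have Kb: "K \<in> sets borel" using K by (auto intro: compact_imp_closed borel_closed)
    have "ennreal (LINT x|lborel. \<bar>f x\<bar> * indicator A x) \<le>
        ennreal ((LINT x|lborel. \<bar>f x\<bar> * indicator K x) + e)"
      using K(3) e unfolding em_int[OF A] em_int[OF Kb]
      by (subst ennreal_plus) (auto intro!: integral_nonneg_AE)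
    then have "(LINT x|lborel. \<bar>f x\<bar> * indicator A x) \<le> (LINT x|lborel. \<bar>f x\<bar> * indicator K x) + e"
      using e by (subst (asm) ennreal_le_iff) (auto intro!: add_nonneg_nonneg integral_nonneg_AE)
    then show ?thesis using K by blast
  qed
  have "(LINT x|lborel. \<bar>f x\<bar> * indicator G x) \<le> B"
  proof (rule field_le_epsilon)
    fix e :: real assume "e > 0"
    define Gp where "Gp = G \<inter> {x. f x > 0}"
    define Gn where "Gn = G \<inter> {x. f x < 0}"
    have [measurable]: "Gp \<in> sets borel" "Gn \<in> sets borel" unfolding Gp_def Gn_def by measurable
    obtain P where P: "P \<subseteq> Gp" "compact P"
      "(LINT x|lborel. \<bar>f x\<bar> * indicator Gp x) \<le> (LINT x|lborel. \<bar>f x\<bar> * indicator P x) + e / 4"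
      using approx[of Gp "e / 4"] \<open>e > 0\<close> by auto
    obtain N where N: "N \<subseteq> Gn" "compact N"
      "(LINT x|lborel. \<bar>f x\<bar> * indicator Gn x) \<le> (LINT x|lborel. \<bar>f x\<bar> * indicator N x) + e / 4"
      using approx[of Gn "e / 4"] \<open>e > 0\<close> by auto
    have [measurable]: "P \<in> sets borel" "N \<in> sets borel"
      using P N by (auto intro: compact_imp_closed borel_closed)
    have Pf: "x \<in> G \<and> f x > 0" if "x \<in> P" for x using P(1) that by (auto simp: Gp_def)
    have Nf: "x \<in> G \<and> f x < 0" if "x \<in> N" for x using N(1) that by (auto simp: Gn_def)
    have "P \<inter> N = {}" using Pf Nf by (meson disjoint_iff order_less_asym)
    with P(2) compact_imp_closed[OF N(2)]
    obtain U V where UV: "open U" "open V" "P \<subseteq> U" "N \<subseteq> V" "U \<inter> V = {}"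
      by (rule separation_normal_compact)
    have "P \<subseteq> U \<inter> G" "open (U \<inter> G)" "N \<subseteq> V \<inter> G" "open (V \<inter> G)"
      using UV G P(1) N(1) by (auto simp: Gp_def Gn_def)
    then obtain \<zeta> \<eta> where
      \<zeta>: "\<zeta> \<in> C1c (U \<inter> G)" "\<And>x. 0 \<le> \<zeta> x \<and> \<zeta> x \<le> 1" "\<And>x. x \<in> P \<Longrightarrow> \<zeta> x = 1" and
      \<eta>: "\<eta> \<in> C1c (V \<inter> G)" "\<And>x. 0 \<le> \<eta> x \<and> \<eta> x \<le> 1" "\<And>x. x \<in> N \<Longrightarrow> \<eta> x = 1"
      using C1c_cutoff[OF P(2)] C1c_cutoff[OF N(2)] by metis
    define \<phi> where "\<phi> x = \<zeta> x - \<eta> x" for x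
    have \<phi>C: "\<phi> \<in> C1c G" unfolding \<phi>_def
      using \<zeta>(1) \<eta>(1) by (intro C1c_diff) (auto elim: C1c_mono)
    have zero: "\<zeta> x = 0 \<or> \<eta> x = 0" for x
      using C1c_zero[OF \<zeta>(1), of x] C1c_zero[OF \<eta>(1), of x] UV(5) by blast
    have \<phi>1: "\<bar>\<phi> x\<bar> \<le> 1" for x using zero[of x] \<zeta>(2)[of x] \<eta>(2)[of x] by (auto simp: \<phi>_def)
    have [measurable]: "\<phi> \<in> borel_measurable borel"
      using C1c_continuous[OF \<phi>C] borel_measurable_continuous_onI by blast
    have \<phi>P: "\<phi> x = 1" if "x \<in> P" for x using that zero[of x] \<zeta>(3) by (auto simp: \<phi>_def)
    have \<phi>N: "\<phi> x = -1" if "x \<in> N" for x using that zero[of x] \<eta>(3) by (auto simp: \<phi>_def)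
    have i\<phi>: "integrable lborel (\<lambda>x. f x * \<phi> x)"
      by (rule Bochner_Integration.integrable_bound[OF f])
         (use \<phi>1 in \<open>auto simp: abs_mult intro!: mult_left_le\<close>)
    note ii = int_ind[of Gp] int_ind[of Gn] int_ind[of P] int_ind[of N] int_ind[of G]
    have G_eq: "(LINT x|lborel. \<bar>f x\<bar> * indicator G x) =
        (LINT x|lborel. \<bar>f x\<bar> * indicator Gp x) + (LINT x|lborel. \<bar>f x\<bar> * indicator Gn x)"
    proof -
      have "(\<lambda>x. \<bar>f x\<bar> * indicator G x) = (\<lambda>x. \<bar>f x\<bar> * indicator Gp x + \<bar>f x\<bar> * indicator Gn x)"
        by (auto simp: fun_eq_iff indicator_def Gp_def Gn_def)
      then show ?thesis using ii by simp
    qed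
    (* Off P and N only f \<phi> >= - |f| is known; the remaining mass is at most e / 2, so it costs at most e. *)
    have "2 * (LINT x|lborel. \<bar>f x\<bar> * indicator P x) + 2 * (LINT x|lborel. \<bar>f x\<bar> * indicator N x)
         - (LINT x|lborel. \<bar>f x\<bar> * indicator G x)
        = (LINT x|lborel. 2 * (\<bar>f x\<bar> * indicator P x) + 2 * (\<bar>f x\<bar> * indicator N x) - \<bar>f x\<bar> * indicator G x)"
      using ii by simp
    also have "\<dots> \<le> (LINT x|lborel. f x * \<phi> x)"
    proof (rule integral_mono)
      show "integrable lborel (\<lambda>x. 2 * (\<bar>f x\<bar> * indicator P x) + 2 * (\<bar>f x\<bar> * indicator N x) - \<bar>f x\<bar> * indicator G x)"
        using ii by auto
      show "2 * (\<bar>f x\<bar> * indicator P x) + 2 * (\<bar>f x\<bar> * indicator N x) - \<bar>f x\<bar> * indicator G x \<le> f x * \<phi> x" for x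
      proof -
        have "- \<bar>f x\<bar> \<le> f x * \<phi> x"
          using \<phi>1[of x] mult_left_mono[of "\<bar>\<phi> x\<bar>" 1 "\<bar>f x\<bar>"] by (auto simp: abs_mult[symmetric])
        moreover have "x \<notin> G \<Longrightarrow> \<phi> x = 0" using C1c_zero[OF \<phi>C] by blast
        moreover have "x \<in> P \<Longrightarrow> x \<in> G \<and> f x > 0 \<and> x \<notin> N" using Pf Nf by (meson order_less_asym)
        moreover have "x \<in> N \<Longrightarrow> x \<in> G \<and> f x < 0 \<and> x \<notin> P" using Pf Nf by (meson order_less_asym)
        ultimately show ?thesis using \<phi>P[of x] \<phi>N[of x] by (auto simp: indicator_def)
      qed
    qed (rule i\<phi>)
    also have "\<dots> \<le> B" using le \<phi>C \<phi>1 by blast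
    finally show "(LINT x|lborel. \<bar>f x\<bar> * indicator G x) \<le> B + e"
      using P(3) N(3) G_eq by linarith
  qed
  moreover have "(\<integral>\<^sup>+x. indicator G x * ennreal \<bar>f x\<bar> \<partial>lborel) = emeasure \<mu> G"
    by (simp add: em mult.commute)
  ultimately show ?thesis using em_int[of G] by (simp add: ennreal_leI)
qed

section \<open>The translation estimate\<close>

text \<open>The points from which the step v can be taken without leaving the set along the way.\<close>

definition seg_shift :: "'a::euclidean_space set \<Rightarrow> 'a \<Rightarrow> 'a set" where
  "seg_shift \<Omega> v = {y. \<forall>s\<in>{0..1}. y + s *\<^sub>R v \<in> \<Omega>}"

lemma open_seg_shift:
  assumes "open \<Omega>" shows "open (seg_shift \<Omega> v)"
proof -
  have "- seg_shift \<Omega> v = (\<Union>x\<in>(\<lambda>s. - s *\<^sub>R v) ` {0..1::real}. \<Union>y\<in>-\<Omega>. {x + y})"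
    by (force simp: seg_shift_def)
  moreover have "compact ((\<lambda>s. - s *\<^sub>R v) ` {0..1::real})"
    by (intro compact_continuous_image continuous_intros) auto
  ultimately have "closed (- seg_shift \<Omega> v)"
    using compact_closed_sums[of "(\<lambda>s. - s *\<^sub>R v) ` {0..1::real}" "-\<Omega>"] assms by (simp add: closed_def)
  then show ?thesis by (simp add: closed_def)
qed

text \<open>The field is \<Psi>(y) v / |v| with \<Psi>(y) = int_0^1 \<phi>(y - s v) ds. Its divergence is the derivative of \<Psi>
along v divided by |v|, which the fundamental theorem of calculus turns into a difference of \<phi>. The
support of \<Psi> is swept out by the segments that start in the support of \<phi>, hence it is a
compact subset of \<Omega>.\<close>

lemma test_field_of_translation:
  fixes \<Omega> :: "'a::euclidean_space set"
  assumes \<phi>: "\<phi> \<in> C1c (seg_shift \<Omega> v)" and \<phi>1: "\<And>x. \<bar>\<phi> x\<bar> \<le> 1" and v: "v \<noteq> 0"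
  shows "\<exists>\<sigma>\<in>test_fields \<Omega>. \<forall>x. divergence \<sigma> x = (\<phi> x - \<phi> (x - v)) / norm v"
proof -
  obtain D S where D: "\<And>x. (\<phi> has_derivative (\<lambda>h. h \<bullet> D x)) (at x)" "continuous_on UNIV D"
    and S: "compact S" "S \<subseteq> seg_shift \<Omega> v" "\<And>x. x \<notin> S \<Longrightarrow> \<phi> x = 0"
    by (rule C1cE[OF \<phi>]) (rule that)
  have cont\<phi>: "continuous_on UNIV \<phi>" by (rule C1c_continuous[OF \<phi>])
  have contS: "continuous_on (UNIV \<times> cbox 0 1) (\<lambda>(x, s). f (x - s *\<^sub>R v))"
    if "continuous_on UNIV f" for f :: "'a \<Rightarrow> 'b::topological_space"
    unfolding case_prod_unfold
    by (rule continuous_on_compose2[OF that]) (auto intro!: continuous_intros)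
  define \<Psi> where "\<Psi> x = integral (cbox 0 1) (\<lambda>s::real. \<phi> (x - s *\<^sub>R v))" for x
  define G where "G x = integral (cbox 0 1) (\<lambda>s::real. D (x - s *\<^sub>R v))" for x
  have intD: "(\<lambda>s. D (x - s *\<^sub>R v)) integrable_on cbox 0 (1::real)" for x
    by (intro integrable_continuous continuous_on_compose2[OF D(2)]) (auto intro!: continuous_intros)
  have d\<Psi>: "(\<Psi> has_derivative (\<lambda>h. h \<bullet> G x)) (at x)" for x
  proof -
    have "((\<lambda>x. integral (cbox 0 1) (\<lambda>s::real. \<phi> (x - s *\<^sub>R v))) has_derivative
        integral (cbox 0 1) (\<lambda>s. blinfun_inner_left (D (x - s *\<^sub>R v)))) (at x within UNIV)"
    proof (rule leibniz_rule)
      show "((\<lambda>x. \<phi> (x - t *\<^sub>R v)) has_derivative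
          blinfun_apply (blinfun_inner_left (D (x - t *\<^sub>R v)))) (at x within UNIV)" for x t
      proof -
        have "((\<lambda>x. x - t *\<^sub>R v) has_derivative (\<lambda>h. h)) (at x)"
          by (auto intro!: derivative_eq_intros)
        from has_derivative_compose[OF this D(1)[of "x - t *\<^sub>R v"]]
        show ?thesis by (simp add: blinfun_inner_left.rep_eq[abs_def])
      qed
      show "(\<lambda>s. \<phi> (x - s *\<^sub>R v)) integrable_on cbox 0 1" for x
        by (intro integrable_continuous continuous_on_compose2[OF cont\<phi>]) (auto intro!: continuous_intros)
      show "continuous_on (UNIV \<times> cbox 0 1) (\<lambda>(x, s). blinfun_inner_left (D (x - s *\<^sub>R v)))"
        by (rule contS[of "\<lambda>y. blinfun_inner_left (D y)"])
          (rule bounded_linear.continuous_on[OF bounded_linear_blinfun_inner_left D(2)])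
    qed auto
    moreover have "integral (cbox 0 1) (\<lambda>s. blinfun_inner_left (D (x - s *\<^sub>R v))) = blinfun_inner_left (G x)"
      using integral_linear[OF intD bounded_linear_blinfun_inner_left, of x] by (simp add: o_def G_def)
    ultimately show ?thesis unfolding \<Psi>_def by (simp add: blinfun_inner_left.rep_eq[abs_def])
  qed
  have contG: "continuous_on UNIV G"
    unfolding G_def by (rule integral_continuous_on_param[OF contS[OF D(2)]])
  have Gv: "v \<bullet> G x = \<phi> x - \<phi> (x - v)" for x
  proof -
    have "((\<lambda>s. v \<bullet> D (x - s *\<^sub>R v)) has_integral (- \<phi> (x - 1 *\<^sub>R v) - - \<phi> (x - 0 *\<^sub>R v))) {0..1::real}"
    proof (rule fundamental_theorem_of_calculus)
      show "((\<lambda>s. - \<phi> (x - s *\<^sub>R v)) has_vector_derivative v \<bullet> D (x - s *\<^sub>R v)) (at s within {0..1})" for s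
      proof -
        have "((\<lambda>s. x - s *\<^sub>R v) has_derivative (\<lambda>h. - h *\<^sub>R v)) (at s within {0..1})"
          by (auto intro!: derivative_eq_intros)
        from has_derivative_minus[OF has_derivative_compose[OF this D(1)]]
        show ?thesis by (simp add: has_vector_derivative_def)
      qed
    qed auto
    moreover have "((\<lambda>s. v \<bullet> D (x - s *\<^sub>R v)) has_integral v \<bullet> G x) {0..1::real}"
      using has_integral_linear[OF integrable_integral[OF intD[of x]] bounded_linear_inner_right[of v]]
      by (simp add: o_def G_def)
    ultimately have "- \<phi> (x - 1 *\<^sub>R v) - - \<phi> (x - 0 *\<^sub>R v) = v \<bullet> G x" by (rule has_integral_unique)
    then show ?thesis by simp
  qed
  have \<Psi>1: "\<bar>\<Psi> x\<bar> \<le> 1" for x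
  proof -
    have "norm (integral (cbox 0 1) (\<lambda>s::real. \<phi> (x - s *\<^sub>R v))) \<le> integral (cbox 0 1) (\<lambda>s::real. 1)"
    proof (rule integral_norm_bound_integral)
      show "(\<lambda>s. \<phi> (x - s *\<^sub>R v)) integrable_on cbox 0 1"
        by (intro integrable_continuous continuous_on_compose2[OF cont\<phi>]) (auto intro!: continuous_intros)
    qed (use \<phi>1 in auto)
    then show ?thesis by (simp add: \<Psi>_def)
  qed
  define \<sigma> where "\<sigma> x = \<Psi> x *\<^sub>R ((1 / norm v) *\<^sub>R v)" for x
  define Z where "Z = (\<lambda>(x, s). x + s *\<^sub>R v) ` (S \<times> {0..1::real})"
  have Z: "compact Z" unfolding Z_def
    by (intro compact_continuous_image compact_Times S(1)) (auto simp: case_prod_unfold intro!: continuous_intros)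
  have Z\<Omega>: "Z \<subseteq> \<Omega>" using S(2) by (auto simp: Z_def seg_shift_def)
  have "\<sigma> x = 0" if "x \<notin> Z" for x
  proof -
    have "\<phi> (x - s *\<^sub>R v) = 0" if s: "s \<in> {0..1}" for s
    proof (rule S(3))
      have "x \<in> Z" if "x - s *\<^sub>R v \<in> S"
        unfolding Z_def by (rule image_eqI[of _ _ "(x - s *\<^sub>R v, s)"]) (use that s in auto)
      then show "x - s *\<^sub>R v \<notin> S" using \<open>x \<notin> Z\<close> by blast
    qed
    then have "\<Psi> x = integral (cbox 0 1) (\<lambda>s::real. 0)" unfolding \<Psi>_def
      by (intro Henstock_Kurzweil_Integration.integral_cong) auto
    then show ?thesis by (simp add: \<sigma>_def)
  qed
  then have sub: "closure {x. \<sigma> x \<noteq> 0} \<subseteq> Z"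
    by (intro closure_minimal compact_imp_closed Z) auto
  have d\<sigma>: "(\<sigma> has_derivative (\<lambda>h. (h \<bullet> G x) *\<^sub>R ((1 / norm v) *\<^sub>R v))) (at x)" for x
    unfolding \<sigma>_def by (rule has_derivative_scaleR_left[OF d\<Psi>])
  have fd: "frechet_derivative \<sigma> (at x) = (\<lambda>h. (h \<bullet> G x) *\<^sub>R ((1 / norm v) *\<^sub>R v))" for x
    using frechet_derivative_at[OF d\<sigma>] by simp
  have "\<sigma> \<in> test_fields \<Omega>"
    unfolding test_fields_def mem_Collect_eq
  proof (intro conjI allI ballI)
    show "\<sigma> differentiable at x" for x using d\<sigma> by (auto simp: differentiable_def)
    show "continuous_on \<Omega> (\<lambda>x. frechet_derivative \<sigma> (at x) h)" for h
      unfolding fd by (intro continuous_intros continuous_on_subset[OF contG]) auto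
    show "compact (closure {x. \<sigma> x \<noteq> 0})"
    proof -
      have "Z \<inter> closure {x. \<sigma> x \<noteq> 0} = closure {x. \<sigma> x \<noteq> 0}" using sub by blast
      then show ?thesis using compact_Int_closed[OF Z closed_closure, of "{x. \<sigma> x \<noteq> 0}"] by argo
    qed
    show "closure {x. \<sigma> x \<noteq> 0} \<subseteq> \<Omega>" using sub Z\<Omega> by auto
    show "norm (\<sigma> x) \<le> 1" for x using \<Psi>1[of x] v by (simp add: \<sigma>_def)
  qed
  moreover have "divergence \<sigma> x = (\<phi> x - \<phi> (x - v)) / norm v" for x
  proof -
    have "divergence \<sigma> x = (\<Sum>b\<in>Basis. (b \<bullet> G x) * (v \<bullet> b)) / norm v"
      unfolding divergence_def fd by (simp add: sum_divide_distrib)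
    also have "(\<Sum>b\<in>Basis. (b \<bullet> G x) * (v \<bullet> b)) = v \<bullet> G x"
      by (subst (3) euclidean_inner) (simp add: inner_commute mult.commute)
    finally show ?thesis using Gv by simp
  qed
  ultimately show ?thesis by blast
qed

lemma lborel_integral_translation:
  fixes f :: "'a::euclidean_space \<Rightarrow> real"
  assumes "f \<in> borel_measurable borel"
  shows "(LINT x|lborel. f (v + x)) = (LINT x|lborel. f x)"
    "integrable lborel (\<lambda>x. f (v + x)) \<longleftrightarrow> integrable lborel f"
  using assms integral_distr[of "(+) v" lborel borel f] integrable_distr_eq[of "(+) v" lborel borel f]
  by (auto simp: lborel_distr_plus)

lemma nn_integral_lborel_translation:
  fixes f :: "'a::euclidean_space \<Rightarrow> ennreal"
  assumes "f \<in> borel_measurable borel"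
  shows "(\<integral>\<^sup>+x. f (v + x) \<partial>lborel) = (\<integral>\<^sup>+x. f x \<partial>lborel)"
  using assms nn_integral_distr[of "(+) v" lborel borel f] by (auto simp: lborel_distr_plus)

lemma integral_lebesgue_on_eq_lborel:
  fixes f :: "'a::euclidean_space \<Rightarrow> real"
  assumes "f \<in> borel_measurable borel" "\<And>x. x \<notin> \<Omega> \<Longrightarrow> f x = 0" "\<Omega> \<in> sets borel"
  shows "(LINT x|lebesgue_on \<Omega>. f x) = (LINT x|lborel. f x)"
proof -
  have "(LINT x|lebesgue_on \<Omega>. f x) = (LINT x|lebesgue. indicator \<Omega> x *\<^sub>R f x)"
    using assms by (intro integral_restrict_space) auto
  also have "(\<lambda>x. indicator \<Omega> x *\<^sub>R f x) = f"
    using assms by (auto simp: indicator_def fun_eq_iff)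
  also have "integral\<^sup>L lebesgue f = (LINT x|lborel. f x)"
    using assms by (intro integral_completion) auto
  finally show ?thesis .
qed

text \<open>Pairing the difference of u with \<phi> equals, after a change of variables, pairing u with the
difference of \<phi>, which is |v| times a divergence; the L^1 norm is the supremum of such pairings.\<close>

lemma BV_translation_estimate:
  fixes \<Omega> :: "'a::euclidean_space set" and B :: real
  assumes \<Omega>: "open \<Omega>" and u: "integrable lborel u" "\<And>x. x \<notin> \<Omega> \<Longrightarrow> u x = 0"
    and BV: "BV_seminorm \<Omega> u \<le> ereal B" and B: "B \<ge> 0"
  shows "(\<integral>\<^sup>+x. indicator (seg_shift \<Omega> v) x * ennreal \<bar>u (v + x) - u x\<bar> \<partial>lborel) \<le> ennreal (norm v * B)"
proof (cases "v = 0")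
  case True then show ?thesis by simp
next
  case False
  have [measurable]: "u \<in> borel_measurable borel" using u(1) by auto
  have i1: "integrable lborel (\<lambda>x. u (v + x))" using u(1) by (subst lborel_integral_translation) auto
  show ?thesis
  proof (rule L1_norm_le_if_C1c_pairing_le)
    show "integrable lborel (\<lambda>x. u (v + x) - u x)" using i1 u(1) by auto
    show "open (seg_shift \<Omega> v)" by (rule open_seg_shift[OF \<Omega>])
    show "0 \<le> norm v * B" using B by simp
  next
    fix \<phi> assume \<phi>: "\<phi> \<in> C1c (seg_shift \<Omega> v)" "\<And>x. \<bar>\<phi> x\<bar> \<le> 1"
    obtain \<sigma> where \<sigma>: "\<sigma> \<in> test_fields \<Omega>" "\<And>x. divergence \<sigma> x = (\<phi> x - \<phi> (x - v)) / norm v"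
      using test_field_of_translation[OF \<phi> False] by blast
    have [measurable]: "\<phi> \<in> borel_measurable borel"
      using C1c_continuous[OF \<phi>(1)] borel_measurable_continuous_onI by blast
    have bd: "integrable lborel (\<lambda>x. w x * \<phi> (x + c))" if "integrable lborel w" for w c
      by (rule Bochner_Integration.integrable_bound[OF that])
         (use \<phi>(2) that in \<open>auto simp: abs_mult intro!: mult_left_le\<close>)
    have "(LINT x|lebesgue_on \<Omega>. - u x * divergence \<sigma> x) \<le> B"
    proof -
      have "ereal (LINT x|lebesgue_on \<Omega>. - u x * divergence \<sigma> x) \<le> BV_seminorm \<Omega> u"
        unfolding BV_seminorm_def by (rule SUP_upper[OF \<sigma>(1)])
      then show ?thesis using BV by (metis ereal_less_eq(3) order_trans)
    qed
    moreover have "(LINT x|lebesgue_on \<Omega>. - u x * divergence \<sigma> x) =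
        (LINT x|lborel. - u x * ((\<phi> x - \<phi> (x - v)) / norm v))"
      unfolding \<sigma>(2) using u(2) \<Omega> by (intro integral_lebesgue_on_eq_lborel) auto
    moreover have "\<dots> = ((LINT x|lborel. u x * \<phi> (x - v)) - (LINT x|lborel. u x * \<phi> x)) / norm v"
    proof -
      have "(\<lambda>x. - u x * ((\<phi> x - \<phi> (x - v)) / norm v)) = (\<lambda>x. (u x * \<phi> (x - v) - u x * \<phi> x) / norm v)"
        by (auto simp: fun_eq_iff field_simps)
      then show ?thesis using bd[OF u(1), of "-v"] bd[OF u(1), of 0] by simp
    qed
    moreover have "(LINT x|lborel. u x * \<phi> (x - v)) = (LINT x|lborel. u (v + x) * \<phi> x)"
      by (subst lborel_integral_translation(1)[symmetric, where v=v]) auto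
    ultimately have "(LINT x|lborel. u (v + x) * \<phi> x) - (LINT x|lborel. u x * \<phi> x) \<le> norm v * B"
      using False by (simp add: divide_le_eq mult.commute)
    then show "(LINT x|lborel. (u (v + x) - u x) * \<phi> x) \<le> norm v * B"
      using bd[OF u(1), of 0] bd[OF i1, of 0] by (simp add: left_diff_distrib)
  qed
qed

section \<open>Directions into a Lipschitz domain\<close>

definition admits_directions :: "'a::euclidean_space set \<Rightarrow> 'a \<Rightarrow> bool" where
  "admits_directions \<Omega> x \<longleftrightarrow> (\<exists>r>0. \<exists>K. open K \<and> K \<noteq> {} \<and> K \<subseteq> ball 0 1 \<and>
     (\<forall>y\<in>\<Omega> \<inter> ball x r. \<forall>v\<in>K. y \<in> seg_shift \<Omega> v))"

lemma interior_point_has_directions: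
  fixes x :: "'a::euclidean_space"
  assumes "open \<Omega>" "x \<in> \<Omega>"
  shows "admits_directions \<Omega> x"
proof -
  obtain r where r: "r > 0" "ball x r \<subseteq> \<Omega>" using assms open_contains_ball by blast
  have "y \<in> seg_shift \<Omega> v" if "y \<in> ball x (r / 2)" "v \<in> ball 0 (min 1 (r / 2))" for y v
    unfolding seg_shift_def
  proof safe
    fix s :: real assume s: "s \<in> {0..1}"
    have "dist x (y + s *\<^sub>R v) \<le> dist x y + norm (s *\<^sub>R v)"
        using dist_triangle[of x "y + s *\<^sub>R v" y] by (simp add: dist_norm)
    also have "norm (s *\<^sub>R v) \<le> norm v" using s by (simp add: mult_left_le_one_le)
    finally have "dist x (y + s *\<^sub>R v) < r" using that by simp
    then show "y + s *\<^sub>R v \<in> \<Omega>" using r by auto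
  qed
  then show ?thesis unfolding admits_directions_def using r(1)
    by (intro exI[of _ "r / 2"] conjI exI[of _ "ball 0 (min 1 (r / 2))"]) auto
qed

text \<open>If \<Omega> is locally the epigraph of an L-Lipschitz function over the hyperplane orthogonal to e, a step v
that rises by more than L times its horizontal part stays in the epigraph. These steps form an open
cone around e.\<close>

lemma boundary_point_has_directions:
  fixes x :: "'a::euclidean_space"
  assumes lb: "lipschitz_boundary \<Omega>" and x: "x \<in> frontier \<Omega>"
  shows "admits_directions \<Omega> x"
proof -
  obtain r e L g where r: "r > 0" and e: "norm e = 1"
    and g: "L-lipschitz_on {z. z \<bullet> e = 0} (g :: 'a \<Rightarrow> real)"
    and \<Omega>: "\<And>y. y \<in> ball x r \<Longrightarrow> y \<in> \<Omega> \<longleftrightarrow> y \<bullet> e > g (y - (y \<bullet> e) *\<^sub>R e)"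
    using lb x unfolding lipschitz_boundary_def by metis
  have ee: "e \<bullet> e = 1" using e by (simp add: norm_eq_1)
  define P where "P y = y - (y \<bullet> e) *\<^sub>R e" for y
  have Pe: "P y \<bullet> e = 0" for y by (simp add: P_def inner_diff_left ee)
  define K where "K = {v. norm v < min 1 (r / 2)} \<inter> {v. L * norm (P v) < v \<bullet> e}"
  have "open K" unfolding K_def P_def
    by (intro open_Int open_Collect_less continuous_intros)
  moreover have "(min 1 (r / 2) / 2) *\<^sub>R e \<in> K"
    using r by (auto simp: K_def P_def ee e)
  moreover have "K \<subseteq> ball 0 1" by (auto simp: K_def)
  moreover have "y \<in> seg_shift \<Omega> v" if y: "y \<in> \<Omega>" "y \<in> ball x (r / 2)" and v: "v \<in> K" for y v
    unfolding seg_shift_def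
  proof safe
    fix s :: real assume s: "s \<in> {0..1}"
    show "y + s *\<^sub>R v \<in> \<Omega>"
    proof (cases "s = 0")
      case False
      then have s0: "s > 0" using s by simp
      have "dist x (y + s *\<^sub>R v) \<le> dist x y + norm (s *\<^sub>R v)"
        using dist_triangle[of x "y + s *\<^sub>R v" y] by (simp add: dist_norm)
      also have "norm (s *\<^sub>R v) \<le> norm v" using s by (simp add: mult_left_le_one_le)
      finally have inb: "y + s *\<^sub>R v \<in> ball x r" using y v by (simp add: K_def)
      have Peq: "P (y + s *\<^sub>R v) = P y + s *\<^sub>R P v"
        by (simp add: P_def algebra_simps)
      have "dist (g (P (y + s *\<^sub>R v))) (g (P y)) \<le> L * dist (P (y + s *\<^sub>R v)) (P y)"
        using lipschitz_onD[OF g] Pe by simp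
      also have "\<dots> = s * (L * norm (P v))" using s0 by (simp add: Peq dist_norm)
      also have "\<dots> < s * (v \<bullet> e)" using v s0 by (simp add: K_def)
      finally have "g (P (y + s *\<^sub>R v)) < g (P y) + s * (v \<bullet> e)" by (simp add: dist_real_def)
      moreover have "g (P y) < y \<bullet> e" using \<Omega>[of y] y r by (simp add: P_def)
      ultimately have "g (P (y + s *\<^sub>R v)) < (y + s *\<^sub>R v) \<bullet> e" by (simp add: inner_add_left)
      then show ?thesis using \<Omega>[OF inb] by (simp add: P_def)
    qed (use y in simp)
  qed
  ultimately show ?thesis unfolding admits_directions_def using r
    by (intro exI[of _ "r / 2"] conjI exI[of _ K]) auto
qed

text \<open>The only consequence of boundary regularity that is used later. Each K i is open and hence has
positive measure; \<kappa> is a common lower bound for these measures.\<close>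

definition cone_covered :: "'a::euclidean_space set \<Rightarrow> 'b set \<Rightarrow> ('b \<Rightarrow> 'a set) \<Rightarrow> ('b \<Rightarrow> 'a set) \<Rightarrow> real \<Rightarrow> bool" where
  "cone_covered \<Omega> X A K \<kappa> \<longleftrightarrow> finite X \<and> \<Omega> \<subseteq> (\<Union>i\<in>X. A i) \<and> 0 < \<kappa> \<and>
     (\<forall>i\<in>X. open (A i) \<and> open (K i) \<and> K i \<subseteq> ball 0 1 \<and> ennreal \<kappa> \<le> emeasure lborel (K i) \<and>
        (\<forall>y\<in>A i. \<forall>v\<in>K i. y \<in> seg_shift \<Omega> v))"

lemma bounded_lipschitz_domain_cone_covered:
  fixes \<Omega> :: "'a::euclidean_space set"
  assumes "bounded_lipschitz_domain \<Omega>"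
  shows "\<exists>(X::'a set) A K \<kappa>. cone_covered \<Omega> X A K \<kappa>"
proof -
  have \<Omega>: "open \<Omega>" "bounded \<Omega>" "lipschitz_boundary \<Omega>"
    using assms by (auto simp: bounded_lipschitz_domain_def)
  have "\<forall>x\<in>closure \<Omega>. admits_directions \<Omega> x"
  proof
    fix x assume "x \<in> closure \<Omega>"
    then consider "x \<in> \<Omega>" | "x \<in> frontier \<Omega>" using \<Omega>(1) by (auto simp: frontier_def interior_open)
    then show "admits_directions \<Omega> x"
      by cases (intro interior_point_has_directions boundary_point_has_directions \<Omega>, assumption)+
  qed
  then obtain r K where rK: "\<And>x. x \<in> closure \<Omega> \<Longrightarrow> r x > 0 \<and> open (K x) \<and> K x \<noteq> {} \<and> K x \<subseteq> ball 0 1 \<and>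
      (\<forall>y\<in>\<Omega> \<inter> ball x (r x). \<forall>v\<in>K x. y \<in> seg_shift \<Omega> v)" unfolding admits_directions_def by metis
  have comp: "compact (closure \<Omega>)" using \<Omega>(2) by simp
  have "closure \<Omega> \<subseteq> (\<Union>x\<in>closure \<Omega>. ball x (r x))" using rK by force
  then obtain X where X: "X \<subseteq> closure \<Omega>" "finite X" "closure \<Omega> \<subseteq> (\<Union>x\<in>X. ball x (r x))"
    using compactE_image[OF comp, of "closure \<Omega>" "\<lambda>x. ball x (r x)"] by auto
  define \<kappa> where "\<kappa> = Min (insert 1 ((\<lambda>x. measure lborel (K x)) ` X))"
  have fin: "emeasure lborel (K x) < \<infinity>" if "x \<in> X" for x
  proof -
    have "emeasure lborel (K x) \<le> emeasure lborel (ball 0 1 :: 'a set)"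
      using rK[of x] that X(1) by (intro emeasure_mono) auto
    also have "\<dots> < \<infinity>" by (rule emeasure_bounded_finite) simp
    finally show ?thesis .
  qed
  have pos: "measure lborel (K x) > 0" if "x \<in> X" for x
  proof -
    have "K x \<noteq> {}" "open (K x)" using rK that X(1) by auto
    then have "\<not> negligible (K x)" using open_not_negligible by blast
    then have "emeasure lborel (K x) \<noteq> 0" using \<open>open (K x)\<close>
      by (simp add: negligible_iff_null_sets null_sets_def)
    then show ?thesis using fin[OF that] by (simp add: measure_def enn2real_positive_iff zero_less_iff_neq_zero)
  qed
  have "\<kappa> > 0" unfolding \<kappa>_def using X(2) pos by (subst Min_gr_iff) auto
  moreover have "ennreal \<kappa> \<le> emeasure lborel (K x)" if "x \<in> X" for x
  proof -
    have "\<kappa> \<le> measure lborel (K x)" unfolding \<kappa>_def using X(2) that by (intro Min_le) auto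
    then show ?thesis using fin[OF that] by (simp add: emeasure_eq_ennreal_measure ennreal_leI)
  qed
  ultimately have "cone_covered \<Omega> X (\<lambda>x. \<Omega> \<inter> ball x (r x)) K \<kappa>"
    unfolding cone_covered_def using X rK \<Omega>(1) closure_subset[of \<Omega>] by (auto simp: subset_iff)
  then show ?thesis by blast
qed

section \<open>Slices of a function and their differences\<close>

text \<open>What remains of a BV bound for a Borel representative u that vanishes outside \<Omega>: a bound for the
L^1 norm and for all difference quotients.\<close>

definition diff_bounded :: "'a::euclidean_space set \<Rightarrow> real \<Rightarrow> ('a \<Rightarrow> real) \<Rightarrow> bool" where
  "diff_bounded \<Omega> B u \<longleftrightarrow> u \<in> borel_measurable borel \<and> (\<forall>x. x \<notin> \<Omega> \<longrightarrow> u x = 0) \<and>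
     (\<integral>\<^sup>+x. ennreal \<bar>u x\<bar> \<partial>lborel) \<le> ennreal B \<and>
     (\<forall>v. (\<integral>\<^sup>+x. indicator (seg_shift \<Omega> v) x * ennreal \<bar>u (v + x) - u x\<bar> \<partial>lborel) \<le> ennreal (norm v * B))"

text \<open>The part of |t| between the levels 2^k and 2^(k+1).\<close>

definition slice :: "nat \<Rightarrow> real \<Rightarrow> real" where
  "slice k t = min \<bar>t\<bar> (2 ^ Suc k) - min \<bar>t\<bar> (2 ^ k)"

lemma slice_measurable [measurable]: "slice k \<in> borel_measurable borel"
  unfolding slice_def[abs_def] by measurable

lemma slice_eq_0_iff: "slice k t = 0 \<longleftrightarrow> \<bar>t\<bar> \<le> 2 ^ k"
  by (auto simp: slice_def min_def)

lemma slice_full: "\<bar>t\<bar> > 2 ^ Suc k \<Longrightarrow> slice k t = 2 ^ k"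
  by (auto simp: slice_def min_def)

text \<open>All slices are increasing functions of |t|, so their increments have the same sign and telescope.\<close>

lemma sum_slice_diff_le: "(\<Sum>k<N. \<bar>slice k a - slice k b\<bar>) \<le> \<bar>a - b\<bar>"
proof -
  have tel: "(\<Sum>k<N. slice k t) = min \<bar>t\<bar> (2 ^ N) - min \<bar>t\<bar> 1" for t
    using sum_lessThan_telescope[of "\<lambda>k. min \<bar>t\<bar> (2 ^ k)" N] by (simp add: slice_def)
  have mono: "slice k s \<le> slice k t" if "\<bar>s\<bar> \<le> \<bar>t\<bar>" for k s t
    using that by (auto simp: slice_def min_def)
  have *: "(\<Sum>k<N. \<bar>slice k a - slice k b\<bar>) \<le> \<bar>a - b\<bar>" if "\<bar>b\<bar> \<le> \<bar>a\<bar>" for a b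
  proof -
    have "(\<Sum>k<N. \<bar>slice k a - slice k b\<bar>) = (\<Sum>k<N. slice k a - slice k b)"
      using mono[OF that] by (intro sum.cong) auto
    also have "\<dots> = min \<bar>a\<bar> (2 ^ N) - min \<bar>a\<bar> 1 - (min \<bar>b\<bar> (2 ^ N) - min \<bar>b\<bar> 1)"
      by (simp add: sum_subtractf tel)
    also have "\<dots> \<le> \<bar>a\<bar> - \<bar>b\<bar>"
      using that one_le_power[of "2::real" N] by (auto simp: min_def)
    finally show ?thesis by linarith
  qed
  show ?thesis
  proof (cases "\<bar>b\<bar> \<le> \<bar>a\<bar>")
    case True then show ?thesis by (rule *)
  next
    case False
    then show ?thesis using *[of a b] by (simp add: abs_minus_commute)
  qed
qed

text \<open>A step of length m \<eta> is a chain of m steps of length \<eta>, and each of them starts at a translate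
of A that still lies in the set of admissible points.\<close>

lemma difference_subdivide:
  fixes w :: "'a::euclidean_space \<Rightarrow> real"
  assumes [measurable]: "w \<in> borel_measurable borel" "A \<in> sets borel" and \<Omega>: "open \<Omega>"
    and A: "\<And>x. x \<in> A \<Longrightarrow> x \<in> seg_shift \<Omega> \<xi>" and \<eta>: "0 \<le> \<eta>" "real m * \<eta> \<le> 1"
  shows "(\<integral>\<^sup>+x. indicator A x * ennreal \<bar>w (x + (real m * \<eta>) *\<^sub>R \<xi>) - w x\<bar> \<partial>lborel)
    \<le> of_nat m * (\<integral>\<^sup>+x. indicator (seg_shift \<Omega> (\<eta> *\<^sub>R \<xi>)) x * ennreal \<bar>w (\<eta> *\<^sub>R \<xi> + x) - w x\<bar> \<partial>lborel)"
proof -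
  define g where "g y = indicator (seg_shift \<Omega> (\<eta> *\<^sub>R \<xi>)) y * ennreal \<bar>w (\<eta> *\<^sub>R \<xi> + y) - w y\<bar>" for y
  have [measurable]: "seg_shift \<Omega> (\<eta> *\<^sub>R \<xi>) \<in> sets borel" using open_seg_shift[OF \<Omega>] by auto
  have [measurable]: "g \<in> borel_measurable borel" unfolding g_def by measurable
  have "(\<integral>\<^sup>+x. indicator A x * ennreal \<bar>w (x + (real m * \<eta>) *\<^sub>R \<xi>) - w x\<bar> \<partial>lborel)
      \<le> (\<integral>\<^sup>+x. (\<Sum>i<m. g ((real i * \<eta>) *\<^sub>R \<xi> + x)) \<partial>lborel)"
  proof (rule nn_integral_mono)
    fix x
    show "indicator A x * ennreal \<bar>w (x + (real m * \<eta>) *\<^sub>R \<xi>) - w x\<bar> \<le> (\<Sum>i<m. g ((real i * \<eta>) *\<^sub>R \<xi> + x))"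
    proof (cases "x \<in> A")
      case True
      have seg: "(real i * \<eta>) *\<^sub>R \<xi> + x \<in> seg_shift \<Omega> (\<eta> *\<^sub>R \<xi>)" if "i < m" for i
        unfolding seg_shift_def
      proof safe
        fix s :: real assume s: "s \<in> {0..1}"
        have "(real i + s) * \<eta> \<le> real m * \<eta>" using s that \<eta> by (intro mult_right_mono) auto
        then have "(real i + s) * \<eta> \<in> {0..1}" using \<eta> s by auto
        then have "x + ((real i + s) * \<eta>) *\<^sub>R \<xi> \<in> \<Omega>" using A[OF True] by (auto simp: seg_shift_def)
        then show "(real i * \<eta>) *\<^sub>R \<xi> + x + s *\<^sub>R \<eta> *\<^sub>R \<xi> \<in> \<Omega>"
          by (simp add: algebra_simps)
      qed
      have "w (x + (real m * \<eta>) *\<^sub>R \<xi>) - w x =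
          (\<Sum>i<m. w ((real (Suc i) * \<eta>) *\<^sub>R \<xi> + x) - w ((real i * \<eta>) *\<^sub>R \<xi> + x))"
        by (subst sum_lessThan_telescope[of "\<lambda>i. w ((real i * \<eta>) *\<^sub>R \<xi> + x)"]) (simp add: add.commute)
      then have "\<bar>w (x + (real m * \<eta>) *\<^sub>R \<xi>) - w x\<bar> \<le>
          (\<Sum>i<m. \<bar>w ((real (Suc i) * \<eta>) *\<^sub>R \<xi> + x) - w ((real i * \<eta>) *\<^sub>R \<xi> + x)\<bar>)"
        by (simp only: sum_abs)
      then have "ennreal \<bar>w (x + (real m * \<eta>) *\<^sub>R \<xi>) - w x\<bar> \<le>
          ennreal (\<Sum>i<m. \<bar>w ((real (Suc i) * \<eta>) *\<^sub>R \<xi> + x) - w ((real i * \<eta>) *\<^sub>R \<xi> + x)\<bar>)"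
        by (rule ennreal_leI)
      also have "\<dots> = (\<Sum>i<m. ennreal \<bar>w ((real (Suc i) * \<eta>) *\<^sub>R \<xi> + x) - w ((real i * \<eta>) *\<^sub>R \<xi> + x)\<bar>)"
        by (simp add: sum_ennreal)
      also have "\<dots> = (\<Sum>i<m. g ((real i * \<eta>) *\<^sub>R \<xi> + x))"
        using seg by (intro sum.cong) (auto simp: g_def algebra_simps)
      finally show ?thesis using True by simp
    qed simp
  qed
  also have "\<dots> = (\<Sum>i<m. \<integral>\<^sup>+x. g ((real i * \<eta>) *\<^sub>R \<xi> + x) \<partial>lborel)"
    by (rule nn_integral_sum) measurable
  also have "\<dots> = (\<Sum>i<m. \<integral>\<^sup>+x. g x \<partial>lborel)"
    by (subst nn_integral_lborel_translation) auto
  finally show ?thesis by (simp add: g_def)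
qed

text \<open>Each slice is differenced at its own scale 1 / 2^(j k). Difference quotients can only grow when the
step is subdivided, so all of them may be compared at one common scale, where the slices add up
to at most the difference of u.\<close>

lemma multiscale_slices:
  fixes u :: "'a::euclidean_space \<Rightarrow> real" and j :: "nat \<Rightarrow> nat" and B :: real
  assumes \<Omega>: "open \<Omega>" and u: "diff_bounded \<Omega> B u" and [measurable]: "A \<in> sets borel"
    and A: "\<And>x. x \<in> A \<Longrightarrow> x \<in> seg_shift \<Omega> \<xi>"
  shows "(\<Sum>k<N. 2 ^ j k * (\<integral>\<^sup>+x. indicator A x *
      ennreal \<bar>slice k (u (x + (1 / 2 ^ j k) *\<^sub>R \<xi>)) - slice k (u x)\<bar> \<partial>lborel)) \<le> ennreal (norm \<xi> * B)"
proof -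
  have [measurable]: "u \<in> borel_measurable borel" using u by (auto simp: diff_bounded_def)
  (* Any scale at least as fine as every j k would do. *)
  define n where "n = (\<Sum>k<N. j k)"
  define \<eta> :: real where "\<eta> = 1 / 2 ^ n"
  have [measurable]: "seg_shift \<Omega> (\<eta> *\<^sub>R \<xi>) \<in> sets borel" using open_seg_shift[OF \<Omega>] by auto
  define F where "F k y = indicator (seg_shift \<Omega> (\<eta> *\<^sub>R \<xi>)) y * ennreal \<bar>slice k (u (\<eta> *\<^sub>R \<xi> + y)) - slice k (u y)\<bar>" for k y
  have [measurable]: "F k \<in> borel_measurable borel" for k unfolding F_def by measurable
  have "2 ^ j k * (\<integral>\<^sup>+x. indicator A x *
      ennreal \<bar>slice k (u (x + (1 / 2 ^ j k) *\<^sub>R \<xi>)) - slice k (u x)\<bar> \<partial>lborel)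
      \<le> 2 ^ n * (\<integral>\<^sup>+y. F k y \<partial>lborel)" if k: "k < N" for k
  proof -
    have jn: "j k \<le> n" unfolding n_def using k by (intro member_le_sum) auto
    have e: "real (2 ^ (n - j k)) * \<eta> = 1 / 2 ^ j k"
    proof -
      have "real (2 ^ (n - j k)) = (2::real) ^ (n - j k)" by simp
      also have "\<dots> = 2 ^ n / 2 ^ j k" using jn by (subst power_diff) auto
      finally show ?thesis by (simp add: \<eta>_def)
    qed
    have "(\<integral>\<^sup>+x. indicator A x *
        ennreal \<bar>slice k (u (x + (real (2 ^ (n - j k)) * \<eta>) *\<^sub>R \<xi>)) - slice k (u x)\<bar> \<partial>lborel)
        \<le> of_nat (2 ^ (n - j k)) * (\<integral>\<^sup>+y. F k y \<partial>lborel)"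
      unfolding F_def
      by (rule difference_subdivide[OF _ _ \<Omega> A]) (use e in \<open>auto simp: \<eta>_def\<close>)
    then have "2 ^ j k * (\<integral>\<^sup>+x. indicator A x *
        ennreal \<bar>slice k (u (x + (1 / 2 ^ j k) *\<^sub>R \<xi>)) - slice k (u x)\<bar> \<partial>lborel)
        \<le> 2 ^ j k * (of_nat (2 ^ (n - j k)) * (\<integral>\<^sup>+y. F k y \<partial>lborel))"
      unfolding e by (rule mult_left_mono) simp
    also have "\<dots> = 2 ^ n * (\<integral>\<^sup>+y. F k y \<partial>lborel)"
      using jn by (simp add: mult.assoc[symmetric] power_add[symmetric])
    finally show ?thesis .
  qed
  then have "(\<Sum>k<N. 2 ^ j k * (\<integral>\<^sup>+x. indicator A x *
      ennreal \<bar>slice k (u (x + (1 / 2 ^ j k) *\<^sub>R \<xi>)) - slice k (u x)\<bar> \<partial>lborel))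
      \<le> (\<Sum>k<N. 2 ^ n * (\<integral>\<^sup>+y. F k y \<partial>lborel))" by (intro sum_mono) auto
  also have "\<dots> = 2 ^ n * (\<integral>\<^sup>+y. (\<Sum>k<N. F k y) \<partial>lborel)"
    by (simp add: sum_distrib_left nn_integral_sum)
  also have "(\<integral>\<^sup>+y. (\<Sum>k<N. F k y) \<partial>lborel) \<le>
      (\<integral>\<^sup>+y. indicator (seg_shift \<Omega> (\<eta> *\<^sub>R \<xi>)) y * ennreal \<bar>u (\<eta> *\<^sub>R \<xi> + y) - u y\<bar> \<partial>lborel)"
  proof (rule nn_integral_mono)
    fix y
    have "(\<Sum>k<N. F k y) = indicator (seg_shift \<Omega> (\<eta> *\<^sub>R \<xi>)) y * ennreal (\<Sum>k<N. \<bar>slice k (u (\<eta> *\<^sub>R \<xi> + y)) - slice k (u y)\<bar>)"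
      unfolding F_def sum_distrib_left[symmetric] by (subst sum_ennreal) auto
    also have "\<dots> \<le> indicator (seg_shift \<Omega> (\<eta> *\<^sub>R \<xi>)) y * ennreal \<bar>u (\<eta> *\<^sub>R \<xi> + y) - u y\<bar>"
      by (intro mult_left_mono ennreal_leI sum_slice_diff_le) simp
    finally show "(\<Sum>k<N. F k y) \<le> indicator (seg_shift \<Omega> (\<eta> *\<^sub>R \<xi>)) y * ennreal \<bar>u (\<eta> *\<^sub>R \<xi> + y) - u y\<bar>" .
  qed
  also have "\<dots> \<le> ennreal (norm (\<eta> *\<^sub>R \<xi>) * B)" using u unfolding diff_bounded_def by blast
  also have "2 ^ n * ennreal (norm (\<eta> *\<^sub>R \<xi>) * B) = ennreal (norm \<xi> * B)"
  proof -
    have "(2 ^ n :: ennreal) = ennreal (2 ^ n)" by (simp add: ennreal_power[symmetric])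
    then show ?thesis by (simp add: ennreal_mult'[symmetric] \<eta>_def)
  qed
  finally show ?thesis by (simp add: mult_left_mono)
qed

lemma emeasure_lborel_scaled_preimage:
  fixes W :: "'a::euclidean_space set"
  assumes [measurable]: "W \<in> sets borel" and h: "h > 0"
  shows "ennreal (h ^ DIM('a)) * emeasure lborel {\<xi>. x + h *\<^sub>R \<xi> \<in> W} = emeasure lborel W"
proof -
  have "emeasure lborel W = emeasure (density (distr lborel borel (\<lambda>\<xi>. x + h *\<^sub>R \<xi>)) (\<lambda>_. ennreal (\<bar>h\<bar> ^ DIM('a)))) W"
    using lborel_affine[of h x] h by simp
  also have "\<dots> = ennreal (h ^ DIM('a)) * emeasure (distr lborel borel (\<lambda>\<xi>. x + h *\<^sub>R \<xi>)) W"
    using h by (subst emeasure_density) (auto simp: nn_integral_cmult_indicator)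
  also have "emeasure (distr lborel borel (\<lambda>\<xi>. x + h *\<^sub>R \<xi>)) W = emeasure lborel {\<xi>. x + h *\<^sub>R \<xi> \<in> W}"
    by (subst emeasure_distr) (auto simp: vimage_def)
  finally show ?thesis by simp
qed

text \<open>From any point, at most half of the steps h \<xi> with \<xi> in K can lead into the set where w is
nonzero, because that set is small. So a point where w equals t sees a drop by t in a set of
directions of measure at least \<kappa> / 2; integrating over such points and exchanging the order of
integration gives the claim.\<close>

lemma level_set_le_differences:
  fixes w :: "'a::euclidean_space \<Rightarrow> real" and \<kappa> h t :: real
  assumes [measurable]: "w \<in> borel_measurable borel" "A \<in> sets borel" "K \<in> sets borel"
    and K: "ennreal \<kappa> \<le> emeasure lborel K" and \<kappa>: "\<kappa> > 0" and h: "h > 0" and t: "t \<ge> 0"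
    and small: "emeasure lborel {x. w x \<noteq> 0} \<le> ennreal (h ^ DIM('a) * (\<kappa> / 2))"
  shows "ennreal (t * (\<kappa> / 2)) * emeasure lborel (A \<inter> {x. w x = t}) \<le>
    (\<integral>\<^sup>+\<xi>. indicator K \<xi> * (\<integral>\<^sup>+x. indicator A x * ennreal \<bar>w (x + h *\<^sub>R \<xi>) - w x\<bar> \<partial>lborel) \<partial>lborel)"
proof -
  have zero: "ennreal (\<kappa> / 2) \<le> emeasure lborel (K \<inter> {\<xi>. w (x + h *\<^sub>R \<xi>) = 0})" for x
  proof -
    define Z where "Z = {\<xi>. w (x + h *\<^sub>R \<xi>) \<noteq> 0}"
    have [measurable]: "Z \<in> sets borel" unfolding Z_def by measurable
    have "ennreal (h ^ DIM('a)) * emeasure lborel Z = emeasure lborel {x. w x \<noteq> 0}"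
      using emeasure_lborel_scaled_preimage[of "{x. w x \<noteq> 0}" h x] h by (simp add: Z_def)
    also have "\<dots> \<le> ennreal (h ^ DIM('a)) * ennreal (\<kappa> / 2)"
      using small h \<kappa> by (simp add: ennreal_mult'[symmetric])
    finally have Z: "emeasure lborel Z \<le> ennreal (\<kappa> / 2)"
      using h by (subst (asm) ennreal_mult_le_mult_iff) auto
    have "ennreal (\<kappa> / 2) + ennreal (\<kappa> / 2) = ennreal \<kappa>" using \<kappa> by (simp add: ennreal_plus[symmetric] del: ennreal_plus)
    also have "\<dots> \<le> emeasure lborel K" by (rule K)
    also have "\<dots> \<le> emeasure lborel ((K \<inter> {\<xi>. w (x + h *\<^sub>R \<xi>) = 0}) \<union> Z)"
      by (intro emeasure_mono) (auto simp: Z_def)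
    also have "\<dots> \<le> emeasure lborel (K \<inter> {\<xi>. w (x + h *\<^sub>R \<xi>) = 0}) + emeasure lborel Z"
      by (intro emeasure_subadditive) auto
    also have "\<dots> \<le> emeasure lborel (K \<inter> {\<xi>. w (x + h *\<^sub>R \<xi>) = 0}) + ennreal (\<kappa> / 2)"
      by (intro add_left_mono Z)
    finally show ?thesis by (simp add: ennreal_add_left_cancel_le add.commute)
  qed
  have "ennreal (t * (\<kappa> / 2)) * emeasure lborel (A \<inter> {x. w x = t}) =
      (\<integral>\<^sup>+x. ennreal (t * (\<kappa> / 2)) * indicator (A \<inter> {x. w x = t}) x \<partial>lborel)"
    by (simp add: nn_integral_cmult_indicator)
  also have "\<dots> \<le> (\<integral>\<^sup>+x. (\<integral>\<^sup>+\<xi>. indicator K \<xi> * (indicator A x * ennreal \<bar>w (x + h *\<^sub>R \<xi>) - w x\<bar>) \<partial>lborel) \<partial>lborel)"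
  proof (rule nn_integral_mono)
    fix x
    show "ennreal (t * (\<kappa> / 2)) * indicator (A \<inter> {x. w x = t}) x \<le>
        (\<integral>\<^sup>+\<xi>. indicator K \<xi> * (indicator A x * ennreal \<bar>w (x + h *\<^sub>R \<xi>) - w x\<bar>) \<partial>lborel)"
    proof (cases "x \<in> A \<and> w x = t")
      case True
      have "ennreal (t * (\<kappa> / 2)) = ennreal t * ennreal (\<kappa> / 2)" using t \<kappa> by (intro ennreal_mult) auto
      also have "\<dots> \<le> ennreal t * emeasure lborel (K \<inter> {\<xi>. w (x + h *\<^sub>R \<xi>) = 0})"
        by (intro mult_left_mono zero) simp
      also have "\<dots> = (\<integral>\<^sup>+\<xi>. ennreal t * indicator (K \<inter> {\<xi>. w (x + h *\<^sub>R \<xi>) = 0}) \<xi> \<partial>lborel)"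
        by (simp add: nn_integral_cmult_indicator)
      also have "\<dots> \<le> (\<integral>\<^sup>+\<xi>. indicator K \<xi> * (indicator A x * ennreal \<bar>w (x + h *\<^sub>R \<xi>) - w x\<bar>) \<partial>lborel)"
        using True t by (intro nn_integral_mono) (auto simp: indicator_def)
      finally show ?thesis using True by simp
    qed (auto simp: indicator_def)
  qed
  also have "\<dots> = (\<integral>\<^sup>+\<xi>. (\<integral>\<^sup>+x. indicator K \<xi> * (indicator A x * ennreal \<bar>w (x + h *\<^sub>R \<xi>) - w x\<bar>) \<partial>lborel) \<partial>lborel)"
    by (rule lborel_pair.Fubini') measurable
  also have "\<dots> = (\<integral>\<^sup>+\<xi>. indicator K \<xi> * (\<integral>\<^sup>+x. indicator A x * ennreal \<bar>w (x + h *\<^sub>R \<xi>) - w x\<bar> \<partial>lborel) \<partial>lborel)"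
    by (intro nn_integral_cong nn_integral_cmult) measurable
  finally show ?thesis .
qed

section \<open>The Sobolev bound\<close>

text \<open>With p = 1 / (1 - \<theta>) and b k = 2^(k p) (a k), the exponents match exactly and the recursion becomes
b (k + 1) <= c' (b k)^\<theta> (D k). As \<theta> < 1, this first bounds b uniformly, and then the sum of b by the
sum of D.\<close>

lemma level_recursion_sum_bounded:
  fixes \<theta> c S V :: real and k0 :: nat
  assumes \<theta>: "0 < \<theta>" "\<theta> < 1" and nonneg: "0 \<le> c" "0 \<le> S" "0 \<le> V"
  shows "\<exists>M\<ge>0. \<forall>a D. (\<forall>k. 0 \<le> a k \<and> a k \<le> V) \<longrightarrow> (\<forall>k. 0 \<le> D k) \<longrightarrow> (\<forall>N. (\<Sum>k<N. D k) \<le> S) \<longrightarrow>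
     (\<forall>k\<ge>k0. a (Suc k) \<le> c * a k powr \<theta> * D k / 2 ^ k) \<longrightarrow>
     (\<forall>N. (\<Sum>k<N. 2 powr (real k / (1 - \<theta>)) * a k) \<le> M)"
proof -
  define p where "p = 1 / (1 - \<theta>)"
  have p: "p > 0" "p * \<theta> = p - 1" "1 / p = 1 - \<theta>"
    using \<theta> by (auto simp: p_def field_simps)
  define c' where "c' = c * 2 powr p"
  define M1 where "M1 = 2 powr (real k0 * p) * V"
  define M0 where "M0 = max M1 ((c' * S) powr p)"
  have c'0: "c' \<ge> 0" using nonneg by (simp add: c'_def)
  have M1: "M1 \<ge> 0" using nonneg by (simp add: M1_def)
  have M0: "M0 \<ge> 0" using M1 by (simp add: M0_def)
  (* M0 is large enough to be preserved by one step of the recursion. *)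
  have fix_M0: "c' * M0 powr \<theta> * S \<le> M0"
  proof (cases "M0 = 0")
    case False
    have "c' * S = ((c' * S) powr p) powr (1 / p)"
      using p(1) c'0 nonneg \<theta> by (simp add: powr_powr)
    also have "\<dots> \<le> M0 powr (1 / p)" using p by (intro powr_mono2) (use \<theta> in \<open>auto simp: M0_def\<close>)
    finally have "c' * S * M0 powr \<theta> \<le> M0 powr (1 / p) * M0 powr \<theta>" by (intro mult_right_mono) auto
    also have "\<dots> = M0 powr 1" unfolding powr_add[symmetric] p(3) by simp
    also have "\<dots> = M0" using M0 by simp
    finally show ?thesis by (simp add: mult_ac)
  qed (use \<theta> in simp)
  define M where "M = real (Suc k0) * M1 + c' * M0 powr \<theta> * S"
  show ?thesis
  proof (intro exI[of _ M] conjI allI impI)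
    show "M \<ge> 0" using M1 c'0 nonneg by (simp add: M_def)
  next
    fix a D :: "nat \<Rightarrow> real" and N
    assume a: "\<forall>k. 0 \<le> a k \<and> a k \<le> V" and D: "\<forall>k. 0 \<le> D k" and DS: "\<forall>N. (\<Sum>k<N. D k) \<le> S"
      and rec: "\<forall>k\<ge>k0. a (Suc k) \<le> c * a k powr \<theta> * D k / 2 ^ k"
    define b where "b k = 2 powr (real k * p) * a k" for k
    have b0: "b k \<ge> 0" for k using a by (simp add: b_def)
    have DleS: "D k \<le> S" for k
    proof -
      have "D k \<le> (\<Sum>i<Suc k. D i)" using D by (intro member_le_sum) auto
      then show ?thesis using DS order_trans by blast
    qed
    have brec: "b (Suc k) \<le> c' * b k powr \<theta> * D k" if "k \<ge> k0" for k
    proof -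
      have e1: "2 powr (real (Suc k) * p) = 2 powr p * 2 powr (real k * p)"
        by (simp add: powr_add[symmetric] algebra_simps)
      have "real k * p * \<theta> = real k * p - real k"
        using p(2) by (simp add: right_diff_distrib mult.assoc)
      then have "2 powr (real k * p * \<theta>) = 2 powr (real k * p) / 2 powr (real k)"
        by (simp add: powr_diff)
      then have e2: "b k powr \<theta> = 2 powr (real k * p) / 2 ^ k * a k powr \<theta>"
        using a by (simp add: b_def powr_mult powr_powr powr_realpow)
      have "b (Suc k) \<le> 2 powr (real (Suc k) * p) * (c * a k powr \<theta> * D k / 2 ^ k)"
        unfolding b_def using rec that by (intro mult_left_mono) auto
      also have "\<dots> = c' * b k powr \<theta> * D k"
        unfolding e1 e2 c'_def by (simp add: field_simps)
      finally show ?thesis .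
    qed
    have small: "b k \<le> M1" if "k \<le> k0" for k
      unfolding b_def M1_def using a that p(1) by (intro mult_mono powr_mono) auto
    have bM0: "b k \<le> M0" if "k \<ge> k0" for k using that
    proof (induction k rule: dec_induct)
      case base then show ?case using small[of k0] by (simp add: M0_def)
    next
      case (step k)
      have "b (Suc k) \<le> c' * b k powr \<theta> * D k" using step by (intro brec)
      also have "\<dots> \<le> c' * M0 powr \<theta> * S"
        using step.IH b0 \<theta> c'0 D DleS by (intro mult_mono powr_mono2) auto
      also have "\<dots> \<le> M0" by (rule fix_M0)
      finally show ?case .
    qed
    have "b k \<le> (if k \<le> k0 then M1 else 0) + c' * M0 powr \<theta> * (case k of 0 \<Rightarrow> 0 | Suc i \<Rightarrow> D i)" for k
    proof (cases "k \<le> k0")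
      case True
      then show ?thesis using small[OF True] c'0 D by (auto split: nat.split intro!: add_increasing2)
    next
      case False
      then obtain i where i: "k = Suc i" "i \<ge> k0" by (cases k) auto
      have "b k \<le> c' * b i powr \<theta> * D i" using brec i by simp
      also have "\<dots> \<le> c' * M0 powr \<theta> * D i"
        using bM0[OF i(2)] b0 \<theta> c'0 D by (intro mult_mono powr_mono2) auto
      finally show ?thesis using i by simp
    qed
    then have "(\<Sum>k<N. b k) \<le> (\<Sum>k<N. (if k \<le> k0 then M1 else 0) + c' * M0 powr \<theta> * (case k of 0 \<Rightarrow> 0 | Suc i \<Rightarrow> D i))"
      by (intro sum_mono)
    also have "\<dots> = (\<Sum>k<N. if k \<le> k0 then M1 else 0) + c' * M0 powr \<theta> * (\<Sum>k<N. case k of 0 \<Rightarrow> 0 | Suc i \<Rightarrow> D i)"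
      by (simp add: sum.distrib sum_distrib_left)
    also have "(\<Sum>k<N. if k \<le> k0 then M1 else 0) \<le> real (Suc k0) * M1"
    proof -
      have "(\<Sum>k<N. if k \<le> k0 then M1 else 0) = (\<Sum>k\<in>{..<N} \<inter> {k. k \<le> k0}. M1)"
        by (simp add: sum.If_cases)
      also have "\<dots> \<le> (\<Sum>k\<in>{..k0}. M1)" using M1 by (intro sum_mono2) auto
      finally show ?thesis by simp
    qed
    also have "(\<Sum>k<N. case k of 0 \<Rightarrow> 0 | Suc i \<Rightarrow> D i) \<le> S"
    proof (cases N)
      case (Suc n)
      then show ?thesis using DS by (simp add: sum.lessThan_Suc_shift del: sum.lessThan_Suc)
    qed (use nonneg in simp)
    finally have "(\<Sum>k<N. b k) \<le> M"
      using c'0 by (simp add: M_def mult_left_mono)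
    then show "(\<Sum>k<N. 2 powr (real k / (1 - \<theta>)) * a k) \<le> M" by (simp add: b_def p_def)
  qed
qed

text \<open>A dyadic number comparable to the d-th root of y, from above within a factor 2.\<close>

lemma dyadic_scale:
  fixes y :: real
  assumes y: "0 < y" "y \<le> 1" and d: "d > 0"
  shows "\<exists>j. y \<le> (1 / 2 ^ j) ^ d \<and> 1 / 2 ^ j \<le> 2 * y powr (1 / real d)"
proof -
  define z where "z = y powr (1 / real d)"
  have z: "z > 0" using y by (simp add: z_def)
  have zd: "z ^ d = y" using y d by (simp add: z_def powr_realpow[symmetric] powr_powr)
  have z1: "z \<le> 1" using y by (simp add: z_def powr_le_one_le powr_le1)
  define n where "n = (LEAST n. (1 / 2) ^ n < z)"
  have "\<exists>n. (1 / 2 :: real) ^ n < z" using real_arch_pow_inv[OF z, of "1/2"] by auto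
  then have n: "(1 / 2) ^ n < z" unfolding n_def by (rule LeastI_ex)
  then have "n \<noteq> 0" using z1 by (intro notI) simp
  then obtain j where j: "n = Suc j" using not0_implies_Suc by blast
  then have "\<not> (1 / 2) ^ j < z" unfolding n_def by (metis lessI not_less_Least)
  then have "z \<le> 1 / 2 ^ j" by (simp add: power_one_over)
  moreover from this have "y \<le> (1 / 2 ^ j) ^ d" unfolding zd[symmetric] using z by (intro power_mono) auto
  moreover have "1 / 2 ^ j \<le> 2 * z" using n by (simp add: j power_one_over)
  ultimately show ?thesis unfolding z_def by blast
qed

text \<open>Let a k be the measure of the set where |u| > 2^k. From some k0 on, depending only on B, a k is at most
\<kappa> / 2 and there is a dyadic scale h with h^d comparable to 2 (a k) / \<kappa>. Then level_set_le_differences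
bounds 2^k a (k + 1) by h times the difference quotients D k of the k-th slice, and multiscale_slices
bounds the sum of the D k. Hence a satisfies the recursion of level_recursion_sum_bounded.
The exponent \<theta> may be smaller than 1 / d, which is what gives all finite exponents if d = 1.\<close>

lemma sobolev_bound:
  fixes \<Omega> :: "'a::euclidean_space set" and B \<theta> \<kappa> :: real
  assumes \<Omega>: "open \<Omega>" "bounded \<Omega>" and cov: "cone_covered \<Omega> X A K \<kappa>" and B: "B \<ge> 0"
    and \<theta>: "0 < \<theta>" "\<theta> < 1" "\<theta> \<le> 1 / DIM('a)"
  shows "\<exists>M\<ge>0. \<forall>u. diff_bounded \<Omega> B u \<longrightarrow>
    (\<integral>\<^sup>+x. ennreal (\<bar>u x\<bar> powr (1 / (1 - \<theta>))) \<partial>lborel) \<le> ennreal M"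
proof -
  define p where "p = 1 / (1 - \<theta>)"
  have p: "p > 0" using \<theta> by (simp add: p_def)
  have X: "finite X" "\<Omega> \<subseteq> (\<Union>i\<in>X. A i)" "0 < \<kappa>" using cov by (auto simp: cone_covered_def)
  have AK: "open (A i)" "open (K i)" "K i \<subseteq> ball 0 1" "ennreal \<kappa> \<le> emeasure lborel (K i)"
    "\<And>y v. y \<in> A i \<Longrightarrow> v \<in> K i \<Longrightarrow> y \<in> seg_shift \<Omega> v" if "i \<in> X" for i
    using cov that by (auto simp: cone_covered_def)
  have \<Omega>fin: "emeasure lborel \<Omega> < \<infinity>" using \<Omega>(2) by (rule emeasure_bounded_finite)
  have [measurable]: "\<Omega> \<in> sets borel" using \<Omega>(1) by auto
  define V where "V = measure lborel \<Omega>"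
  define \<beta> where "\<beta> = measure lborel (ball 0 1 :: 'a set)"
  have \<beta>: "emeasure lborel (ball 0 1 :: 'a set) = ennreal \<beta>"
    unfolding \<beta>_def by (intro emeasure_eq_ennreal_measure) (use emeasure_bounded_finite[of "ball 0 1 :: 'a set"] in auto)
  have \<beta>0: "\<beta> \<ge> 0" by (simp add: \<beta>_def)
  define S where "S = real (card X) * (B * \<beta>)"
  have S: "S \<ge> 0" using B by (simp add: S_def \<beta>_def)
  obtain k0 :: nat where k0: "2 * B / \<kappa> < 2 ^ k0"
    using real_arch_pow[of 2 "2 * B / \<kappa>"] by auto
  define c where "c = (4 / \<kappa>) * (2 / \<kappa>) powr \<theta>"
  have c: "c \<ge> 0" using X by (simp add: c_def)
  obtain M where M: "M \<ge> 0" and Mb: "\<And>a D. (\<forall>k. 0 \<le> a k \<and> a k \<le> V) \<Longrightarrow> (\<forall>k. 0 \<le> D k) \<Longrightarrow> (\<forall>N. (\<Sum>k<N. D k) \<le> S) \<Longrightarrow>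
     (\<forall>k\<ge>k0. a (Suc k) \<le> c * a k powr \<theta> * D k / 2 ^ k) \<Longrightarrow>
     (\<forall>N. (\<Sum>k<N. 2 powr (real k / (1 - \<theta>)) * a k) \<le> M)"
    using level_recursion_sum_bounded[OF \<theta>(1,2) c S, of V k0] by (auto simp: V_def)
  show ?thesis
  proof (intro exI[of _ "V + 2 powr p * M"] conjI allI impI)
    show "0 \<le> V + 2 powr p * M" using M by (simp add: V_def)
  next
    fix u assume u: "diff_bounded \<Omega> B u"
    then have [measurable]: "u \<in> borel_measurable borel" and u0: "\<And>x. x \<notin> \<Omega> \<Longrightarrow> u x = 0"
      and uB: "(\<integral>\<^sup>+x. ennreal \<bar>u x\<bar> \<partial>lborel) \<le> ennreal B"
      by (auto simp: diff_bounded_def)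
    define L where "L k = {x. \<bar>u x\<bar> > 2 ^ k}" for k :: nat
    have [measurable]: "L k \<in> sets borel" for k unfolding L_def by measurable
    have L\<Omega>: "L k \<subseteq> \<Omega>" for k unfolding L_def using u0 by (auto simp: not_less intro: ccontr)
    define a where "a k = measure lborel (L k)" for k
    have Lfin: "emeasure lborel (L k) < \<infinity>" for k
      using emeasure_mono[OF L\<Omega>, of lborel k] \<Omega>fin by (auto intro: le_less_trans)
    have La: "emeasure lborel (L k) = ennreal (a k)" for k
      unfolding a_def using Lfin[of k] by (intro emeasure_eq_ennreal_measure) auto
    have aV: "0 \<le> a k \<and> a k \<le> V" for k
      unfolding a_def V_def using \<Omega>fin L\<Omega> by (auto intro!: measure_mono_fmeasurable simp: fmeasurable_def)
    have a_small: "a k \<le> \<kappa> / 2" if "k \<ge> k0" for k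
    proof -
      have "ennreal (2 ^ k * a k) = (\<integral>\<^sup>+x. ennreal (2 ^ k) * indicator (L k) x \<partial>lborel)"
        by (subst nn_integral_cmult_indicator) (auto simp: La ennreal_mult aV)
      also have "\<dots> \<le> (\<integral>\<^sup>+x. ennreal \<bar>u x\<bar> \<partial>lborel)"
        by (intro nn_integral_mono) (auto simp: indicator_def L_def intro: ennreal_leI)
      also have "\<dots> \<le> ennreal B" by (rule uB)
      finally have "2 ^ k * a k \<le> B" using B by (simp add: ennreal_le_iff)
      moreover have "2 * B \<le> 2 ^ k * \<kappa>"
      proof -
        have "2 * B / \<kappa> < 2 ^ k" using k0 power_increasing[OF that, of "2::real"] by linarith
        then show ?thesis using X(3) by (simp add: field_simps)
      qed
      ultimately have "2 ^ k * (2 * a k) \<le> 2 ^ k * \<kappa>" unfolding mult.left_commute[of _ 2] by linarith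
      then show ?thesis by (subst (asm) mult_le_cancel_left_pos) auto
    qed
    have a_dec: "a (Suc k) \<le> a k" for k
      unfolding a_def using Lfin[of k]
      by (intro measure_mono_fmeasurable) (auto simp: L_def fmeasurable_def less_eq_real_def intro: le_less_trans[rotated])
    (* If a k = 0 the scale does not matter, as the next level set is null as well. *)
    have "\<exists>j. k0 \<le> k \<longrightarrow> a k \<noteq> 0 \<longrightarrow> 2 * a k / \<kappa> \<le> (1 / 2 ^ j) ^ DIM('a) \<and>
        1 / 2 ^ j \<le> 2 * (2 * a k / \<kappa>) powr (1 / DIM('a))" for k
    proof (cases "k0 \<le> k \<and> a k \<noteq> 0")
      case True
      then have "0 < 2 * a k / \<kappa>" "2 * a k / \<kappa> \<le> 1"
        using aV[of k] X(3) a_small[of k] by (auto simp: less_le)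
      from dyadic_scale[OF this DIM_positive] show ?thesis by blast
    qed auto
    then obtain j where j: "\<And>k. k0 \<le> k \<Longrightarrow> a k \<noteq> 0 \<Longrightarrow> 2 * a k / \<kappa> \<le> (1 / 2 ^ j k) ^ DIM('a)"
        "\<And>k. k0 \<le> k \<Longrightarrow> a k \<noteq> 0 \<Longrightarrow> 1 / 2 ^ j k \<le> 2 * (2 * a k / \<kappa>) powr (1 / DIM('a))"
      by metis
    define I where "I i k \<xi> = (\<integral>\<^sup>+x. indicator (A i) x *
      ennreal \<bar>slice k (u (x + (1 / 2 ^ j k) *\<^sub>R \<xi>)) - slice k (u x)\<bar> \<partial>lborel)" for i k \<xi>
    define E where "E i k = (\<integral>\<^sup>+\<xi>. indicator (K i) \<xi> * I i k \<xi> \<partial>lborel)" for i k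
    have meas_I [measurable]: "I i k \<in> borel_measurable borel" if "i \<in> X" for i k
    proof -
      have [measurable]: "A i \<in> sets borel" using AK(1)[OF that] by auto
      have "(\<lambda>\<xi>. I i k \<xi>) \<in> borel_measurable lborel" unfolding I_def by measurable
      then show ?thesis by simp
    qed
    have E_sum: "(\<Sum>k<N. 2 ^ j k * E i k) \<le> ennreal (B * \<beta>)" if i: "i \<in> X" for i N
    proof -
      have [measurable]: "A i \<in> sets borel" "K i \<in> sets borel" using AK[OF i] by auto
      note meas_I[OF i, measurable]
      have "(\<Sum>k<N. 2 ^ j k * E i k) = (\<integral>\<^sup>+\<xi>. indicator (K i) \<xi> * (\<Sum>k<N. 2 ^ j k * I i k \<xi>) \<partial>lborel)"
        unfolding E_def sum_distrib_left
        by (subst nn_integral_sum) (auto simp: nn_integral_cmult[symmetric] mult_ac intro!: sum.cong)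
      also have "\<dots> \<le> (\<integral>\<^sup>+\<xi>. ennreal B * indicator (ball 0 1 :: 'a set) \<xi> \<partial>lborel)"
      proof (rule nn_integral_mono)
        fix \<xi>
        show "indicator (K i) \<xi> * (\<Sum>k<N. 2 ^ j k * I i k \<xi>) \<le> ennreal B * indicator (ball 0 1 :: 'a set) \<xi>"
        proof (cases "\<xi> \<in> K i")
          case True
          then have n1: "norm \<xi> < 1" using AK(3)[OF i] by auto
          have "(\<Sum>k<N. 2 ^ j k * I i k \<xi>) \<le> ennreal (norm \<xi> * B)"
            unfolding I_def by (rule multiscale_slices[OF \<Omega>(1) u]) (use True AK(5)[OF i] in auto)
          also have "\<dots> \<le> ennreal B" using n1 B by (intro ennreal_leI) (simp add: mult_left_le_one_le)
          finally show ?thesis using True n1 by simp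
        qed simp
      qed
      also have "\<dots> = ennreal (B * \<beta>)"
        using B \<beta>0 by (simp add: nn_integral_cmult_indicator \<beta> ennreal_mult)
      finally show ?thesis .
    qed
    define D where "D k = enn2real (\<Sum>i\<in>X. 2 ^ j k * E i k)" for k
    have D_sum: "(\<Sum>k<N. (\<Sum>i\<in>X. 2 ^ j k * E i k)) \<le> ennreal S" for N
    proof -
      have "(\<Sum>k<N. (\<Sum>i\<in>X. 2 ^ j k * E i k)) = (\<Sum>i\<in>X. (\<Sum>k<N. 2 ^ j k * E i k))"
        by (rule sum.swap)
      also have "\<dots> \<le> (\<Sum>i\<in>X. ennreal (B * \<beta>))" by (intro sum_mono E_sum)
      also have "\<dots> = ennreal S" using B \<beta>0 by (simp add: S_def ennreal_mult ennreal_of_nat_eq_real_of_nat)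
      finally show ?thesis .
    qed
    have D_ennreal: "ennreal (D k) = (\<Sum>i\<in>X. 2 ^ j k * E i k)" for k
    proof -
      have "(\<Sum>i\<in>X. 2 ^ j k * E i k) \<le> (\<Sum>k<Suc k. (\<Sum>i\<in>X. 2 ^ j k * E i k))"
        by (intro member_le_sum) auto
      also have "\<dots> \<le> ennreal S" by (rule D_sum)
      also have "\<dots> < top" by simp
      finally show ?thesis unfolding D_def by simp
    qed
    have D0: "D k \<ge> 0" for k by (simp add: D_def)
    have DS: "(\<Sum>k<N. D k) \<le> S" for N
    proof -
      have "ennreal (\<Sum>k<N. D k) \<le> ennreal S"
        using D_sum[of N] D0 by (simp add: D_ennreal[symmetric] sum_ennreal)
      then show ?thesis using S by (simp add: ennreal_le_iff)
    qed
    have rec: "a (Suc k) \<le> c * a k powr \<theta> * D k / 2 ^ k" if k: "k \<ge> k0" for k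
    proof (cases "a k = 0")
      case True
      then show ?thesis using a_dec[of k] aV[of "Suc k"] \<theta> by simp
    next
      case False
      define h :: real where "h = 1 / 2 ^ j k"
      have h: "h > 0" by (simp add: h_def)
      have one: "ennreal (2 ^ k * (\<kappa> / 2)) * emeasure lborel (A i \<inter> {x. slice k (u x) = 2 ^ k}) \<le> E i k"
        if i: "i \<in> X" for i
        unfolding E_def I_def h_def[symmetric]
      proof (rule level_set_le_differences[where w="\<lambda>x. slice k (u x)"])
        have "{x. slice k (u x) \<noteq> 0} = L k" by (auto simp: slice_eq_0_iff L_def)
        moreover have "a k \<le> h ^ DIM('a) * (\<kappa> / 2)"
          using j(1)[OF k False] X(3) by (simp add: h_def field_simps)
        ultimately show "emeasure lborel {x. slice k (u x) \<noteq> 0} \<le> ennreal (h ^ DIM('a) * (\<kappa> / 2))"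
          by (simp add: La ennreal_leI)
      qed (use AK[OF i] X(3) h in auto)
      have "ennreal (2 ^ k * (\<kappa> / 2) * a (Suc k)) = ennreal (2 ^ k * (\<kappa> / 2)) * emeasure lborel (L (Suc k))"
        unfolding La using X(3) aV by (intro ennreal_mult) auto
      also have "\<dots> \<le> ennreal (2 ^ k * (\<kappa> / 2)) * (\<Sum>i\<in>X. emeasure lborel (A i \<inter> {x. slice k (u x) = 2 ^ k}))"
      proof (rule mult_left_mono)
        have "L (Suc k) \<subseteq> (\<Union>i\<in>X. A i \<inter> {x. slice k (u x) = 2 ^ k})"
          using L\<Omega>[of "Suc k"] X(2) slice_full by (fastforce simp: L_def)
        then have "emeasure lborel (L (Suc k)) \<le> emeasure lborel (\<Union>i\<in>X. A i \<inter> {x. slice k (u x) = 2 ^ k})"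
          using AK(1) X(1) by (intro emeasure_mono) (auto intro!: sets.finite_UN)
        also have "\<dots> \<le> (\<Sum>i\<in>X. emeasure lborel (A i \<inter> {x. slice k (u x) = 2 ^ k}))"
          using AK(1) X(1) by (intro emeasure_subadditive_finite) auto
        finally show "emeasure lborel (L (Suc k)) \<le> (\<Sum>i\<in>X. emeasure lborel (A i \<inter> {x. slice k (u x) = 2 ^ k}))" .
      qed simp
      also have "\<dots> \<le> (\<Sum>i\<in>X. E i k)"
        unfolding sum_distrib_left by (intro sum_mono one)
      also have "\<dots> = ennreal (h * D k)"
      proof -
        have "ennreal (h * D k) = ennreal h * (\<Sum>i\<in>X. 2 ^ j k * E i k)"
          using h D0 by (simp add: ennreal_mult D_ennreal)
        also have "\<dots> = (ennreal h * 2 ^ j k) * (\<Sum>i\<in>X. E i k)"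
          by (simp only: sum_distrib_left mult.assoc)
        also have "ennreal h * 2 ^ j k = ennreal (h * 2 ^ j k)"
          using h by (simp add: ennreal_mult ennreal_power[symmetric])
        finally show ?thesis by (simp add: h_def)
      qed
      finally have *: "2 ^ k * (\<kappa> / 2) * a (Suc k) \<le> h * D k"
        using h D0 by (simp add: ennreal_le_iff)
      have y: "0 \<le> 2 * a k / \<kappa>" "2 * a k / \<kappa> \<le> 1" using aV[of k] a_small[OF k] X(3) by auto
      have "h \<le> 2 * (2 * a k / \<kappa>) powr (1 / DIM('a))" using j(2)[OF k False] by (simp add: h_def)
      also have "\<dots> \<le> 2 * (2 * a k / \<kappa>) powr \<theta>"
        using y \<theta>(3) by (intro mult_left_mono powr_mono') auto
      also have "(2 * a k / \<kappa>) powr \<theta> = (2 / \<kappa>) powr \<theta> * a k powr \<theta>"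
        using X(3) aV[of k] by (subst powr_mult[symmetric]) auto
      finally have "h * D k \<le> 2 * ((2 / \<kappa>) powr \<theta> * a k powr \<theta>) * D k"
        using D0 by (intro mult_right_mono) auto
      with * have "2 ^ k * (\<kappa> / 2) * a (Suc k) \<le> 2 * ((2 / \<kappa>) powr \<theta> * a k powr \<theta>) * D k" by linarith
      then show ?thesis using X(3) by (simp add: c_def field_simps)
    qed
    have sumM: "(\<Sum>k<N. 2 powr (real k / (1 - \<theta>)) * a k) \<le> M" for N
      using Mb[of a D] aV D0 DS rec by blast
    have "(\<integral>\<^sup>+x. ennreal (\<bar>u x\<bar> powr p) \<partial>lborel) \<le>
        (\<integral>\<^sup>+x. indicator \<Omega> x + (\<Sum>k. ennreal (2 powr (real (Suc k) * p)) * indicator (L k) x) \<partial>lborel)"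
    proof (rule nn_integral_mono)
      fix x
      (* A value above 1 lies in exactly one dyadic interval (2^k, 2^(k+1)]. *)
      consider "x \<notin> \<Omega>" | "x \<in> \<Omega>" "\<bar>u x\<bar> \<le> 1" | "\<bar>u x\<bar> > 1" by linarith
      then show "ennreal (\<bar>u x\<bar> powr p) \<le>
          indicator \<Omega> x + (\<Sum>k. ennreal (2 powr (real (Suc k) * p)) * indicator (L k) x)"
      proof cases
        case 1 then show ?thesis using u0 by simp
      next
        case 2
        then have "\<bar>u x\<bar> powr p \<le> 1" using p by (intro powr_le1) auto
        then have "ennreal (\<bar>u x\<bar> powr p) \<le> 1" by (simp add: ennreal_le_1)
        then show ?thesis using 2 by (simp add: add_increasing2)
      next
        case 3
        define n where "n = (LEAST n. \<bar>u x\<bar> \<le> 2 ^ n)"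
        have "\<exists>n. \<bar>u x\<bar> \<le> 2 ^ n" using real_arch_pow[of 2 "\<bar>u x\<bar>"] by (auto intro: less_imp_le)
        then have n: "\<bar>u x\<bar> \<le> 2 ^ n" unfolding n_def by (rule LeastI_ex)
        then have "n \<noteq> 0" using 3 by (intro notI) simp
        then obtain k where k: "n = Suc k" using not0_implies_Suc by blast
        then have "\<not> \<bar>u x\<bar> \<le> 2 ^ k" unfolding n_def by (metis lessI not_less_Least)
        then have xL: "x \<in> L k" by (simp add: L_def)
        have "\<bar>u x\<bar> powr p \<le> (2 ^ Suc k) powr p" using n k p by (intro powr_mono2) auto
        also have "\<dots> = 2 powr (real (Suc k) * p)"
          by (subst powr_realpow[symmetric]) (auto simp: powr_powr)
        finally have "ennreal (\<bar>u x\<bar> powr p) \<le> ennreal (2 powr (real (Suc k) * p)) * indicator (L k) x"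
          using xL by (simp add: ennreal_leI)
        also have "\<dots> \<le> (\<Sum>k. ennreal (2 powr (real (Suc k) * p)) * indicator (L k) x)"
        proof -
          have "f k \<le> (\<Sum>k. f k)" for f :: "nat \<Rightarrow> ennreal"
            using sum_le_suminf[OF summableI, of "{k}" f] by simp
          then show ?thesis by fast
        qed
        finally show ?thesis by (simp add: add_increasing)
      qed
    qed
    also have "\<dots> = emeasure lborel \<Omega> + (\<Sum>k. ennreal (2 powr (real (Suc k) * p)) * emeasure lborel (L k))"
      by (simp add: nn_integral_add nn_integral_suminf nn_integral_cmult_indicator)
    also have "emeasure lborel \<Omega> = ennreal V"
      unfolding V_def using \<Omega>fin by (intro emeasure_eq_ennreal_measure) auto
    also have "(\<Sum>k. ennreal (2 powr (real (Suc k) * p)) * emeasure lborel (L k)) \<le> ennreal (2 powr p * M)"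
    proof (rule suminf_le_const[OF summableI])
      fix N
      have "(\<Sum>k<N. ennreal (2 powr (real (Suc k) * p)) * emeasure lborel (L k)) =
          ennreal (\<Sum>k<N. 2 powr (real (Suc k) * p) * a k)"
        using aV by (subst sum_ennreal[symmetric]) (auto simp: La ennreal_mult)
      also have "(\<Sum>k<N. 2 powr (real (Suc k) * p) * a k) = 2 powr p * (\<Sum>k<N. 2 powr (real k / (1 - \<theta>)) * a k)"
        by (simp add: sum_distrib_left p_def distrib_right add_divide_distrib powr_add mult.assoc)
      also have "ennreal \<dots> \<le> ennreal (2 powr p * M)"
        using sumM by (intro ennreal_leI mult_left_mono) auto
      finally show "(\<Sum>k<N. ennreal (2 powr (real (Suc k) * p)) * emeasure lborel (L k)) \<le> ennreal (2 powr p * M)" .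
    qed
    also have "ennreal V + ennreal (2 powr p * M) = ennreal (V + 2 powr p * M)"
      using M by (simp add: V_def)
    finally show "(\<integral>\<^sup>+x. ennreal (\<bar>u x\<bar> powr (1 / (1 - \<theta>))) \<partial>lborel) \<le> ennreal (V + 2 powr p * M)"
      by (simp add: p_def add_left_mono)
  qed
qed

section \<open>Dyadic cells and the Poincare inequality\<close>

definition grid_point :: "nat \<Rightarrow> 'a::euclidean_space \<Rightarrow> 'a" where
  "grid_point m x = (\<Sum>b\<in>Basis. of_int \<lfloor>2 ^ m * (x \<bullet> b)\<rfloor> *\<^sub>R b)"

definition cell :: "nat \<Rightarrow> 'a::euclidean_space \<Rightarrow> 'a set" where
  "cell m z = {x. grid_point m x = z}"

text \<open>Cells are indexed by their lattice points, so a finite set of points describes the cells inside \<Omega>.\<close>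

definition inner_cells :: "'a::euclidean_space set \<Rightarrow> nat \<Rightarrow> 'a set" where
  "inner_cells \<Omega> m = {z \<in> grid_point m ` \<Omega>. cell m z \<subseteq> \<Omega>}"

lemma grid_point_measurable [measurable]: "grid_point m \<in> borel_measurable borel"
  unfolding grid_point_def[abs_def] by measurable

lemma cell_borel [measurable]: "cell m z \<in> sets borel"
  unfolding cell_def by measurable

lemma grid_point_inner: "b \<in> Basis \<Longrightarrow> grid_point m x \<bullet> b = of_int \<lfloor>2 ^ m * (x \<bullet> b)\<rfloor>"
  unfolding grid_point_def by (subst inner_sum_left_Basis) auto

lemma mem_cell_iff: "y \<in> cell m (grid_point m x) \<longleftrightarrow> (\<forall>b\<in>Basis. \<lfloor>2 ^ m * (y \<bullet> b)\<rfloor> = \<lfloor>2 ^ m * (x \<bullet> b)\<rfloor>)"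
  unfolding cell_def mem_Collect_eq by (subst euclidean_eq_iff) (simp add: grid_point_inner)

lemma same_cell_close:
  assumes "x \<in> cell m z" "y \<in> cell m z" "b \<in> Basis"
  shows "\<bar>(y - x) \<bullet> b\<bar> < 1 / 2 ^ m"
proof -
  have "y \<in> cell m (grid_point m x)" using assms by (auto simp: cell_def)
  then have "\<lfloor>2 ^ m * (y \<bullet> b)\<rfloor> = \<lfloor>2 ^ m * (x \<bullet> b)\<rfloor>" using assms(3) by (simp add: mem_cell_iff)
  then have "\<bar>2 ^ m * (y \<bullet> b) - 2 ^ m * (x \<bullet> b)\<bar> < 1" by linarith
  then have "\<bar>2 ^ m * ((y - x) \<bullet> b)\<bar> < 1" by (simp add: inner_diff_left right_diff_distrib)
  then have "2 ^ m * \<bar>(y - x) \<bullet> b\<bar> < 1" by (simp add: abs_mult)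
  then show ?thesis by (simp add: field_simps)
qed

lemma norm_le_of_coords:
  fixes v :: "'a::euclidean_space" and s :: real
  assumes "\<And>b. b \<in> Basis \<Longrightarrow> \<bar>v \<bullet> b\<bar> \<le> s"
  shows "norm v \<le> DIM('a) * s"
proof -
  have "norm v \<le> (\<Sum>b\<in>Basis. \<bar>v \<bullet> b\<bar>)" by (rule norm_le_l1)
  also have "\<dots> \<le> (\<Sum>b\<in>(Basis::'a set). s)" by (intro sum_mono assms)
  finally show ?thesis by simp
qed

lemma same_cell_dist:
  fixes x :: "'a::euclidean_space"
  assumes "x \<in> cell m z" "y \<in> cell m z"
  shows "norm (y - x) \<le> DIM('a) / 2 ^ m"
  using norm_le_of_coords[of "y - x" "1 / 2 ^ m"] same_cell_close[OF assms] by (auto simp: less_imp_le)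

lemma emeasure_cell:
  fixes x :: "'a::euclidean_space"
  shows "emeasure lborel (cell m (grid_point m x)) = ennreal ((1 / 2 ^ m) ^ DIM('a))"
proof -
  let ?z = "grid_point m x"
  define l where "l = (1 / 2 ^ m) *\<^sub>R ?z"
  define r where "r = (1 / 2 ^ m) *\<^sub>R (?z + One)"
  have lr: "r \<bullet> b - l \<bullet> b = 1 / 2 ^ m" if "b \<in> Basis" for b
    using that by (simp add: l_def r_def inner_add_left field_simps)
  have fl: "\<lfloor>2 ^ m * (y \<bullet> b)\<rfloor> = \<lfloor>2 ^ m * (x \<bullet> b)\<rfloor> \<longleftrightarrow> l \<bullet> b \<le> y \<bullet> b \<and> y \<bullet> b < r \<bullet> b" if "b \<in> Basis" for y b
    using that by (simp add: floor_eq_iff l_def r_def inner_add_left grid_point_inner field_simps)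
  have "box l r \<subseteq> cell m ?z" "cell m ?z \<subseteq> cbox l r"
    by (auto simp: mem_box mem_cell_iff fl less_imp_le)
  moreover have le: "l \<bullet> b \<le> r \<bullet> b" if "b \<in> Basis" for b using lr[OF that] by (smt (verit) divide_nonneg_nonneg zero_le_power)
  have "emeasure lborel (box l r) = ennreal ((1 / 2 ^ m) ^ DIM('a))"
    using le by (simp add: emeasure_lborel_box_eq inner_diff_left lr)
  moreover have "emeasure lborel (cbox l r) = ennreal ((1 / 2 ^ m) ^ DIM('a))"
    using le by (simp add: emeasure_lborel_cbox_eq inner_diff_left lr)
  ultimately show ?thesis
    by (metis antisym cell_borel emeasure_mono sets_lborel lborelD cbox_borel)
qed

lemma finite_inner_cells:
  fixes \<Omega> :: "'a::euclidean_space set"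
  assumes "bounded \<Omega>"
  shows "finite (inner_cells \<Omega> m)"
proof -
  obtain R where R: "\<And>x. x \<in> \<Omega> \<Longrightarrow> norm x \<le> R" using assms by (auto simp: bounded_iff)
  define N where "N = \<lceil>2 ^ m * R\<rceil> + 1"
  have "grid_point m ` \<Omega> \<subseteq> (\<lambda>f. \<Sum>b\<in>Basis. of_int (f b) *\<^sub>R b) ` (PiE Basis (\<lambda>_. {-N..N}))"
  proof (rule image_subsetI)
    fix x assume "x \<in> \<Omega>"
    have "\<lfloor>2 ^ m * (x \<bullet> b)\<rfloor> \<in> {-N..N}" if "b \<in> Basis" for b
    proof -
      have "\<bar>x \<bullet> b\<bar> \<le> R" using Basis_le_norm[OF that] R[OF \<open>x \<in> \<Omega>\<close>] order_trans by blast
      then have "\<bar>2 ^ m * (x \<bullet> b)\<bar> \<le> 2 ^ m * R" by (simp add: abs_mult)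
      then show ?thesis unfolding N_def atLeastAtMost_iff by linarith
    qed
    then show "grid_point m x \<in> (\<lambda>f. \<Sum>b\<in>Basis. of_int (f b) *\<^sub>R b) ` (PiE Basis (\<lambda>_. {-N..N}))"
      unfolding grid_point_def
      by (intro image_eqI[of _ _ "\<lambda>b\<in>Basis. \<lfloor>2 ^ m * (x \<bullet> b)\<rfloor>"]) auto
  qed
  moreover have "finite (PiE (Basis :: 'a set) (\<lambda>_. {-N..N}))" by (intro finite_PiE) auto
  ultimately have "finite (grid_point m ` \<Omega>)" using finite_subset by blast
  then show ?thesis by (simp add: inner_cells_def)
qed

text \<open>The cell of a point of the open set \<Omega> lies in \<Omega> as soon as its diameter is small, so the uncovered
sets tend to the empty set pointwise.\<close>

lemma inner_cells_exhaust:
  fixes \<Omega> :: "'a::euclidean_space set"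
  assumes "open \<Omega>" "bounded \<Omega>"
  shows "(\<lambda>m. measure lborel (\<Omega> - (\<Union>z\<in>inner_cells \<Omega> m. cell m z))) \<longlonglongrightarrow> 0"
proof -
  define R where "R m = \<Omega> - (\<Union>z\<in>inner_cells \<Omega> m. cell m z)" for m
  have [measurable]: "\<Omega> \<in> sets borel" using assms by auto
  have R [measurable]: "R m \<in> sets borel" for m
    unfolding R_def using finite_inner_cells[OF assms(2)] by (intro sets.Diff sets.finite_UN) auto
  have \<Omega>fin: "emeasure lborel \<Omega> < \<infinity>" using assms(2) by (rule emeasure_bounded_finite)
  have "(\<lambda>m. LINT x|lborel. indicator (R m) x :: real) \<longlonglongrightarrow> (LINT x::'a|lborel. (0::real))"
  proof (rule integral_dominated_convergence[where w="indicator \<Omega>"])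
    show "integrable lborel (indicator \<Omega> :: 'a \<Rightarrow> real)" using \<Omega>fin by (simp add: integrable_indicator_iff)
    show "AE x in lborel. (\<lambda>m. indicator (R m) x :: real) \<longlonglongrightarrow> 0"
    proof (rule AE_I2)
      fix x
      have "\<forall>\<^sub>F m in sequentially. x \<notin> R m"
      proof (cases "x \<in> \<Omega>")
        case True
        then obtain e where e: "e > 0" "ball x e \<subseteq> \<Omega>" using assms(1) open_contains_ball by blast
        have "(\<lambda>m. DIM('a) / 2 ^ m :: real) \<longlonglongrightarrow> 0"
        proof -
          have "(\<lambda>m. real DIM('a) * (1 / 2) ^ m) \<longlonglongrightarrow> real DIM('a) * 0"
            by (intro tendsto_mult tendsto_const LIMSEQ_power_zero) simp
          then show ?thesis by (simp add: power_one_over)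
        qed
        then have "\<forall>\<^sub>F m in sequentially. DIM('a) / 2 ^ m < e" using e(1) by (rule order_tendstoD)
        then show ?thesis
        proof eventually_elim
          case (elim m)
          have "cell m (grid_point m x) \<subseteq> \<Omega>"
          proof
            fix y assume y: "y \<in> cell m (grid_point m x)"
            have "norm (y - x) \<le> DIM('a) / 2 ^ m"
              by (rule same_cell_dist[OF _ y]) (simp add: cell_def)
            then have "norm (y - x) < e" using elim by linarith
            then show "y \<in> \<Omega>" using e(2) by (auto simp: dist_norm norm_minus_commute)
          qed
          then have "grid_point m x \<in> inner_cells \<Omega> m" using True by (auto simp: inner_cells_def)
          then show ?case by (auto simp: R_def cell_def)
        qed
      qed (simp add: R_def)
      then have "\<forall>\<^sub>F m in sequentially. (indicator (R m) x :: real) = 0" by eventually_elim simp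
      then show "(\<lambda>m. indicator (R m) x :: real) \<longlonglongrightarrow> 0" by (rule tendsto_eventually)
    qed
    show "AE x in lborel. norm (indicator (R m) x :: real) \<le> indicator \<Omega> x" for m
      by (auto simp: indicator_def R_def)
  qed auto
  then show ?thesis by (simp add: R_def)
qed

text \<open>On a cell of measure \<mu>, averaging w(x) = w(y) - (w(y) - w(x)) over y bounds \<mu> |w(x)| by |int w| plus the
integral of |w(y) - w(x)|. Writing y = v + x, the sum over all cells of these double integrals is at
most the integral over |v_i| < 2^(-m) of the L^1 difference of w at step v, because a cell contains
the segments between its points.\<close>

lemma cell_poincare:
  fixes \<Omega> :: "'a::euclidean_space set" and B :: real
  assumes \<Omega>: "open \<Omega>" "bounded \<Omega>" and w: "diff_bounded \<Omega> B w" and B: "B \<ge> 0"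
  shows "(\<integral>\<^sup>+x. ennreal \<bar>w x\<bar> \<partial>lborel) \<le>
    ennreal (2 ^ DIM('a) * DIM('a) * B / 2 ^ m)
    + (\<Sum>z\<in>inner_cells \<Omega> m. ennreal \<bar>LINT y|lborel. indicator (cell m z) y * w y\<bar>)
    + (\<integral>\<^sup>+x. indicator (\<Omega> - (\<Union>z\<in>inner_cells \<Omega> m. cell m z)) x * ennreal \<bar>w x\<bar> \<partial>lborel)"
proof -
  have [measurable]: "w \<in> borel_measurable borel" and w0: "\<And>x. x \<notin> \<Omega> \<Longrightarrow> w x = 0"
    and wB: "(\<integral>\<^sup>+x. ennreal \<bar>w x\<bar> \<partial>lborel) \<le> ennreal B"
    and wd: "\<And>v. (\<integral>\<^sup>+x. indicator (seg_shift \<Omega> v) x * ennreal \<bar>w (v + x) - w x\<bar> \<partial>lborel) \<le> ennreal (norm v * B)"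
    using w by (auto simp: diff_bounded_def)
  have [measurable]: "\<Omega> \<in> sets borel" using \<Omega> by auto
  have iw: "integrable lborel w"
    by (rule integrableI_bounded) (use wB in \<open>auto intro: le_less_trans\<close>)
  define F where "F = inner_cells \<Omega> m"
  have F: "finite F" unfolding F_def by (rule finite_inner_cells[OF \<Omega>(2)])
  define \<mu> :: real where "\<mu> = (1 / 2 ^ m) ^ DIM('a)"
  have \<mu>: "\<mu> > 0" by (simp add: \<mu>_def)
  have em: "emeasure lborel (cell m z) = ennreal \<mu>" if "z \<in> F" for z
    using that emeasure_cell by (auto simp: F_def inner_cells_def \<mu>_def)
  define R where "R = \<Omega> - (\<Union>z\<in>F. cell m z)"
  have [measurable]: "R \<in> sets borel"
    unfolding R_def using F by (intro sets.Diff sets.finite_UN) auto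
  define \<alpha> where "\<alpha> z = \<bar>LINT y|lborel. indicator (cell m z) y * w y\<bar>" for z
  define P where "P z = (\<integral>\<^sup>+x. \<integral>\<^sup>+y. indicator (cell m z) x * indicator (cell m z) y * ennreal \<bar>w y - w x\<bar> \<partial>lborel \<partial>lborel)" for z
  have one: "ennreal \<mu> * (\<integral>\<^sup>+x. indicator (cell m z) x * ennreal \<bar>w x\<bar> \<partial>lborel) \<le> P z + ennreal \<mu> * ennreal (\<alpha> z)"
    if z: "z \<in> F" for z
  proof -
    have ii: "integrable lborel (\<lambda>y. indicator (cell m z) y * w y)"
      by (rule Bochner_Integration.integrable_bound[OF iw]) (auto simp: indicator_def)
    have ic: "integrable lborel (\<lambda>y. indicator (cell m z) y * c)" for c :: real
      using em[OF z] by (intro integrable_mult_left) (auto simp: integrable_indicator_iff)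
    have pt: "ennreal \<mu> * ennreal \<bar>w x\<bar> \<le> (\<integral>\<^sup>+y. indicator (cell m z) y * ennreal \<bar>w y - w x\<bar> \<partial>lborel) + ennreal (\<alpha> z)" for x
    proof -
      let ?d = "LINT y|lborel. indicator (cell m z) y * w y - indicator (cell m z) y * w x"
      have "measure lborel (cell m z) = \<mu>" using em[OF z] \<mu> by (simp add: measure_def)
      then have "\<mu> * w x = (LINT y|lborel. indicator (cell m z) y * w x)" by simp
      also have "\<dots> = (LINT y|lborel. indicator (cell m z) y * w y) - ?d"
        using ii ic by simp
      finally have "\<bar>\<mu> * w x\<bar> \<le> \<alpha> z + \<bar>?d\<bar>"
        unfolding \<alpha>_def by linarith
      moreover have "\<bar>\<mu> * w x\<bar> = \<mu> * \<bar>w x\<bar>" using \<mu> by (simp add: abs_mult)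
      ultimately have "ennreal (\<mu> * \<bar>w x\<bar>) \<le> ennreal (\<alpha> z + \<bar>?d\<bar>)"
        by (intro ennreal_leI) simp
      also have "\<dots> = ennreal (\<alpha> z) + ennreal \<bar>?d\<bar>"
        by (rule ennreal_plus) (simp_all add: \<alpha>_def)
      also have "ennreal \<bar>?d\<bar> \<le>
          (\<integral>\<^sup>+y. ennreal (norm (indicator (cell m z) y * w y - indicator (cell m z) y * w x)) \<partial>lborel)"
        using integral_norm_bound_ennreal[of lborel "\<lambda>y. indicator (cell m z) y * w y - indicator (cell m z) y * w x"] ii ic
        by simp
      also have "\<dots> = (\<integral>\<^sup>+y. indicator (cell m z) y * ennreal \<bar>w y - w x\<bar> \<partial>lborel)"
        by (intro nn_integral_cong) (auto simp: indicator_def)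
      finally show ?thesis using \<mu> by (simp add: ennreal_mult add.commute add_left_mono)
    qed
    have "ennreal \<mu> * (\<integral>\<^sup>+x. indicator (cell m z) x * ennreal \<bar>w x\<bar> \<partial>lborel)
        = (\<integral>\<^sup>+x. indicator (cell m z) x * (ennreal \<mu> * ennreal \<bar>w x\<bar>) \<partial>lborel)"
      by (subst nn_integral_cmult[symmetric]) (auto simp: mult.left_commute)
    also have "\<dots> \<le> (\<integral>\<^sup>+x. indicator (cell m z) x * ((\<integral>\<^sup>+y. indicator (cell m z) y * ennreal \<bar>w y - w x\<bar> \<partial>lborel) + ennreal (\<alpha> z)) \<partial>lborel)"
      by (intro nn_integral_mono mult_left_mono pt) simp
    also have "\<dots> = (\<integral>\<^sup>+x. indicator (cell m z) x * (\<integral>\<^sup>+y. indicator (cell m z) y * ennreal \<bar>w y - w x\<bar> \<partial>lborel) \<partial>lborel)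
        + (\<integral>\<^sup>+x. ennreal (\<alpha> z) * indicator (cell m z) x \<partial>lborel)"
      by (simp add: distrib_left nn_integral_add mult.commute)
    also have "(\<integral>\<^sup>+x. ennreal (\<alpha> z) * indicator (cell m z) x \<partial>lborel) = ennreal \<mu> * ennreal (\<alpha> z)"
      by (simp add: nn_integral_cmult_indicator em[OF z] mult.commute)
    also have "(\<integral>\<^sup>+x. indicator (cell m z) x * (\<integral>\<^sup>+y. indicator (cell m z) y * ennreal \<bar>w y - w x\<bar> \<partial>lborel) \<partial>lborel) = P z"
      unfolding P_def by (intro nn_integral_cong) (simp add: nn_integral_cmult[symmetric] mult.assoc)
    finally show ?thesis .
  qed
  have sumP: "(\<Sum>z\<in>F. P z) \<le> ennreal (\<mu> * (2 ^ DIM('a) * DIM('a) * B / 2 ^ m))"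
  proof -
    define H where "H z x v = indicator (cell m z) x * indicator (cell m z) (v + x) * ennreal \<bar>w (v + x) - w x\<bar>" for z x v
    have Pz: "P z = (\<integral>\<^sup>+v. \<integral>\<^sup>+x. H z x v \<partial>lborel \<partial>lborel)" for z
    proof -
      have "P z = (\<integral>\<^sup>+x. \<integral>\<^sup>+v. H z x v \<partial>lborel \<partial>lborel)"
        unfolding P_def H_def
      proof (rule nn_integral_cong)
        fix x
        show "(\<integral>\<^sup>+y. indicator (cell m z) x * indicator (cell m z) y * ennreal \<bar>w y - w x\<bar> \<partial>lborel) =
          (\<integral>\<^sup>+v. indicator (cell m z) x * indicator (cell m z) (v + x) * ennreal \<bar>w (v + x) - w x\<bar> \<partial>lborel)"
          by (subst nn_integral_lborel_translation[symmetric, where v=x]) (auto simp: add.commute)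
      qed
      also have "\<dots> = (\<integral>\<^sup>+v. \<integral>\<^sup>+x. H z x v \<partial>lborel \<partial>lborel)"
        unfolding H_def by (rule lborel_pair.Fubini') measurable
      finally show ?thesis .
    qed
    let ?b = "box ((- 1 / 2 ^ m) *\<^sub>R One) ((1 / 2 ^ m) *\<^sub>R One) :: 'a set"
    have "(\<Sum>z\<in>F. P z) = (\<integral>\<^sup>+v. \<integral>\<^sup>+x. (\<Sum>z\<in>F. H z x v) \<partial>lborel \<partial>lborel)"
      unfolding Pz H_def by (simp add: nn_integral_sum)
    also have "\<dots> \<le> (\<integral>\<^sup>+v. ennreal (DIM('a) / 2 ^ m * B) * indicator ?b v \<partial>lborel)"
    proof (rule nn_integral_mono)
      fix v :: 'a
      (* At most one cell contains both x and v + x. *)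
      have H_le: "(\<Sum>z\<in>F. H z x v) \<le> indicator ?b v * (indicator (seg_shift \<Omega> v) x * ennreal \<bar>w (v + x) - w x\<bar>)" for x
      proof (cases "grid_point m x \<in> F \<and> grid_point m (v + x) = grid_point m x")
        case True
        let ?z = "grid_point m x"
        have "(\<Sum>z\<in>F. H z x v) = (\<Sum>z\<in>F. if z = ?z then ennreal \<bar>w (v + x) - w x\<bar> else 0)"
          using True by (intro sum.cong) (auto simp: H_def cell_def indicator_def)
        also have "\<dots> = ennreal \<bar>w (v + x) - w x\<bar>" using True F by simp
        finally have s: "(\<Sum>z\<in>F. H z x v) = ennreal \<bar>w (v + x) - w x\<bar>" .
        have c: "x \<in> cell m ?z" "v + x \<in> cell m ?z" using True by (auto simp: cell_def)
        have "v \<in> ?b" using same_cell_close[OF c] by (auto simp: mem_box abs_less_iff minus_less_iff)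
        moreover have "x \<in> seg_shift \<Omega> v" unfolding seg_shift_def
        proof safe
          fix s :: real assume s: "s \<in> {0..1}"
          have "x + s *\<^sub>R v \<in> cell m ?z" unfolding mem_cell_iff
          proof
            fix b :: 'a assume b: "b \<in> Basis"
            have e: "\<lfloor>2 ^ m * ((v + x) \<bullet> b)\<rfloor> = \<lfloor>2 ^ m * (x \<bullet> b)\<rfloor>" using c(2) b by (auto simp: mem_cell_iff)
            let ?p = "2 ^ m * (x \<bullet> b)" and ?q = "2 ^ m * ((v + x) \<bullet> b)"
            have r: "2 ^ m * ((x + s *\<^sub>R v) \<bullet> b) = (1 - s) * ?p + s * ?q"
              by (simp add: inner_add_left algebra_simps)
            have "of_int \<lfloor>?p\<rfloor> \<le> ?q" "?q < of_int \<lfloor>?p\<rfloor> + 1" using e by linarith+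
            then have "(1 - s) * of_int \<lfloor>?p\<rfloor> + s * of_int \<lfloor>?p\<rfloor> \<le> (1 - s) * ?p + s * ?q"
              using s by (intro add_mono mult_left_mono) auto
            moreover have "(1 - s) * ?p + s * ?q < of_int \<lfloor>?p\<rfloor> + 1"
              using s \<open>?q < of_int \<lfloor>?p\<rfloor> + 1\<close> by (intro convex_bound_lt) auto
            ultimately show "\<lfloor>2 ^ m * ((x + s *\<^sub>R v) \<bullet> b)\<rfloor> = \<lfloor>?p\<rfloor>"
              unfolding r by (simp add: floor_eq_iff algebra_simps)
          qed
          moreover have "cell m ?z \<subseteq> \<Omega>" using True by (auto simp: F_def inner_cells_def)
          ultimately show "x + s *\<^sub>R v \<in> \<Omega>" by auto
        qed
        ultimately show ?thesis by (simp add: s)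
      next
        case False
        then have "(\<Sum>z\<in>F. H z x v) = 0" by (intro sum.neutral) (auto simp: H_def cell_def indicator_def)
        then show ?thesis by simp
      qed
      have "(\<integral>\<^sup>+x. (\<Sum>z\<in>F. H z x v) \<partial>lborel) \<le>
          (\<integral>\<^sup>+x. indicator ?b v * (indicator (seg_shift \<Omega> v) x * ennreal \<bar>w (v + x) - w x\<bar>) \<partial>lborel)"
        by (intro nn_integral_mono H_le)
      also have "\<dots> = indicator ?b v * (\<integral>\<^sup>+x. indicator (seg_shift \<Omega> v) x * ennreal \<bar>w (v + x) - w x\<bar> \<partial>lborel)"
      proof -
        have [measurable]: "seg_shift \<Omega> v \<in> sets borel" using open_seg_shift[OF \<Omega>(1)] by auto
        show ?thesis by (rule nn_integral_cmult) measurable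
      qed
      also have "\<dots> \<le> indicator ?b v * ennreal (norm v * B)" by (intro mult_left_mono wd) simp
      also have "\<dots> \<le> ennreal (DIM('a) / 2 ^ m * B) * indicator ?b v"
      proof (cases "v \<in> ?b")
        case True
        then have "norm v \<le> DIM('a) * (1 / 2 ^ m)"
          by (intro norm_le_of_coords) (auto simp: mem_box abs_le_iff less_imp_le minus_le_iff)
        from mult_right_mono[OF this B] have "norm v * B \<le> DIM('a) / 2 ^ m * B" by simp
        from ennreal_leI[OF this] show ?thesis using True by simp
      qed simp
      finally show "(\<integral>\<^sup>+x. (\<Sum>z\<in>F. H z x v) \<partial>lborel) \<le> ennreal (DIM('a) / 2 ^ m * B) * indicator ?b v" .
    qed
    also have "\<dots> = ennreal (DIM('a) / 2 ^ m * B) * ennreal ((2 / 2 ^ m) ^ DIM('a))"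
    proof -
      have "emeasure lborel ?b = ennreal (\<Prod>b\<in>Basis. ((1 / 2 ^ m) *\<^sub>R One - (- 1 / 2 ^ m) *\<^sub>R One) \<bullet> (b::'a))"
        by (rule emeasure_lborel_box) auto
      also have "(\<Prod>b\<in>Basis. ((1 / 2 ^ m) *\<^sub>R One - (- 1 / 2 ^ m) *\<^sub>R One) \<bullet> (b::'a)) = (\<Prod>b\<in>(Basis::'a set). 2 / 2 ^ m)"
        by (intro prod.cong) (auto simp: inner_diff_left inner_add_left)
      finally show ?thesis by (subst nn_integral_cmult_indicator) auto
    qed
    also have "\<dots> = ennreal (\<mu> * (2 ^ DIM('a) * DIM('a) * B / 2 ^ m))"
      using B by (subst ennreal_mult[symmetric]) (auto simp: \<mu>_def power_divide field_simps)
    finally show ?thesis .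
  qed
  have "(\<Sum>z\<in>F. ennreal \<mu> * (\<integral>\<^sup>+x. indicator (cell m z) x * ennreal \<bar>w x\<bar> \<partial>lborel)) \<le>
      (\<Sum>z\<in>F. P z + ennreal \<mu> * ennreal (\<alpha> z))" by (intro sum_mono one)
  also have "\<dots> = (\<Sum>z\<in>F. P z) + ennreal \<mu> * (\<Sum>z\<in>F. ennreal (\<alpha> z))"
    by (simp add: sum.distrib sum_distrib_left)
  also have "\<dots> \<le> ennreal (\<mu> * (2 ^ DIM('a) * DIM('a) * B / 2 ^ m)) + ennreal \<mu> * (\<Sum>z\<in>F. ennreal (\<alpha> z))"
    by (intro add_right_mono sumP)
  also have "\<dots> = ennreal \<mu> * (ennreal (2 ^ DIM('a) * DIM('a) * B / 2 ^ m) + (\<Sum>z\<in>F. ennreal (\<alpha> z)))"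
  proof -
    have "ennreal (\<mu> * (2 ^ DIM('a) * DIM('a) * B / 2 ^ m)) = ennreal \<mu> * ennreal (2 ^ DIM('a) * DIM('a) * B / 2 ^ m)"
      using \<mu> B by (intro ennreal_mult) auto
    then show ?thesis by (simp only: distrib_left)
  qed
  finally have cells: "(\<Sum>z\<in>F. (\<integral>\<^sup>+x. indicator (cell m z) x * ennreal \<bar>w x\<bar> \<partial>lborel)) \<le>
      ennreal (2 ^ DIM('a) * DIM('a) * B / 2 ^ m) + (\<Sum>z\<in>F. ennreal (\<alpha> z))"
    using \<mu> unfolding sum_distrib_left[symmetric] by (subst (asm) ennreal_mult_le_mult_iff) auto
  have "(\<integral>\<^sup>+x. ennreal \<bar>w x\<bar> \<partial>lborel) \<le>
      (\<integral>\<^sup>+x. (\<Sum>z\<in>F. indicator (cell m z) x * ennreal \<bar>w x\<bar>) + indicator R x * ennreal \<bar>w x\<bar> \<partial>lborel)"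
  proof (rule nn_integral_mono)
    fix x
    show "ennreal \<bar>w x\<bar> \<le> (\<Sum>z\<in>F. indicator (cell m z) x * ennreal \<bar>w x\<bar>) + indicator R x * ennreal \<bar>w x\<bar>"
    proof (cases "x \<in> \<Omega> - R")
      case True
      then obtain z where z: "z \<in> F" "x \<in> cell m z" by (auto simp: R_def)
      have "indicator (cell m z) x * ennreal \<bar>w x\<bar> \<le> (\<Sum>z\<in>F. indicator (cell m z) x * ennreal \<bar>w x\<bar>)"
        by (rule member_le_sum[OF z(1) _ F]) simp
      then show ?thesis using z by (simp add: add_increasing2)
    qed (use w0 in \<open>auto simp: add_increasing\<close>)
  qed
  also have "\<dots> = (\<Sum>z\<in>F. (\<integral>\<^sup>+x. indicator (cell m z) x * ennreal \<bar>w x\<bar> \<partial>lborel)) + (\<integral>\<^sup>+x. indicator R x * ennreal \<bar>w x\<bar> \<partial>lborel)"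
    by (simp add: nn_integral_add nn_integral_sum)
  also have "\<dots> \<le> ennreal (2 ^ DIM('a) * DIM('a) * B / 2 ^ m) + (\<Sum>z\<in>F. ennreal (\<alpha> z))
      + (\<integral>\<^sup>+x. indicator R x * ennreal \<bar>w x\<bar> \<partial>lborel)"
    by (intro add_right_mono cells)
  finally show ?thesis unfolding \<alpha>_def F_def R_def .
qed

section \<open>Compactness in L^1\<close>

lemma countable_family_convergent_subsequence:
  fixes f :: "nat \<Rightarrow> nat \<Rightarrow> real"
  assumes "\<And>i n. \<bar>f i n\<bar> \<le> C"
  shows "\<exists>r. strict_mono r \<and> (\<forall>i. convergent (\<lambda>n. f i (r n)))"
proof -
  interpret subseqs "\<lambda>i s. convergent (\<lambda>n. f i (s n))"
  proof
    fix i and s :: "nat \<Rightarrow> nat"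
    have "bounded (range (\<lambda>n. f i (s n)))" using assms by (auto simp: bounded_iff)
    from bounded_imp_convergent_subsequence[OF this]
    show "\<exists>r'. strict_mono r' \<and> convergent (\<lambda>n. f i ((s \<circ> r') n))"
      by (auto simp: convergent_def o_def)
  qed
  have "convergent (\<lambda>n. f i (diagseq n))" for i
  proof -
    have "convergent (\<lambda>n. f i ((diagseq \<circ> (+) (Suc i)) n))"
    proof (rule diagseq_holds)
      fix r s :: "nat \<Rightarrow> nat" and k assume "strict_mono r" "convergent (\<lambda>n. f k (s n))"
      then show "convergent (\<lambda>n. f k ((s \<circ> r) n))"
        using convergent_subseq_convergent[of "\<lambda>n. f k (s n)" r] by (simp add: o_def)
    qed
    then show ?thesis
      using convergent_ignore_initial_segment[of "\<lambda>n. f i (diagseq n)" "Suc i"] by (simp add: o_def add.commute)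
  qed
  then show ?thesis using subseq_diagseq by blast
qed

lemma diff_bounded_diff:
  fixes B :: real
  assumes \<Omega>: "open \<Omega>" and u: "diff_bounded \<Omega> B u" and v: "diff_bounded \<Omega> B v" and B: "B \<ge> 0"
  shows "diff_bounded \<Omega> (2 * B) (\<lambda>x. u x - v x)"
proof -
  have [measurable]: "u \<in> borel_measurable borel" "v \<in> borel_measurable borel"
    using u v by (auto simp: diff_bounded_def)
  have *: "(\<integral>\<^sup>+x. f x * ennreal \<bar>a x - b x\<bar> \<partial>lborel) \<le> ennreal (2 * C)"
    if [measurable]: "f \<in> borel_measurable borel" "a \<in> borel_measurable borel" "b \<in> borel_measurable borel"
      and "(\<integral>\<^sup>+x. f x * ennreal \<bar>a x\<bar> \<partial>lborel) \<le> ennreal C" "(\<integral>\<^sup>+x. f x * ennreal \<bar>b x\<bar> \<partial>lborel) \<le> ennreal C" "C \<ge> 0"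
    for f and a b :: "'a \<Rightarrow> real" and C
  proof -
    have "(\<integral>\<^sup>+x. f x * ennreal \<bar>a x - b x\<bar> \<partial>lborel) \<le> (\<integral>\<^sup>+x. f x * ennreal \<bar>a x\<bar> + f x * ennreal \<bar>b x\<bar> \<partial>lborel)"
    proof (rule nn_integral_mono)
      fix x
      have "ennreal \<bar>a x - b x\<bar> \<le> ennreal (\<bar>a x\<bar> + \<bar>b x\<bar>)" by (intro ennreal_leI) simp
      then have "ennreal \<bar>a x - b x\<bar> \<le> ennreal \<bar>a x\<bar> + ennreal \<bar>b x\<bar>" by simp
      from mult_left_mono[OF this, of "f x"]
      show "f x * ennreal \<bar>a x - b x\<bar> \<le> f x * ennreal \<bar>a x\<bar> + f x * ennreal \<bar>b x\<bar>"
        by (simp add: distrib_left)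
    qed
    also have "\<dots> = (\<integral>\<^sup>+x. f x * ennreal \<bar>a x\<bar> \<partial>lborel) + (\<integral>\<^sup>+x. f x * ennreal \<bar>b x\<bar> \<partial>lborel)"
      by (rule nn_integral_add) measurable
    also have "\<dots> \<le> ennreal C + ennreal C" using that by (intro add_mono)
    also have "\<dots> = ennreal (2 * C)" using that(6) by (simp add: ennreal_plus[symmetric] del: ennreal_plus)
    finally show ?thesis .
  qed
  show ?thesis unfolding diff_bounded_def
  proof (intro conjI allI impI)
    show "(\<integral>\<^sup>+x. ennreal \<bar>u x - v x\<bar> \<partial>lborel) \<le> ennreal (2 * B)"
      using *[of "\<lambda>_. 1" u v B] u v B by (simp add: diff_bounded_def)
    show "(\<integral>\<^sup>+x. indicator (seg_shift \<Omega> h) x * ennreal \<bar>u (h + x) - v (h + x) - (u x - v x)\<bar> \<partial>lborel) \<le> ennreal (norm h * (2 * B))" for h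
    proof -
      have [measurable]: "seg_shift \<Omega> h \<in> sets borel" using open_seg_shift[OF \<Omega>] by auto
      have 1: "(\<integral>\<^sup>+x. indicator (seg_shift \<Omega> h) x * ennreal \<bar>u (h + x) - u x\<bar> \<partial>lborel) \<le> ennreal (norm h * B)"
        using u unfolding diff_bounded_def by blast
      have 2: "(\<integral>\<^sup>+x. indicator (seg_shift \<Omega> h) x * ennreal \<bar>v (h + x) - v x\<bar> \<partial>lborel) \<le> ennreal (norm h * B)"
        using v unfolding diff_bounded_def by blast
      have "(\<integral>\<^sup>+x. indicator (seg_shift \<Omega> h) x * ennreal \<bar>(u (h + x) - u x) - (v (h + x) - v x)\<bar> \<partial>lborel) \<le> ennreal (2 * (norm h * B))"
        by (rule *[OF _ _ _ 1 2]) (use B in auto)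
      then show ?thesis by (simp add: algebra_simps)
    qed
  qed (use u v in \<open>auto simp: diff_bounded_def\<close>)
qed

lemma powr_abs_add_le:
  fixes a b q :: real
  assumes "q \<ge> 0"
  shows "\<bar>a + b\<bar> powr q \<le> 2 powr q * (\<bar>a\<bar> powr q + \<bar>b\<bar> powr q)"
proof -
  have "\<bar>a + b\<bar> powr q \<le> (2 * max \<bar>a\<bar> \<bar>b\<bar>) powr q" using assms by (intro powr_mono2) auto
  also have "\<dots> = 2 powr q * max \<bar>a\<bar> \<bar>b\<bar> powr q" by (simp add: powr_mult)
  also have "max \<bar>a\<bar> \<bar>b\<bar> powr q \<le> \<bar>a\<bar> powr q + \<bar>b\<bar> powr q" by (auto simp: max_def)
  finally show ?thesis by simp
qed

text \<open>Below the level \<tau> the first term dominates, above it the second.\<close>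

lemma powr_interpolate:
  fixes t p q \<tau> :: real
  assumes "t \<ge> 0" "\<tau> > 0" "1 \<le> q" "q \<le> p"
  shows "t powr q \<le> \<tau> powr (q - 1) * t + \<tau> powr (q - p) * t powr p"
proof (cases "t = 0")
  case False
  then have t: "t > 0" using assms by simp
  show ?thesis
  proof (cases "t \<le> \<tau>")
    case True
    have "t powr q = t powr (q - 1) * t" using t by (simp add: powr_mult_base[symmetric] powr_diff)
    also have "\<dots> \<le> \<tau> powr (q - 1) * t" using True assms by (intro mult_right_mono powr_mono2) auto
    finally show ?thesis by (simp add: add_increasing2)
  next
    case False
    have "t powr q = t powr (q - p) * t powr p" using t by (simp add: powr_add[symmetric])
    also have "\<dots> \<le> \<tau> powr (q - p) * t powr p"
      using False assms by (intro mult_right_mono powr_mono2') auto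
    finally show ?thesis using assms by (simp add: add_increasing)
  qed
qed (use assms in auto)

lemma nn_integral_diff_powr_le:
  fixes f g :: "'a \<Rightarrow> real"
  assumes [measurable]: "f \<in> borel_measurable N" "g \<in> borel_measurable N" and p: "p \<ge> 0" "M \<ge> 0"
    and "(\<integral>\<^sup>+x. ennreal (\<bar>f x\<bar> powr p) \<partial>N) \<le> ennreal M" "(\<integral>\<^sup>+x. ennreal (\<bar>g x\<bar> powr p) \<partial>N) \<le> ennreal M"
  shows "(\<integral>\<^sup>+x. ennreal (\<bar>f x - g x\<bar> powr p) \<partial>N) \<le> ennreal (2 powr p * (2 * M))"
proof -
  have "(\<integral>\<^sup>+x. ennreal (\<bar>f x - g x\<bar> powr p) \<partial>N) \<le>
      (\<integral>\<^sup>+x. ennreal (2 powr p) * (ennreal (\<bar>f x\<bar> powr p) + ennreal (\<bar>g x\<bar> powr p)) \<partial>N)"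
  proof (rule nn_integral_mono)
    fix x
    have "ennreal (\<bar>f x - g x\<bar> powr p) \<le> ennreal (2 powr p * (\<bar>f x\<bar> powr p + \<bar>g x\<bar> powr p))"
      using powr_abs_add_le[OF p(1), of "f x" "- g x"] by (intro ennreal_leI) simp
    then show "ennreal (\<bar>f x - g x\<bar> powr p) \<le> ennreal (2 powr p) * (ennreal (\<bar>f x\<bar> powr p) + ennreal (\<bar>g x\<bar> powr p))"
      by (simp add: ennreal_mult)
  qed
  also have "\<dots> = ennreal (2 powr p) * ((\<integral>\<^sup>+x. ennreal (\<bar>f x\<bar> powr p) \<partial>N) + (\<integral>\<^sup>+x. ennreal (\<bar>g x\<bar> powr p) \<partial>N))"
    by (simp add: nn_integral_cmult nn_integral_add)
  also have "\<dots> \<le> ennreal (2 powr p) * (ennreal M + ennreal M)"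
    using assms by (intro mult_left_mono add_mono) auto
  also have "\<dots> = ennreal (2 powr p * (2 * M))"
    using p by (simp add: ennreal_mult ennreal_plus[symmetric] del: ennreal_plus)
  finally show ?thesis .
qed

lemma nn_integral_le_of_AE_tendsto:
  fixes f :: "nat \<Rightarrow> 'a \<Rightarrow> ennreal"
  assumes [measurable]: "\<And>n. f n \<in> borel_measurable N"
    and lim: "AE x in N. (\<lambda>n. f n x) \<longlonglongrightarrow> g x" and le: "\<forall>\<^sub>F n in sequentially. (\<integral>\<^sup>+x. f n x \<partial>N) \<le> C"
  shows "(\<integral>\<^sup>+x. g x \<partial>N) \<le> C"
proof -
  have "(\<integral>\<^sup>+x. g x \<partial>N) = (\<integral>\<^sup>+x. liminf (\<lambda>n. f n x) \<partial>N)"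
    using lim by (intro nn_integral_cong_AE) (auto elim!: eventually_mono simp: lim_imp_Liminf)
  also have "\<dots> \<le> liminf (\<lambda>n. \<integral>\<^sup>+x. f n x \<partial>N)" by (rule nn_integral_liminf) measurable
  also have "\<dots> \<le> C"
  proof -
    have "liminf (\<lambda>n. \<integral>\<^sup>+x. f n x \<partial>N) \<le> limsup (\<lambda>n. \<integral>\<^sup>+x. f n x \<partial>N)" by (rule Liminf_le_Limsup) simp
    also have "\<dots> \<le> C" using le by (rule Limsup_bounded)
    finally show ?thesis .
  qed
  finally show ?thesis .
qed

text \<open>A diagonal subsequence makes the integrals over every inner cell of every level converge. For a
difference w of two members, cell_poincare leaves three terms: one of order 2^(-m), finitely many
differences of cell integrals, and the integral over the uncovered set, which is small uniformly in w
because w is bounded in L^p with p > 1.\<close>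

lemma diff_bounded_L1_Cauchy_subsequence:
  fixes \<Omega> :: "'a::euclidean_space set" and U :: "nat \<Rightarrow> 'a \<Rightarrow> real" and B M p :: real
  assumes \<Omega>: "open \<Omega>" "bounded \<Omega>" and U: "\<And>n. diff_bounded \<Omega> B (U n)" and B: "B \<ge> 0"
    and p: "p > 1" and M: "M \<ge> 0" "\<And>n. (\<integral>\<^sup>+x. ennreal (\<bar>U n x\<bar> powr p) \<partial>lborel) \<le> ennreal M"
  shows "\<exists>r :: nat \<Rightarrow> nat. strict_mono r \<and> (\<forall>e>0. \<exists>N. \<forall>i\<ge>N. \<forall>j\<ge>N. (\<integral>\<^sup>+x. ennreal \<bar>U (r i) x - U (r j) x\<bar> \<partial>lborel) < ennreal e)"
proof -
  have [measurable]: "U n \<in> borel_measurable borel" for n using U[of n] by (simp add: diff_bounded_def)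
  have [measurable]: "\<Omega> \<in> sets borel" using \<Omega> by auto
  have UB: "(\<integral>\<^sup>+x. ennreal \<bar>U n x\<bar> \<partial>lborel) \<le> ennreal B" for n using U[of n] by (simp add: diff_bounded_def)
  have iU: "integrable lborel (U n)" for n
    by (rule integrableI_bounded) (use UB[of n] in \<open>auto intro: le_less_trans\<close>)
  have iUc: "integrable lborel (\<lambda>y. indicator (cell m z) y * U n y)" for m z n
    by (rule Bochner_Integration.integrable_bound[OF iU[of n]]) (auto simp: indicator_def)
  define \<alpha> where "\<alpha> m z n = (LINT y|lborel. indicator (cell m z) y * U n y)" for m z n
  have \<alpha>B: "\<bar>\<alpha> m z n\<bar> \<le> B" for m z n
  proof -
    have "ennreal \<bar>\<alpha> m z n\<bar> \<le> (\<integral>\<^sup>+y. ennreal (norm (indicator (cell m z) y * U n y)) \<partial>lborel)"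
      unfolding \<alpha>_def using integral_norm_bound_ennreal[OF iUc[of m z n]] by simp
    also have "\<dots> \<le> (\<integral>\<^sup>+x. ennreal \<bar>U n x\<bar> \<partial>lborel)" by (intro nn_integral_mono) (auto simp: indicator_def)
    also have "\<dots> \<le> ennreal B" by (rule UB)
    finally show ?thesis using B by (simp add: ennreal_le_iff)
  qed
  define Ix where "Ix = (SIGMA m:UNIV. inner_cells \<Omega> m)"
  have "countable Ix" unfolding Ix_def
    by (intro countable_SIGMA) (auto intro: countable_finite finite_inner_cells[OF \<Omega>(2)])
  obtain r where r: "strict_mono r"
    and conv: "\<And>i. convergent (\<lambda>n. case from_nat_into Ix i of (m, z) \<Rightarrow> \<alpha> m z (r n))"
    using countable_family_convergent_subsequence[of "\<lambda>i n. case from_nat_into Ix i of (m, z) \<Rightarrow> \<alpha> m z n" B] \<alpha>B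
    by (auto simp: case_prod_unfold)
  have conv_cell: "convergent (\<lambda>n. \<alpha> m z (r n))" if "z \<in> inner_cells \<Omega> m" for m z
  proof -
    have "(m, z) \<in> Ix" using that by (simp add: Ix_def)
    then obtain i where "from_nat_into Ix i = (m, z)" using from_nat_into_surj[OF \<open>countable Ix\<close>] by blast
    then show ?thesis using conv[of i] by simp
  qed
  have "\<exists>N. \<forall>i\<ge>N. \<forall>j\<ge>N. (\<integral>\<^sup>+x. ennreal \<bar>U (r i) x - U (r j) x\<bar> \<partial>lborel) < ennreal e" if e: "e > 0" for e
  proof -
    (* Order of choices: the level \<tau> makes the part where |w| > \<tau> small, then m makes the cells fine
       and the uncovered set small, then i and j make the cell integrals close. *)
    define M2 where "M2 = 2 powr p * (2 * M)"
    have M2: "M2 \<ge> 0" using M by (simp add: M2_def)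
    have "((\<lambda>\<tau>. \<tau> powr (1 - p) * M2) \<longlongrightarrow> 0 * M2) at_top"
      using p by (intro tendsto_mult tendsto_const tendsto_neg_powr filterlim_ident) auto
    then have "\<forall>\<^sub>F \<tau> in at_top. \<tau> powr (1 - p) * M2 < e / 5" using e by (intro order_tendstoD) auto
    then obtain \<tau>0 where \<tau>0: "\<And>\<tau>. \<tau> \<ge> \<tau>0 \<Longrightarrow> \<tau> powr (1 - p) * M2 < e / 5"
      by (auto simp: eventually_at_top_linorder)
    define \<tau> where "\<tau> = max \<tau>0 1"
    have \<tau>: "\<tau> > 0" "\<tau> powr (1 - p) * M2 < e / 5" using \<tau>0[of \<tau>] by (auto simp: \<tau>_def)
    define d where "d = 2 ^ DIM('a) * real DIM('a) * (2 * B)"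
    define R where "R m = \<Omega> - (\<Union>z\<in>inner_cells \<Omega> m. cell m z)" for m
    have Rm [measurable]: "R m \<in> sets borel" for m
      unfolding R_def using finite_inner_cells[OF \<Omega>(2)] by (intro sets.Diff sets.finite_UN) auto
    have "(\<lambda>m. d * (1 / 2) ^ m) \<longlonglongrightarrow> d * 0"
      by (intro tendsto_mult tendsto_const LIMSEQ_power_zero) simp
    then have "(\<lambda>m. d / 2 ^ m) \<longlonglongrightarrow> 0" by (simp add: power_one_over)
    then have e1: "\<forall>\<^sub>F m in sequentially. d / 2 ^ m < e / 5" using e by (intro order_tendstoD) auto
    have "(\<lambda>m. \<tau> * measure lborel (R m)) \<longlonglongrightarrow> \<tau> * 0"
      unfolding R_def by (intro tendsto_mult tendsto_const inner_cells_exhaust[OF \<Omega>])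
    then have e2: "\<forall>\<^sub>F m in sequentially. \<tau> * measure lborel (R m) < e / 5" using e by (intro order_tendstoD) auto
    obtain m where m: "d / 2 ^ m < e / 5" "\<tau> * measure lborel (R m) < e / 5"
      using eventually_happens'[OF sequentially_bot eventually_conj[OF e1 e2]] by blast
    define F where "F = inner_cells \<Omega> m"
    have F: "finite F" unfolding F_def by (rule finite_inner_cells[OF \<Omega>(2)])
    define \<delta> where "\<delta> = e / 5 / (real (card F) + 1)"
    have \<delta>: "\<delta> > 0" using e by (simp add: \<delta>_def)
    have "\<forall>z\<in>F. \<exists>N. \<forall>i\<ge>N. \<forall>j\<ge>N. \<bar>\<alpha> m z (r i) - \<alpha> m z (r j)\<bar> < \<delta>"
      using conv_cell[THEN convergent_Cauchy] \<delta> by (auto simp: F_def Cauchy_def dist_real_def)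
    then obtain N where N: "\<And>z i j. z \<in> F \<Longrightarrow> i \<ge> N z \<Longrightarrow> j \<ge> N z \<Longrightarrow> \<bar>\<alpha> m z (r i) - \<alpha> m z (r j)\<bar> < \<delta>" by metis
    show ?thesis
    proof (intro exI[of _ "\<Sum>z\<in>F. N z"] allI impI)
      fix i j assume ij: "i \<ge> (\<Sum>z\<in>F. N z)" "j \<ge> (\<Sum>z\<in>F. N z)"
      define w where "w x = U (r i) x - U (r j) x" for x
      have [measurable]: "w \<in> borel_measurable borel" unfolding w_def by measurable
      have w: "diff_bounded \<Omega> (2 * B) w" unfolding w_def by (rule diff_bounded_diff[OF \<Omega>(1) U U B])
      have wp: "(\<integral>\<^sup>+x. ennreal (\<bar>w x\<bar> powr p) \<partial>lborel) \<le> ennreal M2"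
        unfolding w_def M2_def using p M by (intro nn_integral_diff_powr_le) auto
      let ?c = "\<lambda>z. LINT y|lborel. indicator (cell m z) y * w y"
      have "(\<Sum>z\<in>F. ennreal \<bar>?c z\<bar>) \<le> (\<Sum>z\<in>F. ennreal \<delta>)"
      proof (intro sum_mono ennreal_leI)
        fix z assume z: "z \<in> F"
        have "?c z = \<alpha> m z (r i) - \<alpha> m z (r j)"
          unfolding w_def \<alpha>_def right_diff_distrib using iUc by simp
        moreover have "N z \<le> (\<Sum>z\<in>F. N z)" using F z by (intro member_le_sum) auto
        ultimately show "\<bar>?c z\<bar> \<le> \<delta>"
          using N[OF z, of i j] ij by linarith
      qed
      also have "\<dots> = ennreal (real (card F) * \<delta>)" using \<delta> by (simp add: ennreal_mult ennreal_of_nat_eq_real_of_nat)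
      also have "\<dots> \<le> ennreal (e / 5)"
        using e by (intro ennreal_leI) (simp add: \<delta>_def field_simps)
      finally have t2: "(\<Sum>z\<in>F. ennreal \<bar>?c z\<bar>) \<le> ennreal (e / 5)" .
      have "(\<integral>\<^sup>+x. indicator (R m) x * ennreal \<bar>w x\<bar> \<partial>lborel) \<le>
          (\<integral>\<^sup>+x. ennreal \<tau> * indicator (R m) x + ennreal (\<tau> powr (1 - p)) * ennreal (\<bar>w x\<bar> powr p) \<partial>lborel)"
      proof (rule nn_integral_mono)
        fix x
        have "\<bar>w x\<bar> \<le> \<tau> + \<tau> powr (1 - p) * \<bar>w x\<bar> powr p"
        proof (cases "\<bar>w x\<bar> \<le> \<tau>")
          case False
          then have "\<bar>w x\<bar> = \<bar>w x\<bar> powr (1 - p) * \<bar>w x\<bar> powr p" using \<tau> by (simp add: powr_add[symmetric])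
          also have "\<dots> \<le> \<tau> powr (1 - p) * \<bar>w x\<bar> powr p"
            using False \<tau> p by (intro mult_right_mono powr_mono2') auto
          finally show ?thesis using \<tau> by simp
        qed (simp add: add_increasing2)
        from ennreal_leI[OF this] have "ennreal \<bar>w x\<bar> \<le> ennreal \<tau> + ennreal (\<tau> powr (1 - p)) * ennreal (\<bar>w x\<bar> powr p)"
          using \<tau> by (simp add: ennreal_mult)
        then show "indicator (R m) x * ennreal \<bar>w x\<bar> \<le>
            ennreal \<tau> * indicator (R m) x + ennreal (\<tau> powr (1 - p)) * ennreal (\<bar>w x\<bar> powr p)"
          by (auto simp: indicator_def)
      qed
      also have "\<dots> = ennreal \<tau> * emeasure lborel (R m) + ennreal (\<tau> powr (1 - p)) * (\<integral>\<^sup>+x. ennreal (\<bar>w x\<bar> powr p) \<partial>lborel)"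
        by (simp add: nn_integral_add nn_integral_cmult nn_integral_cmult_indicator)
      also have "\<dots> \<le> ennreal \<tau> * emeasure lborel (R m) + ennreal (\<tau> powr (1 - p)) * ennreal M2"
        by (intro add_left_mono mult_left_mono wp) simp
      also have "emeasure lborel (R m) = ennreal (measure lborel (R m))"
      proof (rule emeasure_eq_ennreal_measure)
        have "emeasure lborel (R m) \<le> emeasure lborel \<Omega>" by (intro emeasure_mono) (auto simp: R_def)
        also have "\<dots> < top" using emeasure_bounded_finite[OF \<Omega>(2)] by simp
        finally show "emeasure lborel (R m) \<noteq> top" by simp
      qed
      also have "ennreal \<tau> * ennreal (measure lborel (R m)) + ennreal (\<tau> powr (1 - p)) * ennreal M2
          = ennreal (\<tau> * measure lborel (R m) + \<tau> powr (1 - p) * M2)"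
        using \<tau> M2 by (simp add: ennreal_mult)
      also have "\<dots> \<le> ennreal (e / 5 + e / 5)" using m \<tau> by (intro ennreal_leI) simp
      finally have t3: "(\<integral>\<^sup>+x. indicator (R m) x * ennreal \<bar>w x\<bar> \<partial>lborel) \<le> ennreal (e / 5 + e / 5)" .
      have "(\<integral>\<^sup>+x. ennreal \<bar>w x\<bar> \<partial>lborel) \<le> ennreal (d / 2 ^ m)
          + (\<Sum>z\<in>F. ennreal \<bar>?c z\<bar>)
          + (\<integral>\<^sup>+x. indicator (R m) x * ennreal \<bar>w x\<bar> \<partial>lborel)"
        using cell_poincare[OF \<Omega> w, of m] B by (simp add: F_def R_def d_def)
      also have "\<dots> \<le> ennreal (e / 5) + ennreal (e / 5) + ennreal (e / 5 + e / 5)"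
        using m(1) by (intro add_mono t2 t3 ennreal_leI) auto
      also have "\<dots> = ennreal (4 * e / 5)" using e by (simp add: ennreal_plus[symmetric] del: ennreal_plus)
      also have "\<dots> < ennreal e" using e by (simp add: ennreal_less_iff)
      finally show "(\<integral>\<^sup>+x. ennreal \<bar>U (r i) x - U (r j) x\<bar> \<partial>lborel) < ennreal e" by (simp add: w_def)
    qed
  qed
  then show ?thesis using r by (auto intro!: exI[of _ r])
qed

text \<open>An L^1 Cauchy sequence has a subsequence that converges almost everywhere, and Fatou's lemma carries
the Cauchy condition and the L^p bound over to the limit.\<close>

lemma diff_bounded_compact:
  fixes \<Omega> :: "'a::euclidean_space set" and U :: "nat \<Rightarrow> 'a \<Rightarrow> real" and B M p :: real
  assumes \<Omega>: "open \<Omega>" "bounded \<Omega>" and U: "\<And>n. diff_bounded \<Omega> B (U n)" and B: "B \<ge> 0"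
    and p: "p > 1" and M: "M \<ge> 0" "\<And>n. (\<integral>\<^sup>+x. ennreal (\<bar>U n x\<bar> powr p) \<partial>lborel) \<le> ennreal M"
  shows "\<exists>r u. strict_mono r \<and> u \<in> borel_measurable borel \<and> (\<forall>x. x \<notin> \<Omega> \<longrightarrow> u x = 0) \<and>
    (AE x in lborel. (\<lambda>n. U (r n) x) \<longlonglongrightarrow> u x) \<and>
    (\<forall>e>0. \<exists>n0. \<forall>n\<ge>n0. (\<integral>\<^sup>+x. ennreal \<bar>U (r n) x - u x\<bar> \<partial>lborel) \<le> ennreal e) \<and>
    (\<integral>\<^sup>+x. ennreal (\<bar>u x\<bar> powr p) \<partial>lborel) \<le> ennreal M"
proof -
  have [measurable]: "U n \<in> borel_measurable borel" for n using U[of n] by (simp add: diff_bounded_def)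
  have U0: "U n x = 0" if "x \<notin> \<Omega>" for n x using U[of n] that by (simp add: diff_bounded_def)
  have iU: "integrable lborel (U n)" for n
  proof (rule integrableI_bounded)
    have "(\<integral>\<^sup>+x. ennreal (norm (U n x)) \<partial>lborel) \<le> ennreal B" using U[of n] by (simp add: diff_bounded_def)
    also have "\<dots> < \<infinity>" by simp
    finally show "(\<integral>\<^sup>+x. ennreal (norm (U n x)) \<partial>lborel) < \<infinity>" .
  qed simp
  obtain r :: "nat \<Rightarrow> nat" where r: "strict_mono r" and
    r_cauchy: "\<And>e. e > 0 \<Longrightarrow> \<exists>N. \<forall>i\<ge>N. \<forall>j\<ge>N. (\<integral>\<^sup>+x. ennreal \<bar>U (r i) x - U (r j) x\<bar> \<partial>lborel) < ennreal e"
    using diff_bounded_L1_Cauchy_subsequence[where U=U, OF \<Omega> U B p M] by blast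
  have "\<exists>N. \<forall>i\<ge>N. \<forall>j\<ge>N. (LINT x|lborel. norm (U (r i) x - U (r j) x)) < e" if e: "e > 0" for e
  proof -
    have "(LINT x|lborel. norm (U (r i) x - U (r j) x)) < e"
      if "(\<integral>\<^sup>+x. ennreal \<bar>U (r i) x - U (r j) x\<bar> \<partial>lborel) < ennreal e" for i j
    proof -
      have "(\<integral>\<^sup>+x. ennreal \<bar>U (r i) x - U (r j) x\<bar> \<partial>lborel) = ennreal (LINT x|lborel. norm (U (r i) x - U (r j) x))"
        unfolding real_norm_def using iU by (intro nn_integral_eq_integral) auto
      then show ?thesis using that e by (simp add: ennreal_less_iff)
    qed
    then show ?thesis using r_cauchy[OF e] by blast
  qed
  from cauchy_L1_AE_cauchy_subseq[OF iU this]
  obtain s where s: "strict_mono s" and AE_C: "AE x in lborel. Cauchy (\<lambda>i. U (r (s i)) x)" by blast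
  define u where "u x = lim (\<lambda>i. U (r (s i)) x)" for x
  have u_meas [measurable]: "u \<in> borel_measurable borel" unfolding u_def by measurable
  have u0: "u x = 0" if "x \<notin> \<Omega>" for x unfolding u_def using U0[OF that] by (simp add: limI)
  have AE_u: "AE x in lborel. (\<lambda>n. U (r (s n)) x) \<longlonglongrightarrow> u x"
    using AE_C by eventually_elim (simp add: u_def convergent_LIMSEQ_iff[symmetric] Cauchy_convergent)
  have "\<exists>n0. \<forall>n\<ge>n0. (\<integral>\<^sup>+x. ennreal \<bar>U (r (s n)) x - u x\<bar> \<partial>lborel) \<le> ennreal e" if e: "e > 0" for e
  proof -
    obtain N where N: "\<And>i j. i \<ge> N \<Longrightarrow> j \<ge> N \<Longrightarrow> (\<integral>\<^sup>+x. ennreal \<bar>U (r i) x - U (r j) x\<bar> \<partial>lborel) < ennreal e"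
      using r_cauchy[OF e] by blast
    have sN: "s n \<ge> N" if "n \<ge> N" for n using seq_suble[OF s, of n] that by simp
    have "(\<integral>\<^sup>+x. ennreal \<bar>U (r (s n)) x - u x\<bar> \<partial>lborel) \<le> ennreal e" if n: "n \<ge> N" for n
    proof (rule nn_integral_le_of_AE_tendsto[where f="\<lambda>k x. ennreal \<bar>U (r (s n)) x - U (r (s k)) x\<bar>"])
      show "AE x in lborel. (\<lambda>k. ennreal \<bar>U (r (s n)) x - U (r (s k)) x\<bar>) \<longlonglongrightarrow> ennreal \<bar>U (r (s n)) x - u x\<bar>"
        using AE_u by eventually_elim (intro tendsto_ennrealI tendsto_rabs tendsto_diff tendsto_const)
      show "\<forall>\<^sub>F k in sequentially. (\<integral>\<^sup>+x. ennreal \<bar>U (r (s n)) x - U (r (s k)) x\<bar> \<partial>lborel) \<le> ennreal e"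
        using eventually_ge_at_top[of N] by eventually_elim (use N sN n in \<open>auto intro: less_imp_le\<close>)
    qed auto
    then show ?thesis by blast
  qed
  moreover have "(\<integral>\<^sup>+x. ennreal (\<bar>u x\<bar> powr p) \<partial>lborel) \<le> ennreal M"
  proof (rule nn_integral_le_of_AE_tendsto[where f="\<lambda>k x. ennreal (\<bar>U (r (s k)) x\<bar> powr p)"])
    show "AE x in lborel. (\<lambda>k. ennreal (\<bar>U (r (s k)) x\<bar> powr p)) \<longlonglongrightarrow> ennreal (\<bar>u x\<bar> powr p)"
      using AE_u by eventually_elim (use p in \<open>auto intro!: tendsto_ennrealI tendsto_powr' tendsto_rabs tendsto_const\<close>)
    show "\<forall>\<^sub>F k in sequentially. (\<integral>\<^sup>+x. ennreal (\<bar>U (r (s k)) x\<bar> powr p) \<partial>lborel) \<le> ennreal M"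
      using M(2) by (intro always_eventually) auto
  qed auto
  ultimately show ?thesis
    using strict_mono_o[OF r s] u_meas u0 AE_u by (intro exI[of _ "r \<circ> s"] exI[of _ u] conjI allI impI) auto
qed

section \<open>From BV functions to Borel representatives\<close>

lemma divergence_continuous_on:
  assumes "\<sigma> \<in> test_fields \<Omega>"
  shows "continuous_on \<Omega> (divergence \<sigma>)"
  unfolding divergence_def[abs_def] using assms by (auto simp: test_fields_def intro!: continuous_intros)

lemma BV_seminorm_cong_AE:
  fixes \<Omega> :: "'a::euclidean_space set"
  assumes \<Omega>: "open \<Omega>" and [measurable]: "u \<in> borel_measurable (lebesgue_on \<Omega>)" "v \<in> borel_measurable (lebesgue_on \<Omega>)"
    and eq: "AE x in lebesgue_on \<Omega>. u x = v x"
  shows "BV_seminorm \<Omega> u = BV_seminorm \<Omega> v"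
  unfolding BV_seminorm_def
proof (rule SUP_cong[OF refl])
  fix \<sigma> assume "\<sigma> \<in> test_fields \<Omega>"
  then have [measurable]: "divergence \<sigma> \<in> borel_measurable (lebesgue_on \<Omega>)"
    using \<Omega> by (intro continuous_imp_measurable_on_sets_lebesgue divergence_continuous_on) auto
  show "ereal (LINT x|lebesgue_on \<Omega>. - u x * divergence \<sigma> x) = ereal (LINT x|lebesgue_on \<Omega>. - v x * divergence \<sigma> x)"
    unfolding ereal.inject
  proof (rule integral_cong_AE)
    show "AE x in lebesgue_on \<Omega>. - u x * divergence \<sigma> x = - v x * divergence \<sigma> x"
      using eq by eventually_elim simp
  qed measurable
qed

lemma BV_seminorm_nonneg: "BV_seminorm \<Omega> u \<ge> 0"
proof -
  have d: "frechet_derivative (\<lambda>_::'a. 0::'a) (at x) = (\<lambda>_. 0)" for x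
    by (metis frechet_derivative_at has_derivative_const)
  have "(\<lambda>_. 0) \<in> test_fields \<Omega>" by (simp add: test_fields_def d)
  moreover have "divergence (\<lambda>_::'a. 0::'a) x = 0" for x by (simp add: divergence_def d)
  ultimately show ?thesis unfolding BV_seminorm_def
    by (intro SUP_upper2[of "\<lambda>_. 0"]) auto
qed

lemma ex_borel_representative:
  fixes u :: "'a::euclidean_space \<Rightarrow> real"
  assumes \<Omega>: "open \<Omega>" and u: "u \<in> borel_measurable (lebesgue_on \<Omega>)"
  shows "\<exists>u'\<in>borel_measurable borel. (\<forall>x. x \<notin> \<Omega> \<longrightarrow> u' x = 0) \<and> (AE x in lebesgue_on \<Omega>. u x = u' x)"
proof -
  have [measurable]: "\<Omega> \<in> sets borel" using \<Omega> by auto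
  then have \<Omega>L: "\<Omega> \<in> sets lebesgue" by simp
  have "(\<lambda>x. if x \<in> \<Omega> then u x else 0) \<in> borel_measurable lebesgue"
    using borel_measurable_if[OF \<Omega>L, of u] u by simp
  from completion_ex_borel_measurable_real[OF this]
  obtain g where [measurable]: "g \<in> borel_measurable borel" and g: "AE x in lborel. (if x \<in> \<Omega> then u x else 0) = g x"
    by auto
  have "AE x in lebesgue. (if x \<in> \<Omega> then u x else 0) = g x" using g by (rule AE_completion)
  then have "AE x in lebesgue_on \<Omega>. u x = (if x \<in> \<Omega> then g x else 0)"
    using \<Omega>L by (auto simp: AE_restrict_space_iff elim!: eventually_mono)
  then show ?thesis by (intro bexI[of _ "\<lambda>x. if x \<in> \<Omega> then g x else 0"]) auto
qed

lemma nn_integral_lebesgue_on_eq_lborel: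
  fixes f :: "'a::euclidean_space \<Rightarrow> ennreal"
  assumes [measurable]: "f \<in> borel_measurable borel" and "\<And>x. x \<notin> \<Omega> \<Longrightarrow> f x = 0" and \<Omega>: "\<Omega> \<in> sets borel"
    and eq: "AE x in lebesgue_on \<Omega>. g x = f x"
  shows "(\<integral>\<^sup>+x. g x \<partial>lebesgue_on \<Omega>) = (\<integral>\<^sup>+x. f x \<partial>lborel)"
proof -
  have "(\<integral>\<^sup>+x. g x \<partial>lebesgue_on \<Omega>) = (\<integral>\<^sup>+x. f x \<partial>lebesgue_on \<Omega>)" using eq by (rule nn_integral_cong_AE)
  also have "\<dots> = (\<integral>\<^sup>+x. f x * indicator \<Omega> x \<partial>lebesgue)" using \<Omega> by (intro nn_integral_restrict_space) auto
  also have "\<dots> = (\<integral>\<^sup>+x. f x \<partial>lebesgue)" using assms(2) by (intro nn_integral_cong) (auto simp: indicator_def)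
  also have "\<dots> = (\<integral>\<^sup>+x. f x \<partial>lborel)" by (rule nn_integral_completion)
  finally show ?thesis .
qed

lemma diff_bounded_representative:
  fixes \<Omega> :: "'a::euclidean_space set" and B :: real
  assumes \<Omega>: "open \<Omega>" and BV: "BV_norm \<Omega> u \<le> ereal B"
  shows "\<exists>u'. diff_bounded \<Omega> B u' \<and> (AE x in lebesgue_on \<Omega>. u x = u' x)"
proof -
  have [measurable]: "\<Omega> \<in> sets borel" using \<Omega> by auto
  have uL: "u \<in> Lp_space 1 \<Omega>" using BV by (auto simp: BV_norm_def split: if_splits)
  then have um: "u \<in> borel_measurable (lebesgue_on \<Omega>)" and ui: "integrable (lebesgue_on \<Omega>) (\<lambda>x. \<bar>u x\<bar>)"
    by (auto simp: Lp_space_def)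
  have n0: "Lp_norm 1 \<Omega> u = (LINT x|lebesgue_on \<Omega>. \<bar>u x\<bar>)" by (simp add: Lp_norm_def)
  have "Lp_norm 1 \<Omega> u \<ge> 0" by (simp add: Lp_norm_def)
  then have nB: "Lp_norm 1 \<Omega> u \<le> B" and sB: "BV_seminorm \<Omega> u \<le> ereal B"
    using BV BV_seminorm_nonneg[of \<Omega> u] uL
    by (cases "BV_seminorm \<Omega> u"; auto simp: BV_norm_def)+
  have B: "B \<ge> 0" using nB \<open>Lp_norm 1 \<Omega> u \<ge> 0\<close> by linarith
  obtain u' where [measurable]: "u' \<in> borel_measurable borel" and u'0: "\<And>x. x \<notin> \<Omega> \<Longrightarrow> u' x = 0"
    and eq: "AE x in lebesgue_on \<Omega>. u x = u' x"
    using ex_borel_representative[OF \<Omega> um] by blast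
  have "(\<integral>\<^sup>+x. ennreal \<bar>u' x\<bar> \<partial>lborel) = (\<integral>\<^sup>+x. ennreal \<bar>u x\<bar> \<partial>lebesgue_on \<Omega>)"
    using eq u'0 by (intro nn_integral_lebesgue_on_eq_lborel[symmetric]) (auto elim!: eventually_mono)
  also have "\<dots> = ennreal (Lp_norm 1 \<Omega> u)" unfolding n0 using ui by (intro nn_integral_eq_integral) auto
  also have "\<dots> \<le> ennreal B" using nB by (rule ennreal_leI)
  finally have L1: "(\<integral>\<^sup>+x. ennreal \<bar>u' x\<bar> \<partial>lborel) \<le> ennreal B" .
  have iu': "integrable lborel u'"
  proof (rule integrableI_bounded)
    show "(\<integral>\<^sup>+x. ennreal (norm (u' x)) \<partial>lborel) < \<infinity>" using L1 by (auto intro: le_less_trans)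
  qed simp
  have "u' \<in> borel_measurable (lebesgue_on \<Omega>)"
    by (intro measurable_restrict_space1 measurable_completion) simp
  then have "BV_seminorm \<Omega> u' = BV_seminorm \<Omega> u"
    using eq um by (intro BV_seminorm_cong_AE[OF \<Omega>]) (auto elim!: eventually_mono)
  then have "BV_seminorm \<Omega> u' \<le> ereal B" using sB by simp
  from BV_translation_estimate[OF \<Omega> iu' u'0 this B]
  have "diff_bounded \<Omega> B u'" unfolding diff_bounded_def using u'0 L1 by auto
  then show ?thesis using eq by blast
qed

text \<open>For d > 1 and \<theta> = 1 / d the exponent p is the critical one.\<close>

lemma BV_compact:
  fixes \<Omega> :: "'a::euclidean_space set" and B \<theta> :: real and U :: "nat \<Rightarrow> 'a \<Rightarrow> real"
  assumes dom: "bounded_lipschitz_domain \<Omega>" and BV: "\<And>n. BV_norm \<Omega> (U n) \<le> ereal B"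
    and \<theta>: "0 < \<theta>" "\<theta> < 1" "\<theta> \<le> 1 / DIM('a)"
  defines "p \<equiv> 1 / (1 - \<theta>)"
  shows "\<exists>r u M. strict_mono r \<and> 0 \<le> M \<and> u \<in> borel_measurable (lebesgue_on \<Omega>) \<and>
    (AE x in lebesgue_on \<Omega>. (\<lambda>n. U (r n) x) \<longlonglongrightarrow> u x) \<and>
    (\<forall>e>0. \<exists>n0. \<forall>n\<ge>n0. (\<integral>\<^sup>+x. ennreal \<bar>U (r n) x - u x\<bar> \<partial>lebesgue_on \<Omega>) \<le> ennreal e) \<and>
    (\<forall>n. (\<integral>\<^sup>+x. ennreal (\<bar>U (r n) x\<bar> powr p) \<partial>lebesgue_on \<Omega>) \<le> ennreal M) \<and>
    (\<integral>\<^sup>+x. ennreal (\<bar>u x\<bar> powr p) \<partial>lebesgue_on \<Omega>) \<le> ennreal M"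
proof -
  have \<Omega>: "open \<Omega>" "bounded \<Omega>" using dom by (auto simp: bounded_lipschitz_domain_def)
  then have [measurable]: "\<Omega> \<in> sets borel" by auto
  have p: "p > 1" using \<theta> by (simp add: p_def)
  have "0 \<le> BV_norm \<Omega> (U 0)"
    using BV_seminorm_nonneg[of \<Omega> "U 0"] by (auto simp: BV_norm_def Lp_norm_def intro!: add_nonneg_nonneg)
  then have "0 \<le> ereal B" using BV[of 0] by (rule order_trans)
  then have B: "B \<ge> 0" by simp
  obtain V where V: "\<And>n. diff_bounded \<Omega> B (V n)" "\<And>n. AE x in lebesgue_on \<Omega>. U n x = V n x"
    using diff_bounded_representative[OF \<Omega>(1) BV] by metis
  have Vm [measurable]: "V n \<in> borel_measurable borel" for n using V(1)[of n] by (simp add: diff_bounded_def)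
  have V0: "V n x = 0" if "x \<notin> \<Omega>" for n x using V(1)[of n] that by (simp add: diff_bounded_def)
  obtain X :: "'a set" and A K \<kappa> where "cone_covered \<Omega> X A K \<kappa>"
    using bounded_lipschitz_domain_cone_covered[OF dom] by blast
  from sobolev_bound[OF \<Omega> this B \<theta>] obtain M where M: "M \<ge> 0"
    and VM: "\<And>n. (\<integral>\<^sup>+x. ennreal (\<bar>V n x\<bar> powr p) \<partial>lborel) \<le> ennreal M" using V(1) unfolding p_def by blast
  obtain r u where r: "strict_mono r" and um [measurable]: "u \<in> borel_measurable borel" and u0: "\<And>x. x \<notin> \<Omega> \<Longrightarrow> u x = 0"
    and lim: "AE x in lborel. (\<lambda>n. V (r n) x) \<longlonglongrightarrow> u x"
    and L1: "\<forall>e>0. \<exists>n0. \<forall>n\<ge>n0. (\<integral>\<^sup>+x. ennreal \<bar>V (r n) x - u x\<bar> \<partial>lborel) \<le> ennreal e"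
    and uM: "(\<integral>\<^sup>+x. ennreal (\<bar>u x\<bar> powr p) \<partial>lborel) \<le> ennreal M"
    using diff_bounded_compact[where U=V, OF \<Omega> V(1) B p M VM] by blast
  have "AE x in lebesgue_on \<Omega>. (\<lambda>n. U (r n) x) \<longlonglongrightarrow> u x"
  proof -
    have "AE x in lebesgue. (\<lambda>n. V (r n) x) \<longlonglongrightarrow> u x" using lim by (rule AE_completion)
    then have "AE x in lebesgue_on \<Omega>. (\<lambda>n. V (r n) x) \<longlonglongrightarrow> u x"
      by (auto simp: AE_restrict_space_iff elim!: eventually_mono)
    moreover have "AE x in lebesgue_on \<Omega>. \<forall>n. U n x = V n x" using V(2) by (simp add: AE_all_countable)
    ultimately show ?thesis by eventually_elim simp
  qed
  moreover have "(\<integral>\<^sup>+x. ennreal \<bar>U (r n) x - u x\<bar> \<partial>lebesgue_on \<Omega>) = (\<integral>\<^sup>+x. ennreal \<bar>V (r n) x - u x\<bar> \<partial>lborel)" for n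
    using V(2)[of "r n"] V0 u0 by (intro nn_integral_lebesgue_on_eq_lborel) (auto elim!: eventually_mono)
  moreover have "(\<integral>\<^sup>+x. ennreal (\<bar>U (r n) x\<bar> powr p) \<partial>lebesgue_on \<Omega>) = (\<integral>\<^sup>+x. ennreal (\<bar>V (r n) x\<bar> powr p) \<partial>lborel)" for n
    using V(2)[of "r n"] V0 p by (intro nn_integral_lebesgue_on_eq_lborel) (auto elim!: eventually_mono)
  moreover have "(\<integral>\<^sup>+x. ennreal (\<bar>u x\<bar> powr p) \<partial>lebesgue_on \<Omega>) = (\<integral>\<^sup>+x. ennreal (\<bar>u x\<bar> powr p) \<partial>lborel)"
    using u0 p by (intro nn_integral_lebesgue_on_eq_lborel) auto
  moreover have "u \<in> borel_measurable (lebesgue_on \<Omega>)"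
    by (intro measurable_restrict_space1 measurable_completion) simp
  ultimately show ?thesis using r L1 VM uM M by (intro exI[of _ r] exI[of _ u] exI[of _ M]) simp
qed

section \<open>Strong and weak convergence in L^q\<close>

lemma Lp_space_iff_nn_integral:
  "u \<in> Lp_space q \<Omega> \<longleftrightarrow> u \<in> borel_measurable (lebesgue_on \<Omega>) \<and>
     (\<integral>\<^sup>+x. ennreal (\<bar>u x\<bar> powr q) \<partial>lebesgue_on \<Omega>) < \<infinity>"
  by (auto simp: Lp_space_def integrable_iff_bounded)

lemma Lp_space_measurable [measurable_dest]: "u \<in> Lp_space q \<Omega> \<Longrightarrow> u \<in> borel_measurable (lebesgue_on \<Omega>)"
  by (simp add: Lp_space_def)

lemma Lp_space_integrable: "u \<in> Lp_space q \<Omega> \<Longrightarrow> integrable (lebesgue_on \<Omega>) (\<lambda>x. \<bar>u x\<bar> powr q)"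
  by (simp add: Lp_space_def)

lemma Lp_space_add:
  assumes "q \<ge> 0" "u \<in> Lp_space q \<Omega>" "v \<in> Lp_space q \<Omega>"
  shows "(\<lambda>x. u x + v x) \<in> Lp_space q \<Omega>"
proof -
  note assms(2,3)[THEN Lp_space_measurable, measurable]
  have "integrable (lebesgue_on \<Omega>) (\<lambda>x. 2 powr q * (\<bar>u x\<bar> powr q + \<bar>v x\<bar> powr q))"
    using assms(2,3)[THEN Lp_space_integrable] by simp
  then have "integrable (lebesgue_on \<Omega>) (\<lambda>x. \<bar>u x + v x\<bar> powr q)"
    by (rule Bochner_Integration.integrable_bound) (use powr_abs_add_le[OF assms(1)] in auto)
  then show ?thesis by (simp add: Lp_space_def)
qed

lemma Lp_space_cmult:
  assumes "u \<in> Lp_space q \<Omega>"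
  shows "(\<lambda>x. c * u x) \<in> Lp_space q \<Omega>"
proof -
  note assms[THEN Lp_space_measurable, measurable]
  show ?thesis using Lp_space_integrable[OF assms] by (simp add: Lp_space_def abs_mult powr_mult)
qed

lemma Lp_space_diff:
  assumes "q \<ge> 0" "u \<in> Lp_space q \<Omega>" "v \<in> Lp_space q \<Omega>"
  shows "(\<lambda>x. u x - v x) \<in> Lp_space q \<Omega>"
  using Lp_space_add[OF assms(1,2) Lp_space_cmult[OF assms(3), of "-1"]] by simp

lemma zero_in_Lp_space: "(\<lambda>_. 0) \<in> Lp_space q \<Omega>"
  by (simp add: Lp_space_def)

text \<open>A null sequence is asymptotically disjoint from a fixed S. Indeed the positive part of
|S + w|^q - 2^q |w|^q - |S|^q is at most 2^q |S|^q and tends to 0 with w, so its integrals tend to 0 by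
dominated convergence. The factor 2^q is harmless in the application, where only a bound
independent of S matters.\<close>

lemma integral_powr_add_le:
  fixes S :: "'a::euclidean_space \<Rightarrow> real"
  assumes q: "q > 0" and S: "S \<in> Lp_space q \<Omega>" and w: "\<And>n. w n \<in> Lp_space q \<Omega>"
    and lim: "AE x in lebesgue_on \<Omega>. (\<lambda>n. w n x) \<longlonglongrightarrow> 0"
    and M: "\<And>n. (LINT x|lebesgue_on \<Omega>. \<bar>w n x\<bar> powr q) \<le> M"
  shows "\<exists>n. (LINT x|lebesgue_on \<Omega>. \<bar>S x + w n x\<bar> powr q) \<le> (LINT x|lebesgue_on \<Omega>. \<bar>S x\<bar> powr q) + (2 powr q * M + 1)"
proof -
  let ?N = "lebesgue_on \<Omega>"
  note S[THEN Lp_space_measurable, measurable] w[THEN Lp_space_measurable, measurable]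
  note iS = Lp_space_integrable[OF S] and iw = Lp_space_integrable[OF w]
  define f where "f n x = max 0 (\<bar>S x + w n x\<bar> powr q - 2 powr q * \<bar>w n x\<bar> powr q - \<bar>S x\<bar> powr q)" for n x
  have [measurable]: "f n \<in> borel_measurable ?N" for n unfolding f_def by measurable
  have f_le: "norm (f n x) \<le> 2 powr q * \<bar>S x\<bar> powr q" for n x
  proof -
    have "\<bar>S x + w n x\<bar> powr q \<le> 2 powr q * \<bar>S x\<bar> powr q + 2 powr q * \<bar>w n x\<bar> powr q"
      using powr_abs_add_le[of q "S x" "w n x"] q by (simp add: distrib_left)
    moreover have "\<bar>S x\<bar> powr q \<ge> 0" by simp
    ultimately have "\<bar>S x + w n x\<bar> powr q - 2 powr q * \<bar>w n x\<bar> powr q - \<bar>S x\<bar> powr q \<le> 2 powr q * \<bar>S x\<bar> powr q"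
      by linarith
    then show ?thesis by (simp add: f_def)
  qed
  have i2: "integrable ?N (\<lambda>x. 2 powr q * \<bar>S x\<bar> powr q)" using iS by simp
  have "(\<lambda>n. LINT x|?N. f n x) \<longlonglongrightarrow> (LINT x|?N. 0)"
  proof (rule integral_dominated_convergence[OF _ _ i2])
    show "AE x in ?N. (\<lambda>n. f n x) \<longlonglongrightarrow> 0"
      using lim
    proof eventually_elim
      case (elim x)
      have "(\<lambda>n. f n x) \<longlonglongrightarrow> max 0 (\<bar>S x + 0\<bar> powr q - 2 powr q * \<bar>0\<bar> powr q - \<bar>S x\<bar> powr q)"
        unfolding f_def
        by (intro tendsto_max tendsto_diff tendsto_mult tendsto_const tendsto_powr' tendsto_rabs tendsto_add elim)
          (use q in auto)
      then show ?case using q by simp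
    qed
    show "AE x in ?N. norm (f n x) \<le> 2 powr q * \<bar>S x\<bar> powr q" for n using f_le by simp
  qed auto
  then have "\<forall>\<^sub>F n in sequentially. (LINT x|?N. f n x) < 1" by (intro order_tendstoD) auto
  then obtain n where n: "(LINT x|?N. f n x) < 1" by (metis eventually_happens' sequentially_bot)
  have if_: "integrable ?N (f n)" by (rule Bochner_Integration.integrable_bound[OF i2]) (use f_le in auto)
  have "(LINT x|?N. \<bar>S x + w n x\<bar> powr q) \<le> (LINT x|?N. f n x + 2 powr q * \<bar>w n x\<bar> powr q + \<bar>S x\<bar> powr q)"
  proof (rule integral_mono)
    show "integrable ?N (\<lambda>x. \<bar>S x + w n x\<bar> powr q)"
      using Lp_space_integrable[OF Lp_space_add[OF _ S w]] q by simp
    show "integrable ?N (\<lambda>x. f n x + 2 powr q * \<bar>w n x\<bar> powr q + \<bar>S x\<bar> powr q)" using if_ iw iS by simp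
  qed (auto simp: f_def)
  also have "\<dots> = (LINT x|?N. f n x) + 2 powr q * (LINT x|?N. \<bar>w n x\<bar> powr q) + (LINT x|?N. \<bar>S x\<bar> powr q)"
    using if_ iw iS by simp
  also have "\<dots> \<le> 1 + 2 powr q * M + (LINT x|?N. \<bar>S x\<bar> powr q)"
    using n M[of n] by (intro add_mono mult_left_mono) auto
  finally show ?thesis by (intro exI[of _ n]) simp
qed

lemma not_all_nat_le_powr:
  fixes \<epsilon> C q :: real
  assumes "q > 1" "\<epsilon> > 0" "C \<ge> 0"
  shows "\<exists>n::nat. C * real n powr (1 / q) < real n * \<epsilon>"
proof -
  have "filterlim (\<lambda>n. real n powr (1 - 1 / q)) at_top sequentially"
    using assms by (intro filterlim_compose[OF real_powr_at_top filterlim_real_sequentially]) auto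
  then have "\<forall>\<^sub>F n in sequentially. C / \<epsilon> < real n powr (1 - 1 / q)" by (simp add: filterlim_at_top_dense)
  then have "\<forall>\<^sub>F n in sequentially. C / \<epsilon> < real n powr (1 - 1 / q) \<and> n > 0"
    using eventually_gt_at_top[of 0] by eventually_elim simp
  then obtain n where n: "C / \<epsilon> < real n powr (1 - 1 / q)" "n > 0"
    by (metis (no_types, lifting) eventually_happens' sequentially_bot)
  have "C * real n powr (1 / q) < (\<epsilon> * real n powr (1 - 1 / q)) * real n powr (1 / q)"
    using n assms by (intro mult_strict_right_mono) (auto simp: field_simps)
  also have "\<dots> = \<epsilon> * real n"
    using n by (simp add: mult.assoc powr_add[symmetric])
  finally show ?thesis by (auto simp: mult.commute)
qed

text \<open>Otherwise, after a change of signs, infinitely many members have value at least \<epsilon>. By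
integral_powr_add_le one can pick n of them one after the other so that the q-th power of the norm
of their sum is at most n C. The functional is at least n \<epsilon> on that sum but at most a
constant times n^(1/q), which is impossible for large n as q > 1.\<close>

lemma Lp_dual_null_sequence:
  fixes w :: "nat \<Rightarrow> 'a::euclidean_space \<Rightarrow> real"
  assumes q: "q > 1" and \<phi>: "\<phi> \<in> Lp_dual q \<Omega>" and w: "\<And>n. w n \<in> Lp_space q \<Omega>"
    and lim: "AE x in lebesgue_on \<Omega>. (\<lambda>n. w n x) \<longlonglongrightarrow> 0"
    and M: "\<And>n. (LINT x|lebesgue_on \<Omega>. \<bar>w n x\<bar> powr q) \<le> M"
  shows "(\<lambda>n. \<phi> (w n)) \<longlonglongrightarrow> 0"
proof (rule ccontr)
  let ?N = "lebesgue_on \<Omega>"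
  have add: "\<And>u v. u \<in> Lp_space q \<Omega> \<Longrightarrow> v \<in> Lp_space q \<Omega> \<Longrightarrow> \<phi> (\<lambda>x. u x + v x) = \<phi> u + \<phi> v"
    and scale: "\<And>u c. u \<in> Lp_space q \<Omega> \<Longrightarrow> \<phi> (\<lambda>x. c * u x) = c * \<phi> u"
    and "\<exists>K. \<forall>u\<in>Lp_space q \<Omega>. \<bar>\<phi> u\<bar> \<le> K * Lp_norm q \<Omega> u"
    using \<phi> by (auto simp: Lp_dual_def)
  then obtain K0 where K0: "\<And>u. u \<in> Lp_space q \<Omega> \<Longrightarrow> \<bar>\<phi> u\<bar> \<le> K0 * Lp_norm q \<Omega> u" by blast
  define K where "K = \<bar>K0\<bar>"
  have K: "\<bar>\<phi> u\<bar> \<le> K * Lp_norm q \<Omega> u" if "u \<in> Lp_space q \<Omega>" for u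
  proof -
    have "K0 * Lp_norm q \<Omega> u \<le> K * Lp_norm q \<Omega> u" by (intro mult_right_mono) (auto simp: K_def Lp_norm_def)
    then show ?thesis using K0[OF that] by linarith
  qed
  assume "\<not> (\<lambda>n. \<phi> (w n)) \<longlonglongrightarrow> 0"
  then obtain \<epsilon> where \<epsilon>: "\<epsilon> > 0" "\<not> (\<forall>\<^sub>F n in sequentially. \<bar>\<phi> (w n)\<bar> < \<epsilon>)"
    by (auto simp: tendsto_iff dist_real_def)
  define s where "s n x = sgn (\<phi> (w n)) * w n x" for n x
  have s: "s n \<in> Lp_space q \<Omega>" for n unfolding s_def by (rule Lp_space_cmult[OF w])
  have \<phi>s: "\<phi> (s n) = \<bar>\<phi> (w n)\<bar>" for n unfolding s_def using scale[OF w] by (simp add: sgn_if)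
  have s_le: "\<bar>s n x\<bar> \<le> \<bar>w n x\<bar>" for n x by (simp add: s_def abs_mult sgn_if)
  have s_int: "(LINT x|?N. \<bar>s n x\<bar> powr q) \<le> M" for n
  proof -
    have "(LINT x|?N. \<bar>s n x\<bar> powr q) \<le> (LINT x|?N. \<bar>w n x\<bar> powr q)"
      using q by (intro integral_mono Lp_space_integrable s w powr_mono2 s_le) auto
    then show ?thesis using M[of n] by linarith
  qed
  have s_lim: "AE x in ?N. (\<lambda>n. s n x) \<longlonglongrightarrow> 0"
    using lim
  proof eventually_elim
    case (elim x)
    show ?case
      by (rule Lim_null_comparison[OF _ tendsto_rabs_zero[OF elim]]) (use s_le in auto)
  qed
  have "\<exists>\<^sub>F n in sequentially. \<epsilon> \<le> \<phi> (s n)" using \<epsilon>(2) by (simp add: not_eventually \<phi>s not_less)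
  then obtain r :: "nat \<Rightarrow> nat" where r: "strict_mono r" "\<And>n. \<epsilon> \<le> \<phi> (s (r n))"
    using infinite_enumerate[of "{n. \<epsilon> \<le> \<phi> (s n)}"] by (auto simp: frequently_cofinite[symmetric] cofinite_eq_sequentially)
  have r_lim: "AE x in ?N. (\<lambda>n. s (r n) x) \<longlonglongrightarrow> 0"
    using s_lim by eventually_elim (use LIMSEQ_subseq_LIMSEQ[OF _ r(1)] in \<open>auto simp: o_def\<close>)
  define C where "C = 2 powr q * M + 1"
  have "(LINT x|?N. \<bar>w 0 x\<bar> powr q) \<ge> 0" by (rule integral_nonneg_AE) auto
  then have "M \<ge> 0" using M[of 0] by linarith
  then have C: "C \<ge> 0" by (simp add: C_def)
  have sums: "\<exists>S\<in>Lp_space q \<Omega>. real n * \<epsilon> \<le> \<phi> S \<and> (LINT x|?N. \<bar>S x\<bar> powr q) \<le> real n * C" for n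
  proof (induction n)
    case 0
    have "\<phi> (\<lambda>_. 0) = 0" using scale[OF zero_in_Lp_space, of 0] by simp
    then show ?case by (intro bexI[of _ "\<lambda>_. 0"] zero_in_Lp_space) auto
  next
    case (Suc n)
    then obtain S where S: "S \<in> Lp_space q \<Omega>" "real n * \<epsilon> \<le> \<phi> S" "(LINT x|?N. \<bar>S x\<bar> powr q) \<le> real n * C" by blast
    obtain k where k: "(LINT x|?N. \<bar>S x + s (r k) x\<bar> powr q) \<le> (LINT x|?N. \<bar>S x\<bar> powr q) + C"
      using integral_powr_add_le[OF _ S(1) s r_lim s_int] q unfolding C_def by auto
    show ?case
    proof (intro bexI[of _ "\<lambda>x. S x + s (r k) x"] conjI)
      show "(\<lambda>x. S x + s (r k) x) \<in> Lp_space q \<Omega>" using q by (intro Lp_space_add S s) auto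
      show "real (Suc n) * \<epsilon> \<le> \<phi> (\<lambda>x. S x + s (r k) x)"
        using add[OF S(1) s] S(2) r(2)[of k] by (simp add: distrib_right)
      show "(LINT x|?N. \<bar>S x + s (r k) x\<bar> powr q) \<le> real (Suc n) * C" using k S(3) by (simp add: distrib_right)
    qed
  qed
  obtain n where n: "(K * C powr (1 / q)) * real n powr (1 / q) < real n * \<epsilon>"
    using not_all_nat_le_powr[OF q \<epsilon>(1), of "K * C powr (1 / q)"] by (auto simp: K_def)
  obtain S where S: "S \<in> Lp_space q \<Omega>" "real n * \<epsilon> \<le> \<phi> S" "(LINT x|?N. \<bar>S x\<bar> powr q) \<le> real n * C"
    using sums by blast
  have "Lp_norm q \<Omega> S \<le> (real n * C) powr (1 / q)"
    unfolding Lp_norm_def using q S(3) by (intro powr_mono2) auto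
  also have "\<dots> = C powr (1 / q) * real n powr (1 / q)" using C by (simp add: powr_mult)
  finally have "K * Lp_norm q \<Omega> S \<le> (K * C powr (1 / q)) * real n powr (1 / q)"
    by (simp add: K_def mult.assoc mult_left_mono)
  moreover have "\<phi> S \<le> K * Lp_norm q \<Omega> S" using K[OF S(1)] by linarith
  ultimately show False using S(2) n by linarith
qed

lemma Lp_weak_tendsto_of_AE:
  fixes U :: "nat \<Rightarrow> 'a::euclidean_space \<Rightarrow> real"
  assumes q: "q > 1" and U: "\<And>n. U n \<in> Lp_space q \<Omega>" and u: "u \<in> Lp_space q \<Omega>"
    and lim: "AE x in lebesgue_on \<Omega>. (\<lambda>n. U n x) \<longlonglongrightarrow> u x"
    and M: "\<And>n. (LINT x|lebesgue_on \<Omega>. \<bar>U n x - u x\<bar> powr q) \<le> M"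
  shows "Lp_weak_tendsto q \<Omega> U u"
  unfolding Lp_weak_tendsto_def
proof
  fix \<phi> assume \<phi>: "\<phi> \<in> Lp_dual q \<Omega>"
  have w: "(\<lambda>x. U n x - u x) \<in> Lp_space q \<Omega>" for n using q by (intro Lp_space_diff U u) auto
  have "AE x in lebesgue_on \<Omega>. (\<lambda>n. U n x - u x) \<longlonglongrightarrow> 0"
    using lim by eventually_elim (simp add: LIM_zero_iff)
  from Lp_dual_null_sequence[OF q \<phi> w this M]
  have "(\<lambda>n. \<phi> (\<lambda>x. U n x - u x) + \<phi> u) \<longlonglongrightarrow> 0 + \<phi> u" by (intro tendsto_intros)
  moreover have "\<phi> (\<lambda>x. U n x - u x) + \<phi> u = \<phi> (U n)" for n
  proof -
    have "\<forall>u\<in>Lp_space q \<Omega>. \<forall>v\<in>Lp_space q \<Omega>. \<phi> (\<lambda>x. u x + v x) = \<phi> u + \<phi> v"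
      using \<phi> by (simp add: Lp_dual_def)
    from this[THEN bspec, OF w[of n], THEN bspec, OF u] show ?thesis by simp
  qed
  ultimately show "(\<lambda>n. \<phi> (U n)) \<longlonglongrightarrow> \<phi> u" by simp
qed

lemma Lp_tendsto_of_L1:
  fixes U :: "nat \<Rightarrow> 'a::euclidean_space \<Rightarrow> real"
  assumes q: "1 \<le> q" "q < p" and M: "M \<ge> 0"
    and [measurable]: "\<And>n. U n \<in> borel_measurable (lebesgue_on \<Omega>)" "u \<in> borel_measurable (lebesgue_on \<Omega>)"
    and L1: "\<And>e. e > 0 \<Longrightarrow> \<exists>n0. \<forall>n\<ge>n0. (\<integral>\<^sup>+x. ennreal \<bar>U n x - u x\<bar> \<partial>lebesgue_on \<Omega>) \<le> ennreal e"
    and Lp: "\<And>n. (\<integral>\<^sup>+x. ennreal (\<bar>U n x - u x\<bar> powr p) \<partial>lebesgue_on \<Omega>) \<le> ennreal M"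
  shows "Lp_tendsto q \<Omega> U u"
proof -
  let ?N = "lebesgue_on \<Omega>"
  let ?I = "\<lambda>n. LINT x|?N. \<bar>U n x - u x\<bar> powr q"
  have small: "\<exists>n0. \<forall>n\<ge>n0. ?I n \<le> e" if e: "e > 0" for e
  proof -
    have "((\<lambda>t. t powr (q - p) * M) \<longlongrightarrow> 0 * M) at_top"
      using q by (intro tendsto_mult tendsto_const tendsto_neg_powr filterlim_ident) auto
    then have "\<forall>\<^sub>F t in at_top. t powr (q - p) * M < e / 2" using e by (intro order_tendstoD) auto
    then obtain t0 where t0: "\<And>t. t \<ge> t0 \<Longrightarrow> t powr (q - p) * M < e / 2" by (auto simp: eventually_at_top_linorder)
    define t where "t = max t0 1"
    have t: "t > 0" "t powr (q - p) * M < e / 2" using t0[of t] by (auto simp: t_def)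
    define \<delta> where "\<delta> = e / 2 / t powr (q - 1)"
    have \<delta>: "\<delta> > 0" "t powr (q - 1) * \<delta> = e / 2" using e t by (auto simp: \<delta>_def)
    obtain n0 where n0: "\<And>n. n \<ge> n0 \<Longrightarrow> (\<integral>\<^sup>+x. ennreal \<bar>U n x - u x\<bar> \<partial>?N) \<le> ennreal \<delta>" using L1[OF \<delta>(1)] by blast
    have "?I n \<le> e" if n: "n \<ge> n0" for n
    proof -
      have "(\<integral>\<^sup>+x. ennreal (\<bar>U n x - u x\<bar> powr q) \<partial>?N) \<le>
          (\<integral>\<^sup>+x. ennreal (t powr (q - 1)) * ennreal \<bar>U n x - u x\<bar> + ennreal (t powr (q - p)) * ennreal (\<bar>U n x - u x\<bar> powr p) \<partial>?N)"
      proof (rule nn_integral_mono)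
        fix x
        from ennreal_leI[OF powr_interpolate[of "\<bar>U n x - u x\<bar>" t q p]]
        show "ennreal (\<bar>U n x - u x\<bar> powr q) \<le>
          ennreal (t powr (q - 1)) * ennreal \<bar>U n x - u x\<bar> + ennreal (t powr (q - p)) * ennreal (\<bar>U n x - u x\<bar> powr p)"
          using t q by (simp add: ennreal_mult)
      qed
      also have "\<dots> = ennreal (t powr (q - 1)) * (\<integral>\<^sup>+x. ennreal \<bar>U n x - u x\<bar> \<partial>?N)
          + ennreal (t powr (q - p)) * (\<integral>\<^sup>+x. ennreal (\<bar>U n x - u x\<bar> powr p) \<partial>?N)"
        by (simp add: nn_integral_add nn_integral_cmult)
      also have "\<dots> \<le> ennreal (t powr (q - 1)) * ennreal \<delta> + ennreal (t powr (q - p)) * ennreal M"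
        by (intro add_mono mult_left_mono n0[OF n] Lp) auto
      also have "\<dots> = ennreal (t powr (q - 1) * \<delta> + t powr (q - p) * M)"
        using \<delta>(1) M by (simp add: ennreal_mult)
      also have "\<dots> \<le> ennreal e" using t \<delta>(2) by (intro ennreal_leI) simp
      finally have le: "(\<integral>\<^sup>+x. ennreal (\<bar>U n x - u x\<bar> powr q) \<partial>?N) \<le> ennreal e" .
      have "?I n = enn2real (\<integral>\<^sup>+x. ennreal (\<bar>U n x - u x\<bar> powr q) \<partial>?N)"
        by (rule integral_eq_nn_integral) auto
      also have "\<dots> \<le> enn2real (ennreal e)" by (rule enn2real_mono[OF le]) simp
      finally show ?thesis using e by simp
    qed
    then show ?thesis by blast
  qed
  have "?I \<longlonglongrightarrow> 0"
  proof (rule LIMSEQ_I)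
    fix e :: real assume "e > 0"
    then obtain n0 where n0: "\<forall>n\<ge>n0. ?I n \<le> e / 2" using small[of "e / 2"] by auto
    have "?I n < e" if "n \<ge> n0" for n
      using n0[rule_format, OF that] \<open>e > 0\<close> by linarith
    then show "\<exists>no. \<forall>n\<ge>no. norm (?I n - 0) < e" by auto
  qed
  then have "(\<lambda>n. ?I n powr (1 / q)) \<longlonglongrightarrow> 0 powr (1 / q)"
    using q by (intro tendsto_powr') (auto intro!: always_eventually)
  then show ?thesis by (simp add: Lp_tendsto_def Lp_norm_def)
qed

section \<open>The direct method\<close>

text \<open>Along a minimizing sequence J cannot tend to infinity, since T would then tend to infinity too
while the infimum is finite. So J, and with it the BV norm, is bounded along a subsequence.\<close>

lemma minimizing_sequence_BV_bounded:
  fixes J T :: "('a::euclidean_space \<Rightarrow> real) \<Rightarrow> ereal"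
  assumes C: "C > 0" and JBV: "\<forall>u\<in>Lp_space q \<Omega>. BV_norm \<Omega> u \<le> ereal C * J u"
    and coer: "CBV_coercive q \<Omega> J T" and fin: "\<exists>u\<in>Lp_space q \<Omega>. T u < \<infinity>"
  shows "\<exists>U B. (\<forall>n. U n \<in> Lp_space q \<Omega>) \<and> (\<forall>n. BV_norm \<Omega> (U n) \<le> ereal B) \<and>
    (\<lambda>n. T (U n)) \<longlonglongrightarrow> (INF u\<in>Lp_space q \<Omega>. T u)"
proof -
  define m where "m = (INF u\<in>Lp_space q \<Omega>. T u)"
  have "T ` Lp_space q \<Omega> \<noteq> {}" using zero_in_Lp_space by blast
  from Inf_as_limit[OF this] obtain f where f: "\<And>n. f n \<in> T ` Lp_space q \<Omega>" "f \<longlonglongrightarrow> m"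
    unfolding m_def by blast
  from f(1) have "\<forall>n. \<exists>u\<in>Lp_space q \<Omega>. T u = f n" by (metis imageE)
  then obtain V where V: "\<And>n. V n \<in> Lp_space q \<Omega>" "\<And>n. T (V n) = f n" by metis
  have TV: "(\<lambda>n. T (V n)) \<longlonglongrightarrow> m" using f(2) by (simp add: V(2))
  have "m < \<infinity>" using fin INF_lower[of _ "Lp_space q \<Omega>" T] unfolding m_def by (meson le_less_trans)
  then have "\<not> (\<lambda>n. T (V n)) \<longlonglongrightarrow> \<infinity>" using TV LIMSEQ_unique by blast
  then have "\<not> (\<lambda>n. J (V n)) \<longlonglongrightarrow> \<infinity>" using coer V(1) unfolding CBV_coercive_def by blast
  then obtain b :: real where "\<not> (\<forall>\<^sub>F n in sequentially. ereal b < J (V n))"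
    by (auto simp: tendsto_PInfty)
  then have "\<exists>\<^sub>F n in sequentially. J (V n) \<le> ereal b" by (simp add: not_eventually not_less)
  then obtain r :: "nat \<Rightarrow> nat" where r: "strict_mono r" "\<And>n. J (V (r n)) \<le> ereal b"
    using infinite_enumerate[of "{n. J (V n) \<le> ereal b}"] by (auto simp: frequently_cofinite[symmetric] cofinite_eq_sequentially)
  have "BV_norm \<Omega> (V (r n)) \<le> ereal (C * b)" for n
  proof -
    have "BV_norm \<Omega> (V (r n)) \<le> ereal C * J (V (r n))" using JBV V(1) by blast
    also have "\<dots> \<le> ereal C * ereal b" using C r(2) by (intro ereal_mult_left_mono) auto
    finally show ?thesis by simp
  qed
  moreover have "(\<lambda>n. T (V (r n))) \<longlonglongrightarrow> m" using LIMSEQ_subseq_LIMSEQ[OF TV r(1)] by (simp add: o_def)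
  ultimately show ?thesis using V(1) unfolding m_def by (intro exI[of _ "\<lambda>n. V (r n)"] exI[of _ "C * b"]) auto
qed

text \<open>Both cases of semicontinuity are treated together: the subsequence from BV_compact converges strongly in
L^q below the exponent 1 / (1 - \<theta>) and weakly at this exponent.\<close>

lemma BV_direct_method:
  fixes \<Omega> :: "'a::euclidean_space set" and J T :: "('a \<Rightarrow> real) \<Rightarrow> ereal"
  assumes dom: "bounded_lipschitz_domain \<Omega>"
    and C: "C > 0" and JBV: "\<forall>u\<in>Lp_space q \<Omega>. BV_norm \<Omega> u \<le> ereal C * J u"
    and coer: "CBV_coercive q \<Omega> J T"
    and \<theta>: "0 < \<theta>" "\<theta> < 1" "\<theta> \<le> 1 / DIM('a)" and q: "1 \<le> q" and qp: "q \<le> 1 / (1 - \<theta>)"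
    and lsc: "(q < 1 / (1 - \<theta>) \<and> Lp_lsc q \<Omega> T) \<or> (q = 1 / (1 - \<theta>) \<and> Lp_weakly_lsc q \<Omega> T)"
  shows "\<exists>u. Lp_minimizer q \<Omega> T u"
proof (cases "\<exists>u\<in>Lp_space q \<Omega>. T u < \<infinity>")
  case False
  then have "T u = \<infinity>" if "u \<in> Lp_space q \<Omega>" for u using that by auto
  then show ?thesis using zero_in_Lp_space by (intro exI[of _ "\<lambda>_. 0"]) (auto simp: Lp_minimizer_def)
next
  case True
  let ?N = "lebesgue_on \<Omega>"
  define p where "p = 1 / (1 - \<theta>)"
  have p: "p > 1" using \<theta> by (simp add: p_def)
  obtain U B where U: "\<And>n. U n \<in> Lp_space q \<Omega>" "\<And>n. BV_norm \<Omega> (U n) \<le> ereal B"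
    and TU: "(\<lambda>n. T (U n)) \<longlonglongrightarrow> (INF u\<in>Lp_space q \<Omega>. T u)"
    using minimizing_sequence_BV_bounded[OF C JBV coer True] by blast
  obtain r u M where r: "strict_mono r" and M: "0 \<le> M" and um [measurable]: "u \<in> borel_measurable ?N"
    and lim: "AE x in ?N. (\<lambda>n. U (r n) x) \<longlonglongrightarrow> u x"
    and L1: "\<forall>e>0. \<exists>n0. \<forall>n\<ge>n0. (\<integral>\<^sup>+x. ennreal \<bar>U (r n) x - u x\<bar> \<partial>?N) \<le> ennreal e"
    and UM: "\<And>n. (\<integral>\<^sup>+x. ennreal (\<bar>U (r n) x\<bar> powr p) \<partial>?N) \<le> ennreal M"
    and uM: "(\<integral>\<^sup>+x. ennreal (\<bar>u x\<bar> powr p) \<partial>?N) \<le> ennreal M"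
    using BV_compact[where U=U, OF dom U(2) \<theta>] unfolding p_def[symmetric] by blast
  note U(1)[THEN Lp_space_measurable, measurable]
  define M' where "M' = 2 powr p * (2 * M)"
  have M': "M' \<ge> 0" using M by (simp add: M'_def)
  have dM: "(\<integral>\<^sup>+x. ennreal (\<bar>U (r n) x - u x\<bar> powr p) \<partial>?N) \<le> ennreal M'" for n
    unfolding M'_def using p M UM uM by (intro nn_integral_diff_powr_le) auto
  have finN: "emeasure ?N (space ?N) < \<infinity>"
  proof -
    have "bounded \<Omega>" "open \<Omega>" using dom by (auto simp: bounded_lipschitz_domain_def)
    then show ?thesis using emeasure_bounded_finite[of \<Omega>] by (simp add: emeasure_restrict_space)
  qed
  have uL: "u \<in> Lp_space q \<Omega>"
    unfolding Lp_space_iff_nn_integral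
  proof
    have "(\<integral>\<^sup>+x. ennreal (\<bar>u x\<bar> powr q) \<partial>?N) \<le> (\<integral>\<^sup>+x. 1 + ennreal (\<bar>u x\<bar> powr p) \<partial>?N)"
    proof (rule nn_integral_mono)
      fix x
      have "\<bar>u x\<bar> powr q \<le> 1 + \<bar>u x\<bar> powr p"
      proof (cases "\<bar>u x\<bar> \<le> 1")
        case True
        then have "\<bar>u x\<bar> powr q \<le> 1" using q by (intro powr_le1) auto
        then show ?thesis by (simp add: add_increasing2)
      next
        case False
        then have "\<bar>u x\<bar> powr q \<le> \<bar>u x\<bar> powr p" using qp by (intro powr_mono) (auto simp: p_def)
        then show ?thesis by simp
      qed
      from ennreal_leI[OF this] show "ennreal (\<bar>u x\<bar> powr q) \<le> 1 + ennreal (\<bar>u x\<bar> powr p)" by simp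
    qed
    also have "\<dots> = emeasure ?N (space ?N) + (\<integral>\<^sup>+x. ennreal (\<bar>u x\<bar> powr p) \<partial>?N)" by (simp add: nn_integral_add)
    also have "\<dots> < \<infinity>" using finN uM by (auto intro: le_less_trans)
    finally show "(\<integral>\<^sup>+x. ennreal (\<bar>u x\<bar> powr q) \<partial>?N) < \<infinity>" .
  qed simp
  have "T u \<le> liminf (\<lambda>n. T (U (r n)))"
    using lsc
  proof
    assume a: "q < 1 / (1 - \<theta>) \<and> Lp_lsc q \<Omega> T"
    have "Lp_tendsto q \<Omega> (\<lambda>n. U (r n)) u"
      by (rule Lp_tendsto_of_L1[OF q _ M' _ um _ dM]) (use a L1 in \<open>auto simp: p_def\<close>)
    moreover from a[THEN conjunct2, unfolded Lp_lsc_def, THEN spec, of "\<lambda>n. U (r n)", THEN bspec, OF uL]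
    have "Lp_tendsto q \<Omega> (\<lambda>n. U (r n)) u \<longrightarrow> T u \<le> liminf (\<lambda>n. T (U (r n)))" using U(1) by simp
    ultimately show ?thesis by simp
  next
    assume a: "q = 1 / (1 - \<theta>) \<and> Lp_weakly_lsc q \<Omega> T"
    then have qp': "q = p" by (simp add: p_def)
    have "(LINT x|?N. \<bar>U (r n) x - u x\<bar> powr q) \<le> M'" for n
    proof -
      have "(LINT x|?N. \<bar>U (r n) x - u x\<bar> powr q) = enn2real (\<integral>\<^sup>+x. ennreal (\<bar>U (r n) x - u x\<bar> powr q) \<partial>?N)"
        by (rule integral_eq_nn_integral) auto
      also have "\<dots> \<le> enn2real (ennreal M')" unfolding qp' by (rule enn2real_mono[OF dM]) simp
      finally show ?thesis using M' by simp
    qed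
    then have "Lp_weak_tendsto q \<Omega> (\<lambda>n. U (r n)) u"
      using p qp' by (intro Lp_weak_tendsto_of_AE U uL lim) auto
    moreover from a[THEN conjunct2, unfolded Lp_weakly_lsc_def, THEN spec, of "\<lambda>n. U (r n)", THEN bspec, OF uL]
    have "Lp_weak_tendsto q \<Omega> (\<lambda>n. U (r n)) u \<longrightarrow> T u \<le> liminf (\<lambda>n. T (U (r n)))" using U(1) by simp
    ultimately show ?thesis by simp
  qed
  also have "liminf (\<lambda>n. T (U (r n))) = (INF u\<in>Lp_space q \<Omega>. T u)"
    using LIMSEQ_subseq_LIMSEQ[OF TU r] by (intro lim_imp_Liminf) (auto simp: o_def)
  finally have "T u \<le> T v" if "v \<in> Lp_space q \<Omega>" for v using that by (meson INF_lower order_trans)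
  then show ?thesis using uL by (auto simp: Lp_minimizer_def)
qed

text \<open>Properness makes the minimum finite, so strict convexity applies to the midpoint of two minimizers.\<close>

lemma strictly_convex_minimizer_unique:
  fixes T :: "('a::euclidean_space \<Rightarrow> real) \<Rightarrow> ereal"
  assumes q: "q \<ge> 0" and F: "Lp_functional q \<Omega> T" and conv: "Lp_strictly_convex q \<Omega> T" and pr: "Lp_proper q \<Omega> T"
    and u: "Lp_minimizer q \<Omega> T u" and v: "Lp_minimizer q \<Omega> T v"
  shows "ae_eq \<Omega> u v"
proof (rule ccontr)
  assume ne: "\<not> ae_eq \<Omega> u v"
  have uL: "u \<in> Lp_space q \<Omega>" and vL: "v \<in> Lp_space q \<Omega>" using u v by (auto simp: Lp_minimizer_def)
  have eq: "T u = T v" using u v uL vL by (auto simp: Lp_minimizer_def intro: antisym)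
  obtain w where "w \<in> Lp_space q \<Omega>" "T w < \<infinity>" using pr by (auto simp: Lp_proper_def)
  then have fin: "T u < \<infinity>" using u by (auto simp: Lp_minimizer_def intro: le_less_trans)
  have "T u \<noteq> -\<infinity>" using F uL by (auto simp: Lp_functional_def)
  then obtain t where t: "T u = ereal t" using fin by (cases "T u") auto
  have "T (\<lambda>x. (1/2) * u x + (1 - 1/2) * v x) < ereal (1/2) * T u + ereal (1 - 1/2) * T v"
  proof -
    have "(1/2 :: real) \<in> {0<..<1}" by simp
    from conv[unfolded Lp_strictly_convex_def, THEN bspec, OF uL, THEN bspec, OF vL, THEN bspec, OF this]
    show ?thesis using ne fin eq by simp
  qed
  also have "\<dots> = T u" by (simp add: eq[symmetric] t)
  finally have "T (\<lambda>x. (1/2) * u x + (1 - 1/2) * v x) < T u" .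
  moreover have "(\<lambda>x. (1/2) * u x + (1 - 1/2) * v x) \<in> Lp_space q \<Omega>"
    using q by (intro Lp_space_add Lp_space_cmult uL vL)
  ultimately show False using u by (auto simp: Lp_minimizer_def not_less[symmetric])
qed

theorem theorem2p1:
  fixes \<Omega> :: "'a::euclidean_space set"
    and q C :: real
    and J T :: "('a \<Rightarrow> real) \<Rightarrow> ereal"
  assumes "bounded_lipschitz_domain \<Omega>"
    and "Lp_functional q \<Omega> J"
    and "C > 0"
    and "\<forall>u\<in>Lp_space q \<Omega>. BV_norm \<Omega> u \<le> ereal C * J u"
    and "Lp_functional q \<Omega> T"
    and "CBV_coercive q \<Omega> J T"
  shows "(1 \<le> q \<and> ereal q < critical_exponent DIM('a) \<and> Lp_lsc q \<Omega> T \<longrightarrow>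
            (\<exists>u. Lp_minimizer q \<Omega> T u)) \<and>
         (ereal q = critical_exponent DIM('a) \<and> DIM('a) \<ge> 2 \<and> Lp_weakly_lsc q \<Omega> T \<longrightarrow>
            (\<exists>u. Lp_minimizer q \<Omega> T u)) \<and>
         ((1 \<le> q \<and> ereal q < critical_exponent DIM('a) \<and> Lp_lsc q \<Omega> T) \<or>
          (ereal q = critical_exponent DIM('a) \<and> DIM('a) \<ge> 2 \<and> Lp_weakly_lsc q \<Omega> T) \<longrightarrow>
            Lp_strictly_convex q \<Omega> T \<longrightarrow> Lp_proper q \<Omega> T \<longrightarrow>
            (\<forall>u v. Lp_minimizer q \<Omega> T u \<longrightarrow> Lp_minimizer q \<Omega> T v \<longrightarrow> ae_eq \<Omega> u v))"
proof (intro conjI impI allI)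
  assume a: "1 \<le> q \<and> ereal q < critical_exponent DIM('a) \<and> Lp_lsc q \<Omega> T"
  show "\<exists>u. Lp_minimizer q \<Omega> T u"
  proof (cases "DIM('a) = 1")
    case True
    (* In dimension 1 any exponent above q is available; \<theta> = q / (q + 1) gives q + 1. *)
    have "1 / (1 - q / (q + 1)) = q + 1" using a by (simp add: field_simps)
    then show ?thesis using a True
      by (intro BV_direct_method[OF assms(1,3,4,6), of "q / (q + 1)"]) (auto simp: field_simps)
  next
    case False
    have d: "real DIM('a) > 1" using False DIM_positive[where 'a='a] by linarith
    have "1 / (1 - 1 / real DIM('a)) = real DIM('a) / (real DIM('a) - 1)" using d by (simp add: field_simps)
    then show ?thesis using a False d
      by (intro BV_direct_method[OF assms(1,3,4,6), of "1 / real DIM('a)"]) (auto simp: critical_exponent_def)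
  qed
next
  assume a: "ereal q = critical_exponent DIM('a) \<and> DIM('a) \<ge> 2 \<and> Lp_weakly_lsc q \<Omega> T"
  then have d: "real DIM('a) > 1" by linarith
  have q: "q = real DIM('a) / (real DIM('a) - 1)" using a d by (auto simp: critical_exponent_def split: if_splits)
  have "1 / (1 - 1 / real DIM('a)) = q" unfolding q using d by (simp add: field_simps)
  moreover have "q > 1" unfolding q using d by (simp add: field_simps)
  ultimately show "\<exists>u. Lp_minimizer q \<Omega> T u" using a d
    by (intro BV_direct_method[OF assms(1,3,4,6), of "1 / real DIM('a)"]) auto
next
  fix u v
  assume a: "(1 \<le> q \<and> ereal q < critical_exponent DIM('a) \<and> Lp_lsc q \<Omega> T) \<or>
      (ereal q = critical_exponent DIM('a) \<and> DIM('a) \<ge> 2 \<and> Lp_weakly_lsc q \<Omega> T)"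
    and conv: "Lp_strictly_convex q \<Omega> T" "Lp_proper q \<Omega> T" and uv: "Lp_minimizer q \<Omega> T u" "Lp_minimizer q \<Omega> T v"
  have "q \<ge> 0" using a by (auto simp: critical_exponent_def split: if_splits)
  from strictly_convex_minimizer_unique[OF this assms(5) conv uv] show "ae_eq \<Omega> u v" .
qed

end
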